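(* Let $F_{31}:=(6,\{02,03,12,13,45\})$. Then $\lambda_{F_{31}}=10/81$. Furthermore, the $F_{31}$-problem is perfectly $B$-stable with $B:=(3,\{00,12\})$, and the unique (up to automorphisms of $B$) maximiser of $p(F_{31},B(\boldsymbol x))$ over $\boldsymbol x\in\mathbb S_3$ is $\boldsymbol x=(1/3,1/3,1/3)$.
   Context: All graphs are finite and simple. $(m,E)$ denotes the graph or pattern with vertex set $\{0,\dots,m-1\}$ and edge set $E$; $ij$ abbreviates $\{i,j\}$ ($ii$ is a loop). For graphs $F,G$ with $\kappa\le n$ vertices, $p(F,G)$ is the number of $\kappa$-subsets of $V(G)$ inducing a subgraph isomorphic to $F$, divided by $\binom n\kappa$; $p(F,n)$ is the maximum of $p(F,G)$ over $n$-vertex graphs $G$; $\lambda_F=\lim_{n\to\infty}p(F,n)$ (the limit exists). A pattern is a graph in which loops are allowed; its automorphisms are the bijections of the vertex set preserving edges, non-edges, loops and non-loops. For a pattern $B$ on $\{0,\dots,m-1\}$ and disjoint (possibly empty) sets $V_0,\dots,V_{m-1}$, the blowup $B(V_0,\dots,V_{m-1})$ is the simple graph on $\bigcup V_i$ in which distinct $x\in V_i$, $y\in V_j$ are adjacent iff $\{i,j\}\in E(B)$ (so $V_i$ is a clique if $i$ has a loop and independent otherwise); $B()$ is the family of all blowups. $\mathbb S_m=\{\boldsymbol x\in\mathbb R^m:x_i\ge0,\sum x_i=1\}$, and $p(F,B(\boldsymbol x))$ is the limit as $n\to\infty$ of $p(F,B(V_0,\dots,V_{m-1}))$ with $|V_i|=(x_i+o(1))n$.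 $\delta_{\mathrm{edit}}(G,B())$ is the minimum number of vertex pairs whose adjacency must be changed to turn $G$ into a graph isomorphic to a blowup of $B$ (of the same order). The $F$-problem is perfectly $B$-stable if there is $C>0$ such that every graph $G$ with $n\ge C$ vertices satisfies $\delta_{\mathrm{edit}}(G,B())\le C\,(p(F,n)-p(F,G))\,n^2$. *)

theory Defs
  imports Complex_Main "HOL-Library.Disjoint_Sets"
begin

text \<open>A pattern is a vertex set with a set of edges; the edge \<open>ij\<close> is the set \<open>{i, j}\<close>, so that
  the loop \<open>ii\<close> is the singleton \<open>{i}\<close>. Graphs are the loopless patterns.\<close>

type_synonym 'a pattern = "'a set \<times> 'a set set"

abbreviation verts :: "'a pattern \<Rightarrow> 'a set" where "verts \<equiv> fst"
abbreviation edges :: "'a pattern \<Rightarrow> 'a set set" where "edges \<equiv> snd"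

definition simple_graph :: "'a pattern \<Rightarrow> bool" where
  "simple_graph G \<longleftrightarrow> finite (verts G) \<and> (\<forall>e\<in>edges G. e \<subseteq> verts G \<and> card e = 2)"

text \<open>The case \<open>x = y\<close> below says that loops and non-loops are preserved.\<close>

definition pattern_iso :: "('a \<Rightarrow> 'b) \<Rightarrow> 'a pattern \<Rightarrow> 'b pattern \<Rightarrow> bool" where
  "pattern_iso f G H \<longleftrightarrow> bij_betw f (verts G) (verts H) \<and>
     (\<forall>x\<in>verts G. \<forall>y\<in>verts G. {x, y} \<in> edges G \<longleftrightarrow> {f x, f y} \<in> edges H)"

definition isomorphic :: "'a pattern \<Rightarrow> 'b pattern \<Rightarrow> bool" where
  "isomorphic G H \<longleftrightarrow> (\<exists>f. pattern_iso f G H)"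

definition pattern_aut :: "'a pattern \<Rightarrow> ('a \<Rightarrow> 'a) \<Rightarrow> bool" where
  "pattern_aut B f \<longleftrightarrow> pattern_iso f B B"

definition induced :: "'a pattern \<Rightarrow> 'a set \<Rightarrow> 'a pattern" where
  "induced G S = (S, {e \<in> edges G. e \<subseteq> S})"

text \<open>\<open>p(F, G)\<close>. If \<open>G\<close> has fewer vertices than \<open>F\<close>, the value is \<open>0 / 0 = 0\<close>.\<close>

definition induced_density :: "'a pattern \<Rightarrow> 'b pattern \<Rightarrow> real" where
  "induced_density F G =
     real (card {S. S \<subseteq> verts G \<and> card S = card (verts F) \<and> isomorphic (induced G S) F}) /
     real (card (verts G) choose card (verts F))"

text \<open>\<open>p(F, n)\<close>. Here and below the host graphs have natural numbers as vertices; every finite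
  graph is isomorphic to such a graph.\<close>

definition max_density :: "'a pattern \<Rightarrow> nat \<Rightarrow> real" where
  "max_density F n =
     Max {induced_density F G | G :: nat pattern. simple_graph G \<and> card (verts G) = n}"

text \<open>\<open>\<lambda>\<^sub>F\<close>\<close>

definition inducibility :: "'a pattern \<Rightarrow> real" where
  "inducibility F = lim (max_density F)"

definition blowup :: "'b pattern \<Rightarrow> ('b \<Rightarrow> 'a set) \<Rightarrow> 'a pattern" where
  "blowup B V =
     (\<Union>i\<in>verts B. V i,
      {{x, y} | x y. x \<noteq> y \<and>
         (\<exists>i\<in>verts B. \<exists>j\<in>verts B. x \<in> V i \<and> y \<in> V j \<and> {i, j} \<in> edges B)})"

definition blowup_parts :: "'b pattern \<Rightarrow> ('b \<Rightarrow> 'a set) \<Rightarrow> bool" where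
  "blowup_parts B V \<longleftrightarrow> (\<forall>i\<in>verts B. finite (V i)) \<and> disjoint_family_on V (verts B)"

definition blowups :: "'b pattern \<Rightarrow> 'a pattern set" where
  "blowups B = {blowup B V | V. blowup_parts B V}"

definition edit_distance :: "nat pattern \<Rightarrow> 'b pattern \<Rightarrow> nat" where
  "edit_distance G B =
     Min {card ((edges G - edges H) \<union> (edges H - edges G)) | H.
       simple_graph H \<and> verts H = verts G \<and>
       (\<exists>K :: nat pattern. K \<in> blowups B \<and> isomorphic H K)}"

definition perfectly_stable :: "'a pattern \<Rightarrow> 'b pattern \<Rightarrow> bool" where
  "perfectly_stable F B \<longleftrightarrow>
     (\<exists>C :: real. C > 0 \<and>
       (\<forall>G :: nat pattern. simple_graph G \<and> real (card (verts G)) \<ge> C \<longrightarrow>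
          real (edit_distance G B) \<le>
            C * (max_density F (card (verts G)) - induced_density F G) * (real (card (verts G)))\<^sup>2))"

text \<open>The elements of \<open>\<real>\<^sup>m\<close> are represented as functions vanishing outside \<open>{0,\<dots>,m-1}\<close>.\<close>

definition unit_simplex :: "nat \<Rightarrow> (nat \<Rightarrow> real) set" where
  "unit_simplex m = {x. (\<forall>i<m. 0 \<le> x i) \<and> (\<forall>i\<ge>m. x i = 0) \<and> (\<Sum>i<m. x i) = 1}"

text \<open>\<open>p(F, B(x))\<close>: the common limit of \<open>p(F, B(V\<^sub>0,\<dots>,V\<^sub>m\<^sub>-\<^sub>1))\<close> along all sequences of
  parts with \<open>|V\<^sub>i| = (x\<^sub>i + o(1)) n\<close>.\<close>

definition blowup_density :: "'a pattern \<Rightarrow> 'b pattern \<Rightarrow> ('b \<Rightarrow> real) \<Rightarrow> real" where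
  "blowup_density F B x =
     (THE L. \<forall>V :: nat \<Rightarrow> 'b \<Rightarrow> nat set.
        (\<forall>n. blowup_parts B (V n)) \<and>
        (\<forall>i\<in>verts B. (\<lambda>n. real (card (V n i)) / real n) \<longlonglongrightarrow> x i) \<longrightarrow>
        (\<lambda>n. induced_density F (blowup B (V n))) \<longlonglongrightarrow> L)"

definition F31 :: "nat pattern" where
  "F31 = ({0..<6}, {{0,2}, {0,3}, {1,2}, {1,3}, {4,5}})"

definition B31 :: "nat pattern" where
  "B31 = ({0..<3}, {{0,0}, {1,2}})"

definition barycentre :: "nat \<Rightarrow> real" where
  "barycentre = (\<lambda>i. if i < 3 then 1/3 else 0)"

end

theory Submission
  imports Defs "HOL-Combinatorics.Multiset_Permutations" "HOL-Library.FuncSet"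
begin

text \<open>The graph \<open>F31\<close> is the disjoint union of a 4-cycle (parts \<open>{0, 1}\<close> and \<open>{2, 3}\<close>) and an edge. In a
  blowup of \<open>B31\<close>, a clique beside a complete bipartite graph, the 4-cycle sits in the bipartite part
  and the edge in the clique, so a blowup with parts of sizes \<open>x\<^sub>0 n, x\<^sub>1 n, x\<^sub>2 n\<close> has density
  \<open>90 (x\<^sub>0 x\<^sub>1 x\<^sub>2)\<^sup>2\<close> in the limit. By the inequality of the means this is largest, namely \<open>10/81\<close>,
  at the barycentre only.

  The matching upper bound is a sum-of-squares (flag algebra) certificate. Fix two root vertices in
  a graph and classify the remaining pairs of vertices by their adjacencies to the roots and to
  each other; for a positive semidefinite quadratic form in the frequencies of these classes, the
  sum over all pairs of pairs is nonnegative. There is one form for adjacent and one for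
  non-adjacent roots. Added to a multiple of the number of copies and averaged over the orders of
  six vertices, they give at most a constant, for every graph on six vertices (\<open>check_all\<close>,
  \<open>sum_excess_le\<close>). Summing over all maps of six points into the vertex set, injective or not,
  makes this a bound on copies without error terms (\<open>copies_bound\<close>). The certificate is slack by at least one
  unit on each six-vertex graph that is not a blowup.

  That slack gives stability. In a graph with nearly \<open>2/729 n\<^sup>6\<close> embeddings of \<open>F31\<close>, almost all
  six-tuples of vertices induce blowups. A path on three vertices together with an isolated
  vertex determines its colouring by parts up to a symmetry of \<open>B31\<close>, and then determines the part of
  each further vertex; so such a graph is within a small multiple of \<open>n\<^sup>2\<close> edits of a blowup
  (\<open>close_to_blowup\<close>).

  Perfect stability is a local-optimality argument (\<open>extremal_graphs_are_blowups\<close>). Among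
  all graphs on \<open>V\<close>, let \<open>E\<close> maximise the number of embeddings plus a tiny multiple of \<open>n\<^sup>4\<close> times the
  distance to the blowups. Then \<open>E\<close> is close to a blowup; take the best colouring by the parts. By
  maximality each vertex lies in nearly as many copies as it would if it were attached like a vertex
  of some part, which forces its neighbourhood to agree with that of a part except in a small
  proportion (\<open>nearly_best_attachment\<close>). Finally, if a pair disagreed with the colouring, it would lie
  in hardly any copy, because a copy with exactly one disagreeing pair does not exist
  (\<open>one_disagreement_impossible\<close>), whereas correcting it creates of the order of \<open>n\<^sup>4\<close> copies
  (\<open>card_emb_flip_pair\<close>), more than the distance term can lose. So \<open>E\<close> is a blowup, its
  distance term vanishes, and comparing the maximum with an arbitrary graph is perfect stability.\<close>

section \<open>The certificate on six vertices\<close>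

text \<open>The class of an unordered pair \<open>{v, w}\<close> relative to two roots \<open>p, q\<close>. The first letter says whether \<open>vw\<close>
  is an edge; the other two say to which roots the two vertices are adjacent: none (\<open>Z\<close>), only \<open>p\<close>
  (\<open>P\<close>), only \<open>q\<close> (\<open>Q\<close>) or both (\<open>R\<close>).\<close>

datatype flag =
  NZZ | NZP | NZQ | NZR | NPP | NPQ | NPR | NQQ | NQR | NRR | EZZ | EZP | EZQ | EZR | EPP |
  EPQ | EPR | EQQ | EQR | ERR

text \<open>The arguments are the adjacencies \<open>pv, qv, pw, qw, vw\<close>. All cases are listed, so that
  the evaluation of a flag is a single rewrite step.\<close>

fun flag_of :: "bool \<Rightarrow> bool \<Rightarrow> bool \<Rightarrow> bool \<Rightarrow> bool \<Rightarrow> flag" where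
  "flag_of True True True True True = ERR"
| "flag_of True True True True False = NRR"
| "flag_of True True True False True = EPR"
| "flag_of True True True False False = NPR"
| "flag_of True True False True True = EQR"
| "flag_of True True False True False = NQR"
| "flag_of True True False False True = EZR"
| "flag_of True True False False False = NZR"
| "flag_of True False True True True = EPR"
| "flag_of True False True True False = NPR"
| "flag_of True False True False True = EPP"
| "flag_of True False True False False = NPP"
| "flag_of True False False True True = EPQ"
| "flag_of True False False True False = NPQ"
| "flag_of True False False False True = EZP"
| "flag_of True False False False False = NZP"
| "flag_of False True True True True = EQR"
| "flag_of False True True True False = NQR"
| "flag_of False True True False True = EPQ"
| "flag_of False True True False False = NPQ"
| "flag_of False True False True True = EQQ"
| "flag_of False True False True False = NQQ"
| "flag_of False True False False True = EZQ"
| "flag_of False True False False False = NZQ"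
| "flag_of False False True True True = EZR"
| "flag_of False False True True False = NZR"
| "flag_of False False True False True = EZP"
| "flag_of False False True False False = NZP"
| "flag_of False False False True True = EZQ"
| "flag_of False False False True False = NZQ"
| "flag_of False False False False True = EZZ"
| "flag_of False False False False False = NZZ"

text \<open>The quadratic form for non-adjacent roots. Its entries come from a numerically solved semidefinite
  program, rounded so that the finite check below is exact at the blowups.\<close>

definition nonedge_gram :: "flag \<Rightarrow> flag \<Rightarrow> int" where
  "nonedge_gram c d = (case c of
      NZZ \<Rightarrow> (case d of NZZ \<Rightarrow> 160 | NZP \<Rightarrow> 148 | NZQ \<Rightarrow> 148 | NZR \<Rightarrow> -72 | NPP
        \<Rightarrow> 104 | NPQ \<Rightarrow> 238 | NQQ \<Rightarrow> 104 | NRR \<Rightarrow> 188 | EZZ \<Rightarrow>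
        -524 | EZP \<Rightarrow> -500 | EZQ \<Rightarrow> -500 | EPP \<Rightarrow> -36 | EQQ \<Rightarrow> -36 | _
        \<Rightarrow> 0)
    | NZP \<Rightarrow> (case d of NZZ \<Rightarrow> 148 | NZP \<Rightarrow> 1280 | NZQ \<Rightarrow> -952 | NZR \<Rightarrow> -108 | NPP
        \<Rightarrow> 1776 | NPQ \<Rightarrow> 112 | NQQ \<Rightarrow> -1944 | NRR \<Rightarrow> 92 | EZZ
        \<Rightarrow> -320 | EZP \<Rightarrow> -684 | EZQ \<Rightarrow> 60 | EPP \<Rightarrow> -1108 | EQQ
        \<Rightarrow> 1124 | _ \<Rightarrow> 0)
    | NZQ \<Rightarrow> (case d of NZZ \<Rightarrow> 148 | NZP \<Rightarrow> -952 | NZQ \<Rightarrow> 1280 | NZR \<Rightarrow> -108 | NPP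
        \<Rightarrow> -1944 | NPQ \<Rightarrow> 112 | NQQ \<Rightarrow> 1776 | NRR \<Rightarrow> 92 | EZZ
        \<Rightarrow> -320 | EZP \<Rightarrow> 60 | EZQ \<Rightarrow> -684 | EPP \<Rightarrow> 1124 | EQQ
        \<Rightarrow> -1108 | _ \<Rightarrow> 0)
    | NZR \<Rightarrow> (case d of NZZ \<Rightarrow> -72 | NZP \<Rightarrow> -108 | NZQ \<Rightarrow> -108 | NZR \<Rightarrow> 176 | NPP
        \<Rightarrow> 476 | NPQ \<Rightarrow> 68 | NQQ \<Rightarrow> 476 | NRR \<Rightarrow> 324 | EZZ \<Rightarrow>
        -460 | EZP \<Rightarrow> -132 | EZQ \<Rightarrow> -132 | EPP \<Rightarrow> -60 | EQQ \<Rightarrow> -60 | _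
        \<Rightarrow> 0)
    | NPP \<Rightarrow> (case d of NZZ \<Rightarrow> 104 | NZP \<Rightarrow> 1776 | NZQ \<Rightarrow> -1944 | NZR \<Rightarrow> 476 | NPP
        \<Rightarrow> 5232 | NPQ \<Rightarrow> 676 | NQQ \<Rightarrow> -968 | NRR \<Rightarrow> 1820 | EZZ
        \<Rightarrow> -3084 | EZP \<Rightarrow> -2182 | EZQ \<Rightarrow> -942 | EPP \<Rightarrow> -2156 | EQQ
        \<Rightarrow> 1564 | _ \<Rightarrow> 0)
    | NPQ \<Rightarrow> (case d of NZZ \<Rightarrow> 238 | NZP \<Rightarrow> 112 | NZQ \<Rightarrow> 112 | NZR \<Rightarrow> 68 | NPP
        \<Rightarrow> 676 | NPQ \<Rightarrow> 1616 | NQQ \<Rightarrow> 676 | NRR \<Rightarrow> -148 | EZZ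
        \<Rightarrow> -702 | EZP \<Rightarrow> -1995 | EZQ \<Rightarrow> -1995 | EPP \<Rightarrow> -380 | EQQ
        \<Rightarrow> -380 | _ \<Rightarrow> 0)
    | NQQ \<Rightarrow> (case d of NZZ \<Rightarrow> 104 | NZP \<Rightarrow> -1944 | NZQ \<Rightarrow> 1776 | NZR \<Rightarrow> 476 | NPP
        \<Rightarrow> -968 | NPQ \<Rightarrow> 676 | NQQ \<Rightarrow> 5232 | NRR \<Rightarrow> 1820 | EZZ
        \<Rightarrow> -3084 | EZP \<Rightarrow> -942 | EZQ \<Rightarrow> -2182 | EPP \<Rightarrow> 1564 | EQQ
        \<Rightarrow> -2156 | _ \<Rightarrow> 0)
    | NRR \<Rightarrow> (case d of NZZ \<Rightarrow> 188 | NZP \<Rightarrow> 92 | NZQ \<Rightarrow> 92 | NZR \<Rightarrow> 324 | NPP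
        \<Rightarrow> 1820 | NPQ \<Rightarrow> -148 | NQQ \<Rightarrow> 1820 | NRR \<Rightarrow> 2328 | EZZ
        \<Rightarrow> -3540 | EZP \<Rightarrow> -912 | EZQ \<Rightarrow> -912 | EPP \<Rightarrow> -72 | EQQ
        \<Rightarrow> -72 | _ \<Rightarrow> 0)
    | EZZ \<Rightarrow> (case d of NZZ \<Rightarrow> -524 | NZP \<Rightarrow> -320 | NZQ \<Rightarrow> -320 | NZR \<Rightarrow> -460 | NPP
        \<Rightarrow> -3084 | NPQ \<Rightarrow> -702 | NQQ \<Rightarrow> -3084 | NRR \<Rightarrow> -3540 | EZZ
        \<Rightarrow> 6032 | EZP \<Rightarrow> 2676 | EZQ \<Rightarrow> 2676 | EPP \<Rightarrow> 300 | EQQ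
        \<Rightarrow> 300 | _ \<Rightarrow> 0)
    | EZP \<Rightarrow> (case d of NZZ \<Rightarrow> -500 | NZP \<Rightarrow> -684 | NZQ \<Rightarrow> 60 | NZR \<Rightarrow> -132 | NPP
        \<Rightarrow> -2182 | NPQ \<Rightarrow> -1995 | NQQ \<Rightarrow> -942 | NRR \<Rightarrow> -912 | EZZ
        \<Rightarrow> 2676 | EZP \<Rightarrow> 3222 | EZQ \<Rightarrow> 2974 | EPP \<Rightarrow> 852 | EQQ
        \<Rightarrow> 108 | _ \<Rightarrow> 0)
    | EZQ \<Rightarrow> (case d of NZZ \<Rightarrow> -500 | NZP \<Rightarrow> 60 | NZQ \<Rightarrow> -684 | NZR \<Rightarrow> -132 | NPP
        \<Rightarrow> -942 | NPQ \<Rightarrow> -1995 | NQQ \<Rightarrow> -2182 | NRR \<Rightarrow> -912 | EZZ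
        \<Rightarrow> 2676 | EZP \<Rightarrow> 2974 | EZQ \<Rightarrow> 3222 | EPP \<Rightarrow> 108 | EQQ
        \<Rightarrow> 852 | _ \<Rightarrow> 0)
    | EPP \<Rightarrow> (case d of NZZ \<Rightarrow> -36 | NZP \<Rightarrow> -1108 | NZQ \<Rightarrow> 1124 | NZR \<Rightarrow> -60 | NPP
        \<Rightarrow> -2156 | NPQ \<Rightarrow> -380 | NQQ \<Rightarrow> 1564 | NRR \<Rightarrow> -72 | EZZ
        \<Rightarrow> 300 | EZP \<Rightarrow> 852 | EZQ \<Rightarrow> 108 | EPP \<Rightarrow> 1232 | EQQ \<Rightarrow>
        -1000 | _ \<Rightarrow> 0)
    | EQQ \<Rightarrow> (case d of NZZ \<Rightarrow> -36 | NZP \<Rightarrow> 1124 | NZQ \<Rightarrow> -1108 | NZR \<Rightarrow> -60 | NPP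
        \<Rightarrow> 1564 | NPQ \<Rightarrow> -380 | NQQ \<Rightarrow> -2156 | NRR \<Rightarrow> -72 | EZZ
        \<Rightarrow> 300 | EZP \<Rightarrow> 108 | EZQ \<Rightarrow> 852 | EPP \<Rightarrow> -1000 | EQQ
        \<Rightarrow> 1232 | _ \<Rightarrow> 0)
    | _ \<Rightarrow> 0)"

definition edge_gram :: "flag \<Rightarrow> flag \<Rightarrow> int" where
  "edge_gram c d = (case c of
      NZZ \<Rightarrow> (case d of NZZ \<Rightarrow> 1624 | NZP \<Rightarrow> -92 | NZQ \<Rightarrow> -92 | NZR \<Rightarrow> -1200 | NPP
        \<Rightarrow> -40 | NQQ \<Rightarrow> -40 | EZZ \<Rightarrow> 528 | EPQ \<Rightarrow> -40 | ERR \<Rightarrow>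
        496 | _ \<Rightarrow> 0)
    | NZP \<Rightarrow> (case d of NZZ \<Rightarrow> -92 | NZP \<Rightarrow> 72 | NZQ \<Rightarrow> 72 | NZR \<Rightarrow> 40 | NPP \<Rightarrow>
        -172 | NQQ \<Rightarrow> -172 | EZZ \<Rightarrow> 32 | EPQ \<Rightarrow> 12 | ERR \<Rightarrow> -40 | _
        \<Rightarrow> 0)
    | NZQ \<Rightarrow> (case d of NZZ \<Rightarrow> -92 | NZP \<Rightarrow> 72 | NZQ \<Rightarrow> 72 | NZR \<Rightarrow> 40 | NPP \<Rightarrow>
        -172 | NQQ \<Rightarrow> -172 | EZZ \<Rightarrow> 32 | EPQ \<Rightarrow> 12 | ERR \<Rightarrow> -40 | _
        \<Rightarrow> 0)
    | NZR \<Rightarrow> (case d of NZZ \<Rightarrow> -1200 | NZP \<Rightarrow> 40 | NZQ \<Rightarrow> 40 | NZR \<Rightarrow> 1060 | NPP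
        \<Rightarrow> 114 | NQQ \<Rightarrow> 114 | EZZ \<Rightarrow> -732 | EPQ \<Rightarrow> 172 | ERR \<Rightarrow>
        -376 | _ \<Rightarrow> 0)
    | NPP \<Rightarrow> (case d of NZZ \<Rightarrow> -40 | NZP \<Rightarrow> -172 | NZQ \<Rightarrow> -172 | NZR \<Rightarrow> 114 | NPP
        \<Rightarrow> 480 | NQQ \<Rightarrow> 480 | EZZ \<Rightarrow> -196 | EPQ \<Rightarrow> -38 | ERR \<Rightarrow>
        16 | _ \<Rightarrow> 0)
    | NQQ \<Rightarrow> (case d of NZZ \<Rightarrow> -40 | NZP \<Rightarrow> -172 | NZQ \<Rightarrow> -172 | NZR \<Rightarrow> 114 | NPP
        \<Rightarrow> 480 | NQQ \<Rightarrow> 480 | EZZ \<Rightarrow> -196 | EPQ \<Rightarrow> -38 | ERR \<Rightarrow>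
        16 | _ \<Rightarrow> 0)
    | EZZ \<Rightarrow> (case d of NZZ \<Rightarrow> 528 | NZP \<Rightarrow> 32 | NZQ \<Rightarrow> 32 | NZR \<Rightarrow> -732 | NPP
        \<Rightarrow> -196 | NQQ \<Rightarrow> -196 | EZZ \<Rightarrow> 848 | EPQ \<Rightarrow> -292 | ERR
        \<Rightarrow> 176 | _ \<Rightarrow> 0)
    | EPQ \<Rightarrow> (case d of NZZ \<Rightarrow> -40 | NZP \<Rightarrow> 12 | NZQ \<Rightarrow> 12 | NZR \<Rightarrow> 172 | NPP
        \<Rightarrow> -38 | NQQ \<Rightarrow> -38 | EZZ \<Rightarrow> -292 | EPQ \<Rightarrow> 160 | ERR \<Rightarrow>
        -24 | _ \<Rightarrow> 0)
    | ERR \<Rightarrow> (case d of NZZ \<Rightarrow> 496 | NZP \<Rightarrow> -40 | NZQ \<Rightarrow> -40 | NZR \<Rightarrow> -376 | NPP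
        \<Rightarrow> 16 | NQQ \<Rightarrow> 16 | EZZ \<Rightarrow> 176 | EPQ \<Rightarrow> -24 | ERR \<Rightarrow>
        160 | _ \<Rightarrow> 0)
    | _ \<Rightarrow> 0)"

text \<open>A decomposition of the form into weighted squares of linear forms, which witnesses that it is positive
  semidefinite. Each linear form is symmetric or antisymmetric under exchange of the roots.\<close>

definition nonedge_forms :: "(real \<times> (flag \<Rightarrow> real)) list" where
  "nonedge_forms =
    [(1/40, \<lambda>c. case c of
        NZZ \<Rightarrow> 80 | NZP \<Rightarrow> 74 | NZQ \<Rightarrow> 74 | NZR \<Rightarrow> -36 |
        NPP \<Rightarrow> 52 | NPQ \<Rightarrow> 119 | NQQ \<Rightarrow> 52 | NRR \<Rightarrow> 94 |
        EZZ \<Rightarrow> -262 | EZP \<Rightarrow> -250 | EZQ \<Rightarrow> -250 | EPP \<Rightarrow>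
        -18 | EQQ \<Rightarrow> -18 | _ \<Rightarrow> 0),
     (1/14360, \<lambda>c. case c of
        NZP \<Rightarrow> -414 | NZQ \<Rightarrow> -414 | NZR \<Rightarrow> 1436 | NPP \<Rightarrow>
        5228 | NPQ \<Rightarrow> 1751 | NQQ \<Rightarrow> 5228 | NRR \<Rightarrow> 4086 | EZZ
        \<Rightarrow> -6958 | EZP \<Rightarrow> -3570 | EZQ \<Rightarrow> -3570 | EPP \<Rightarrow>
        -762 | EQQ \<Rightarrow> -762 | _ \<Rightarrow> 0),
     (1/8694980, \<lambda>c. case c of
        NZP \<Rightarrow> 6940 | NZQ \<Rightarrow> 6940 | NPP \<Rightarrow> 1730 | NPQ \<Rightarrow>
        -83839 | NQQ \<Rightarrow> 1730 | NRR \<Rightarrow> 67176 | EZZ \<Rightarrow> -67176 | EZP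
        \<Rightarrow> 63924 | EZQ \<Rightarrow> 63924 | EPP \<Rightarrow> 24220 | EQQ \<Rightarrow>
        24220 | _ \<Rightarrow> 0),
     (1/31500, \<lambda>c. case c of
        NZP \<Rightarrow> -432 | NZQ \<Rightarrow> -432 | NPP \<Rightarrow> 2250 | NPQ \<Rightarrow>
        -1393 | NQQ \<Rightarrow> 2250 | NRR \<Rightarrow> 2756 | EZZ \<Rightarrow> -2756 | EZP
        \<Rightarrow> 700 | EZQ \<Rightarrow> 700 | _ \<Rightarrow> 0),
     (2/216314875, \<lambda>c. case c of
        NZP \<Rightarrow> 20006 | NZQ \<Rightarrow> 20006 | NPQ \<Rightarrow> -53281 | NRR
        \<Rightarrow> 108552 | EZZ \<Rightarrow> -108552 | EZP \<Rightarrow> 33275 | EZQ \<Rightarrow>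
        33275 | _ \<Rightarrow> 0),
     (4/7710820202295, \<lambda>c. case c of
        NPQ \<Rightarrow> -17130017 | NRR \<Rightarrow> 11568688 | EZZ \<Rightarrow> -11568688 | EZP
        \<Rightarrow> 17130017 | EZQ \<Rightarrow> 17130017 | _ \<Rightarrow> 0),
     (102336780/17130017, \<lambda>c. case c of
        NRR \<Rightarrow> -1 | EZZ \<Rightarrow> 1 | _ \<Rightarrow> 0),
     (124, \<lambda>c. case c of
        NZP \<Rightarrow> -3 | NZQ \<Rightarrow> 3 | NPP \<Rightarrow> -5 | NQQ \<Rightarrow> 5 | EZP
        \<Rightarrow> 1 | EZQ \<Rightarrow> -1 | EPP \<Rightarrow> 3 | EQQ \<Rightarrow> -3 | _
        \<Rightarrow> 0)]"

definition edge_forms :: "(real \<times> (flag \<Rightarrow> real)) list" where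
  "edge_forms =
    [(1/53, \<lambda>c. case c of
        NZZ \<Rightarrow> 132 | NZP \<Rightarrow> 8 | NZQ \<Rightarrow> 8 | NZR \<Rightarrow> -183 |
        NPP \<Rightarrow> -49 | NQQ \<Rightarrow> -49 | EZZ \<Rightarrow> 212 | EPQ \<Rightarrow> -73 |
        ERR \<Rightarrow> 44 | _ \<Rightarrow> 0),
     (2/454793, \<lambda>c. case c of
        NZZ \<Rightarrow> 17162 | NZP \<Rightarrow> -1483 | NZQ \<Rightarrow> -1483 | NZR \<Rightarrow>
        -9861 | NPP \<Rightarrow> 1087 | NQQ \<Rightarrow> 1087 | EPQ \<Rightarrow> 1879 | ERR
        \<Rightarrow> 5120 | _ \<Rightarrow> 0),
     (1/37696333, \<lambda>c. case c of
        NZP \<Rightarrow> 28426 | NZQ \<Rightarrow> 28426 | NZR \<Rightarrow> 4393 | NPP \<Rightarrow>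
        -69087 | NQQ \<Rightarrow> -69087 | EPQ \<Rightarrow> 12235 | ERR \<Rightarrow> -17572 | _
        \<Rightarrow> 0),
     (4/192769233, \<lambda>c. case c of
        NZP \<Rightarrow> 28606 | NZQ \<Rightarrow> 28606 | NPP \<Rightarrow> -101093 | NQQ
        \<Rightarrow> -101093 | EPQ \<Rightarrow> 43881 | _ \<Rightarrow> 0),
     (996338/43881, \<lambda>c. case c of
        NZP \<Rightarrow> 1 | NZQ \<Rightarrow> 1 | NPP \<Rightarrow> -2 | NQQ \<Rightarrow> -2 | _
        \<Rightarrow> 0)]"

definition pair_gram :: "bool \<Rightarrow> flag \<Rightarrow> flag \<Rightarrow> int" where
  "pair_gram e c d = (case e of True \<Rightarrow> edge_gram c d | False \<Rightarrow> nonedge_gram c d)"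

text \<open>The order \<open>p, q, v, w, x, y\<close> is a copy of the target with edge \<open>pq\<close> and 4-cycle on the
  parts \<open>{v, w}\<close> and \<open>{x, y}\<close>.\<close>

definition copy_bits :: "bool \<Rightarrow> bool \<Rightarrow> bool \<Rightarrow> bool \<Rightarrow> bool \<Rightarrow> bool \<Rightarrow> bool \<Rightarrow> bool \<Rightarrow> bool \<Rightarrow> bool
    \<Rightarrow> bool \<Rightarrow> bool \<Rightarrow> bool \<Rightarrow> bool \<Rightarrow> bool \<Rightarrow> bool" where
  "copy_bits pq pv pw px py qv qw qx qy vw vx vy wx wy xy \<longleftrightarrow>
     pq \<and> \<not> pv \<and> \<not> pw \<and> \<not> px \<and> \<not> py \<and> \<not> qv \<and> \<not> qw \<and> \<not> qx \<and> \<not> qy \<and>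
     \<not> vw \<and> vx \<and> vy \<and> wx \<and> wy \<and> \<not> xy"

text \<open>The multiplier \<open>58320 = 160 * 729 / 2\<close> is such that an average of at most \<open>160\<close> over the orders of six
  vertices is the bound \<open>2/729\<close> on the proportion of maps that are copies.\<close>

definition term_bits :: "bool \<Rightarrow> bool \<Rightarrow> bool \<Rightarrow> bool \<Rightarrow> bool \<Rightarrow> bool \<Rightarrow> bool \<Rightarrow> bool \<Rightarrow> bool \<Rightarrow> bool
    \<Rightarrow> bool \<Rightarrow> bool \<Rightarrow> bool \<Rightarrow> bool \<Rightarrow> bool \<Rightarrow> int" where
  "term_bits pq pv pw px py qv qw qx qy vw vx vy wx wy xy =
     pair_gram pq (flag_of pv qv pw qw vw) (flag_of px qx py qy xy) +
     (case copy_bits pq pv pw px py qv qw qx qy vw vx vy wx wy xy of True \<Rightarrow> 58320 | False \<Rightarrow> 0)"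

text \<open>A term does not change when the roots are exchanged, the two vertices of a pair are exchanged, or
  the two pairs are exchanged. These symmetries have order \<open>16\<close>, so the \<open>720\<close> orders of six vertices
  fall into \<open>45\<close> classes; this is the sum of one term from each. Its bound is \<open>7200 = 45 * 160\<close>.\<close>

definition total_bits where
  "total_bits b01 b02 b03 b04 b05 b12 b13 b14 b15 b23 b24 b25 b34 b35 b45 =
    term_bits b01 b02 b03 b04 b05 b12 b13 b14 b15 b23 b24 b25 b34 b35 b45 +
    term_bits b01 b02 b04 b03 b05 b12 b14 b13 b15 b24 b23 b25 b34 b45 b35 +
    term_bits b01 b02 b05 b03 b04 b12 b15 b13 b14 b25 b23 b24 b35 b45 b34 +
    term_bits b02 b01 b03 b04 b05 b12 b23 b24 b25 b13 b14 b15 b34 b35 b45 +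
    term_bits b02 b01 b04 b03 b05 b12 b24 b23 b25 b14 b13 b15 b34 b45 b35 +
    term_bits b02 b01 b05 b03 b04 b12 b25 b23 b24 b15 b13 b14 b35 b45 b34 +
    term_bits b03 b01 b02 b04 b05 b13 b23 b34 b35 b12 b14 b15 b24 b25 b45 +
    term_bits b03 b01 b04 b02 b05 b13 b34 b23 b35 b14 b12 b15 b24 b45 b25 +
    term_bits b03 b01 b05 b02 b04 b13 b35 b23 b34 b15 b12 b14 b25 b45 b24 +
    term_bits b04 b01 b02 b03 b05 b14 b24 b34 b45 b12 b13 b15 b23 b25 b35 +
    term_bits b04 b01 b03 b02 b05 b14 b34 b24 b45 b13 b12 b15 b23 b35 b25 +
    term_bits b04 b01 b05 b02 b03 b14 b45 b24 b34 b15 b12 b13 b25 b35 b23 +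
    term_bits b05 b01 b02 b03 b04 b15 b25 b35 b45 b12 b13 b14 b23 b24 b34 +
    term_bits b05 b01 b03 b02 b04 b15 b35 b25 b45 b13 b12 b14 b23 b34 b24 +
    term_bits b05 b01 b04 b02 b03 b15 b45 b25 b35 b14 b12 b13 b24 b34 b23 +
    term_bits b12 b01 b13 b14 b15 b02 b23 b24 b25 b03 b04 b05 b34 b35 b45 +
    term_bits b12 b01 b14 b13 b15 b02 b24 b23 b25 b04 b03 b05 b34 b45 b35 +
    term_bits b12 b01 b15 b13 b14 b02 b25 b23 b24 b05 b03 b04 b35 b45 b34 +
    term_bits b13 b01 b12 b14 b15 b03 b23 b34 b35 b02 b04 b05 b24 b25 b45 +
    term_bits b13 b01 b14 b12 b15 b03 b34 b23 b35 b04 b02 b05 b24 b45 b25 +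
    term_bits b13 b01 b15 b12 b14 b03 b35 b23 b34 b05 b02 b04 b25 b45 b24 +
    term_bits b14 b01 b12 b13 b15 b04 b24 b34 b45 b02 b03 b05 b23 b25 b35 +
    term_bits b14 b01 b13 b12 b15 b04 b34 b24 b45 b03 b02 b05 b23 b35 b25 +
    term_bits b14 b01 b15 b12 b13 b04 b45 b24 b34 b05 b02 b03 b25 b35 b23 +
    term_bits b15 b01 b12 b13 b14 b05 b25 b35 b45 b02 b03 b04 b23 b24 b34 +
    term_bits b15 b01 b13 b12 b14 b05 b35 b25 b45 b03 b02 b04 b23 b34 b24 +
    term_bits b15 b01 b14 b12 b13 b05 b45 b25 b35 b04 b02 b03 b24 b34 b23 +
    term_bits b23 b02 b12 b24 b25 b03 b13 b34 b35 b01 b04 b05 b14 b15 b45 +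
    term_bits b23 b02 b24 b12 b25 b03 b34 b13 b35 b04 b01 b05 b14 b45 b15 +
    term_bits b23 b02 b25 b12 b24 b03 b35 b13 b34 b05 b01 b04 b15 b45 b14 +
    term_bits b24 b02 b12 b23 b25 b04 b14 b34 b45 b01 b03 b05 b13 b15 b35 +
    term_bits b24 b02 b23 b12 b25 b04 b34 b14 b45 b03 b01 b05 b13 b35 b15 +
    term_bits b24 b02 b25 b12 b23 b04 b45 b14 b34 b05 b01 b03 b15 b35 b13 +
    term_bits b25 b02 b12 b23 b24 b05 b15 b35 b45 b01 b03 b04 b13 b14 b34 +
    term_bits b25 b02 b23 b12 b24 b05 b35 b15 b45 b03 b01 b04 b13 b34 b14 +
    term_bits b25 b02 b24 b12 b23 b05 b45 b15 b35 b04 b01 b03 b14 b34 b13 +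
    term_bits b34 b03 b13 b23 b35 b04 b14 b24 b45 b01 b02 b05 b12 b15 b25 +
    term_bits b34 b03 b23 b13 b35 b04 b24 b14 b45 b02 b01 b05 b12 b25 b15 +
    term_bits b34 b03 b35 b13 b23 b04 b45 b14 b24 b05 b01 b02 b15 b25 b12 +
    term_bits b35 b03 b13 b23 b34 b05 b15 b25 b45 b01 b02 b04 b12 b14 b24 +
    term_bits b35 b03 b23 b13 b34 b05 b25 b15 b45 b02 b01 b04 b12 b24 b14 +
    term_bits b35 b03 b34 b13 b23 b05 b45 b15 b25 b04 b01 b02 b14 b24 b12 +
    term_bits b45 b04 b14 b24 b34 b05 b15 b25 b35 b01 b02 b03 b12 b13 b23 +
    term_bits b45 b04 b24 b14 b34 b05 b25 b15 b35 b02 b01 b03 b12 b23 b13 +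
    term_bits b45 b04 b34 b14 b24 b05 b35 b15 b25 b03 b01 b02 b13 b23 b12"

text \<open>The vertices \<open>0, 1, 2\<close> of the pattern \<open>B31\<close>.\<close>

datatype part = Clique | Left | Right

fun joined :: "part \<Rightarrow> part \<Rightarrow> bool" where
  "joined Clique Clique = True"
| "joined Left Right = True"
| "joined Right Left = True"
| "joined _ _ = False"

definition coloured_bits where
  "coloured_bits c0 c1 c2 c3 c4 c5 b01 b02 b03 b04 b05 b12 b13 b14 b15 b23 b24 b25 b34 b35 b45 \<longleftrightarrow>
    b01 = joined c0 c1 \<and> b02 = joined c0 c2 \<and> b03 = joined c0 c3 \<and> b04 = joined c0 c4 \<and> b05 = joined c0 c5 \<and> b12 = joined c1 c2 \<and> b13 = joined c1 c3 \<and> b14 = joined c1 c4 \<and> b15 = joined c1 c5 \<and> b23 = joined c2 c3 \<and> b24 = joined c2 c4 \<and> b25 = joined c2 c5 \<and> b34 = joined c3 c4 \<and> b35 = joined c3 c5 \<and> b45 = joined c4 c5"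

text \<open>Only graphs in which the first two vertices are adjacent are examined, hence only two ways to
  colour them.\<close>

definition blowup_bits where
  "blowup_bits b01 b02 b03 b04 b05 b12 b13 b14 b15 b23 b24 b25 b34 b35 b45 \<longleftrightarrow>
     list_ex (\<lambda>(c0, c1). list_ex (\<lambda>c2. list_ex (\<lambda>c3. list_ex (\<lambda>c4. list_ex (\<lambda>c5.
       coloured_bits c0 c1 c2 c3 c4 c5 b01 b02 b03 b04 b05 b12 b13 b14 b15 b23 b24 b25 b34 b35 b45)
       [Clique, Left, Right]) [Clique, Left, Right]) [Clique, Left, Right]) [Clique, Left, Right])
       [(Clique, Clique), (Left, Right)]"

text \<open>The comparison with \<open>7199\<close> comes first and the branches are written as a case distinction, so that
  a colouring is sought only for the few graphs attaining \<open>7200\<close>.\<close>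

definition good_bits where
  "good_bits b01 b02 b03 b04 b05 b12 b13 b14 b15 b23 b24 b25 b34 b35 b45 \<longleftrightarrow>
     (case total_bits b01 b02 b03 b04 b05 b12 b13 b14 b15 b23 b24 b25 b34 b35 b45 \<le> 7199 of True \<Rightarrow> True
      | False \<Rightarrow> total_bits b01 b02 b03 b04 b05 b12 b13 b14 b15 b23 b24 b25 b34 b35 b45 \<le> 7200 \<and> blowup_bits b01 b02 b03 b04 b05 b12 b13 b14 b15 b23 b24 b25 b34 b35 b45)"

definition ones :: "bool list \<Rightarrow> nat" where "ones bs = length (filter id bs)"

text \<open>Vertices outside the first two are sorted by their adjacencies to these, then by degree; degrees
  are below \<open>6\<close>.\<close>

fun key_of :: "bool \<Rightarrow> bool \<Rightarrow> nat \<Rightarrow> nat" where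
  "key_of False False d = d"
| "key_of True False d = 6 + d"
| "key_of False True d = 12 + d"
| "key_of True True d = 18 + d"

text \<open>Necessary conditions for a canonical order of a graph with an edge: the first vertex has maximal degree,
  the second has maximal degree among the neighbours of the first, and the others are sorted
  by key. They leave some isomorphic duplicates, but few enough graphs for evaluation.\<close>

definition ordered_degrees where
  "ordered_degrees b02 b03 b04 b05 b12 b13 b14 b15 d0 d1 d2 d3 d4 d5 \<longleftrightarrow>
     d1 \<le> d0 \<and> d2 \<le> d0 \<and> d3 \<le> d0 \<and> d4 \<le> d0 \<and> d5 \<le> d0 \<and>
     (b02 \<longrightarrow> d2 \<le> d1) \<and> (b03 \<longrightarrow> d3 \<le> d1) \<and> (b04 \<longrightarrow> d4 \<le> d1) \<and> (b05 \<longrightarrow> d5 \<le> d1) \<and>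
     key_of b02 b12 d2 \<le> key_of b03 b13 d3 \<and> key_of b03 b13 d3 \<le> key_of b04 b14 d4 \<and>
     key_of b04 b14 d4 \<le> key_of b05 b15 (d5::nat)"

definition canonical_bits where
  "canonical_bits b01 b02 b03 b04 b05 b12 b13 b14 b15 b23 b24 b25 b34 b35 b45 \<longleftrightarrow> ordered_degrees b02 b03 b04 b05 b12 b13 b14 b15
     (ones [b01, b02, b03, b04, b05]) (ones [b01, b12, b13, b14, b15]) (ones [b02, b12, b23, b24, b25])
     (ones [b03, b13, b23, b34, b35]) (ones [b04, b14, b24, b34, b45]) (ones [b05, b15, b25, b35, b45])"

definition check_bits where
  "check_bits b01 b02 b03 b04 b05 b12 b13 b14 b15 b23 b24 b25 b34 b35 b45 \<longleftrightarrow>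
     (case canonical_bits b01 b02 b03 b04 b05 b12 b13 b14 b15 b23 b24 b25 b34 b35 b45 of True \<Rightarrow> good_bits b01 b02 b03 b04 b05 b12 b13 b14 b15 b23 b24 b25 b34 b35 b45 | False \<Rightarrow> True)"

definition states :: "(bool \<times> bool) list" where
  "states = [(False, False), (True, False), (False, True), (True, True)]"

definition all_bits :: "(bool \<Rightarrow> bool) \<Rightarrow> bool" where "all_bits P \<longleftrightarrow> P True \<and> P False"

definition check_states :: "(bool \<times> bool) \<Rightarrow> (bool \<times> bool) \<Rightarrow> (bool \<times> bool) \<Rightarrow> (bool \<times> bool) \<Rightarrow> bool" where
  "check_states s2 s3 s4 s5 \<longleftrightarrow> (case s2 of (b02, b12) \<Rightarrow> case s3 of (b03, b13) \<Rightarrow>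
     case s4 of (b04, b14) \<Rightarrow> case s5 of (b05, b15) \<Rightarrow>
     all_bits (\<lambda>b23. all_bits (\<lambda>b24. all_bits (\<lambda>b25. all_bits (\<lambda>b34. all_bits (\<lambda>b35. all_bits (\<lambda>b45.
       check_bits True b02 b03 b04 b05 b12 b13 b14 b15 b23 b24 b25 b34 b35 b45)))))))"

fun sorted_tails :: "'a list \<Rightarrow> 'a list list" where
  "sorted_tails [] = []"
| "sorted_tails (x # xs) = (x # xs) # sorted_tails xs"

text \<open>The finite heart of the proof: each six-vertex graph with an edge has a canonical order and is covered
  by this evaluation. The lists of tails run over the nondecreasing choices of adjacency
  states for the last four vertices.\<close>

lemma check_all:
  "list_all (\<lambda>s2s. list_all (\<lambda>s3s. list_all (\<lambda>s4s. list_all (\<lambda>s5s.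
     check_states (hd s2s) (hd s3s) (hd s4s) (hd s5s))
     (sorted_tails s4s)) (sorted_tails s3s)) (sorted_tails s2s)) (sorted_tails states)"
  by code_simp

section \<open>From canonical orders to all graphs on six vertices\<close>

lemma all_bits_iff: "all_bits P \<longleftrightarrow> (\<forall>b. P b)"
  by (metis (full_types) all_bits_def)

definition state_code :: "bool \<Rightarrow> bool \<Rightarrow> nat" where
  "state_code b c = (if b then 1 else 0) + (if c then 2 else 0)"

lemma key_of_eq: "key_of b c d = 6 * state_code b c + d"
  by (cases b; cases c) (simp_all add: state_code_def)

lemmas check_cases = check_all[unfolded states_def, simplified]

lemma check_sorted_states:
  assumes "state_code b02 b12 \<le> state_code b03 b13" "state_code b03 b13 \<le> state_code b04 b14"
    "state_code b04 b14 \<le> state_code b05 b15"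
  shows "check_states (b02, b12) (b03, b13) (b04, b14) (b05, b15)"
  using assms
  by (cases b02; cases b12; cases b03; cases b13; cases b04; cases b14; cases b05; cases b15)
    (simp_all add: state_code_def check_cases)

lemma ones_le: "ones bs \<le> length bs"
  unfolding ones_def by (rule length_filter_le)

lemma good_of_canonical:
  assumes "canonical_bits True b02 b03 b04 b05 b12 b13 b14 b15 b23 b24 b25 b34 b35 b45"
  shows "good_bits True b02 b03 b04 b05 b12 b13 b14 b15 b23 b24 b25 b34 b35 b45"
proof -
  have le: "ones [a, b, c, d, e] \<le> 5" for a b c d e
    using ones_le[of "[a, b, c, d, e]"] by simp
  have "check_states (b02, b12) (b03, b13) (b04, b14) (b05, b15)"
    using assms le[of b02 b12 b23 b24 b25] le[of b03 b13 b23 b34 b35]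
      le[of b04 b14 b24 b34 b45] le[of b05 b15 b25 b35 b45]
    unfolding canonical_bits_def ordered_degrees_def key_of_eq
    by (intro check_sorted_states) linarith+
  then have "check_bits True b02 b03 b04 b05 b12 b13 b14 b15 b23 b24 b25 b34 b35 b45"
    unfolding check_states_def all_bits_iff by simp
  then show ?thesis using assms unfolding check_bits_def by simp
qed

definition coloured_by :: "(nat \<Rightarrow> nat \<Rightarrow> bool) \<Rightarrow> (nat \<Rightarrow> part) \<Rightarrow> bool" where
  "coloured_by E c \<longleftrightarrow> (\<forall>i<6. \<forall>j<6. i \<noteq> j \<longrightarrow> E i j = joined (c i) (c j))"

lemma joined_commute: "joined c d = joined d c"
  by (cases c; cases d) simp_all

lemma forall_less_6: "(\<forall>i<6. P i) \<longleftrightarrow> P 0 \<and> P 1 \<and> P 2 \<and> P 3 \<and> P 4 \<and> P (5::nat)"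
  by (simp add: numeral_eq_Suc All_less_Suc2)

lemma coloured_bits_imp:
  assumes sym: "\<And>i j. E i j = E j i"
    and "coloured_bits c0 c1 c2 c3 c4 c5 (E 0 1) (E 0 2) (E 0 3) (E 0 4) (E 0 5) (E 1 2) (E 1 3) (E 1 4) (E 1 5) (E 2 3) (E 2 4) (E 2 5) (E 3 4) (E 3 5) (E 4 5)"
  shows "coloured_by E (\<lambda>i. [c0, c1, c2, c3, c4, c5] ! i)"
  using assms(2) sym[of 1 0] sym[of 2 0] sym[of 3 0] sym[of 4 0] sym[of 5 0] sym[of 2 1] sym[of 3 1]
    sym[of 4 1] sym[of 5 1] sym[of 3 2] sym[of 4 2] sym[of 5 2] sym[of 4 3] sym[of 5 3] sym[of 5 4]
  unfolding coloured_bits_def coloured_by_def forall_less_6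
  by (simp add: joined_commute eval_nat_numeral)

abbreviation total_of :: "(nat \<Rightarrow> nat \<Rightarrow> bool) \<Rightarrow> int" where
  "total_of E \<equiv> total_bits (E 0 1) (E 0 2) (E 0 3) (E 0 4) (E 0 5) (E 1 2) (E 1 3) (E 1 4) (E 1 5) (E 2 3) (E 2 4) (E 2 5) (E 3 4) (E 3 5) (E 4 5)"

lemma good_bitsD:
  assumes sym: "\<And>i j. E i j = E j i"
    and "good_bits (E 0 1) (E 0 2) (E 0 3) (E 0 4) (E 0 5) (E 1 2) (E 1 3) (E 1 4) (E 1 5) (E 2 3) (E 2 4) (E 2 5) (E 3 4) (E 3 5) (E 4 5)"
  shows "total_of E \<le> 7200 - of_bool (\<nexists>c. coloured_by E c)"
proof (cases "total_of E \<le> 7199")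
  case False
  then have "blowup_bits (E 0 1) (E 0 2) (E 0 3) (E 0 4) (E 0 5) (E 1 2) (E 1 3) (E 1 4) (E 1 5) (E 2 3) (E 2 4) (E 2 5) (E 3 4) (E 3 5) (E 4 5)"
    and "total_of E \<le> 7200"
    using assms(2) unfolding good_bits_def by simp_all
  then obtain p c2 c3 c4 c5 where "coloured_bits (fst p) (snd p) c2 c3 c4 c5 (E 0 1) (E 0 2) (E 0 3) (E 0 4) (E 0 5) (E 1 2) (E 1 3) (E 1 4) (E 1 5) (E 2 3) (E 2 4) (E 2 5) (E 3 4) (E 3 5) (E 4 5)"
    unfolding blowup_bits_def list_ex_iff split_beta by blast
  then have "\<exists>c. coloured_by E c"
    using coloured_bits_imp[of E, OF sym] by blast
  then show ?thesis using \<open>total_of E \<le> 7200\<close> by simp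
qed simp

fun excess :: "(nat \<Rightarrow> nat \<Rightarrow> bool) \<Rightarrow> nat list \<Rightarrow> int" where
  "excess E [p, q, v, w, x, y] = term_bits (E p q) (E p v) (E p w) (E p x) (E p y)
     (E q v) (E q w) (E q x) (E q y) (E v w) (E v x) (E v y) (E w x) (E w y) (E x y)"
| "excess E _ = 0"

lemma flag_of_swap_pair: "flag_of c d a b e = flag_of a b c d e"
  by (cases a; cases b; cases c; cases d; cases e) simp_all

fun swap_flag :: "flag \<Rightarrow> flag" where
  "swap_flag NZP = NZQ" | "swap_flag NZQ = NZP" | "swap_flag NPP = NQQ" | "swap_flag NQQ = NPP"
| "swap_flag NPR = NQR" | "swap_flag NQR = NPR"
| "swap_flag EZP = EZQ" | "swap_flag EZQ = EZP" | "swap_flag EPP = EQQ" | "swap_flag EQQ = EPP"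
| "swap_flag EPR = EQR" | "swap_flag EQR = EPR"
| "swap_flag c = c"

lemma flag_of_swap_root: "flag_of b a d c e = swap_flag (flag_of a b c d e)"
  by (cases a; cases b; cases c; cases d; cases e) simp_all

lemma nonedge_gram_forms:
  "real_of_int (nonedge_gram c d) = (\<Sum>(w, L)\<leftarrow>nonedge_forms. w * L c * L d)"
  unfolding nonedge_gram_def nonedge_forms_def by (cases c; simp; cases d; simp)

lemma edge_gram_forms:
  "real_of_int (edge_gram c d) = (\<Sum>(w, L)\<leftarrow>edge_forms. w * L c * L d)"
  unfolding edge_gram_def edge_forms_def by (cases c; simp; cases d; simp)

definition pair_forms :: "bool \<Rightarrow> (real \<times> (flag \<Rightarrow> real)) list" where
  "pair_forms e = (if e then edge_forms else nonedge_forms)"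

lemma pair_gram_forms: "real_of_int (pair_gram e c d) = (\<Sum>(w, L)\<leftarrow>pair_forms e. w * L c * L d)"
  by (cases e) (simp_all add: pair_gram_def pair_forms_def edge_gram_forms nonedge_gram_forms)

lemma pair_forms_weight: "(w, L) \<in> set (pair_forms e) \<Longrightarrow> 0 \<le> w"
  by (auto simp: pair_forms_def edge_forms_def nonedge_forms_def split: if_splits)

lemma pair_forms_swap:
  assumes "(w, L) \<in> set (pair_forms e)"
  shows "L (swap_flag c) * L (swap_flag d) = L c * L d"
proof -
  have "(\<forall>c. L (swap_flag c) = L c) \<or> (\<forall>c. L (swap_flag c) = - L c)"
  proof (cases "w = 124")
    case True
    then have "\<forall>c. L (swap_flag c) = - L c"
      using assms by (intro allI) (case_tac c; auto simp: pair_forms_def edge_forms_def nonedge_forms_def split: if_splits)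
    then show ?thesis ..
  next
    case False
    then have "L (swap_flag c) = L c" for c
      using assms by (cases c) (auto simp: pair_forms_def edge_forms_def nonedge_forms_def split: if_splits)
    then show ?thesis by blast
  qed
  then show ?thesis by auto
qed

lemma pair_gram_commute: "pair_gram e c d = pair_gram e d c"
proof -
  have "real_of_int (pair_gram e c d) = real_of_int (pair_gram e d c)"
    unfolding pair_gram_forms by (intro arg_cong[where f = sum_list] map_cong) auto
  then show ?thesis by simp
qed

lemma pair_gram_swap: "pair_gram e (swap_flag c) (swap_flag d) = pair_gram e c d"
proof -
  have "real_of_int (pair_gram e (swap_flag c) (swap_flag d)) = real_of_int (pair_gram e c d)"
    unfolding pair_gram_forms
    by (intro arg_cong[where f = sum_list] map_cong) (auto simp: pair_forms_swap mult.assoc)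
  then show ?thesis by simp
qed

lemma case_bool_cong: "P = Q \<Longrightarrow> (case P of True \<Rightarrow> x | False \<Rightarrow> y) = (case Q of True \<Rightarrow> x | False \<Rightarrow> y)"
  by simp

context
  fixes E :: "nat \<Rightarrow> nat \<Rightarrow> bool"
  assumes sym: "\<And>i j. E i j = E j i"
begin

lemma excess_swap_root: "excess E [q, p, v, w, x, y] = excess E [p, q, v, w, x, y]"
  unfolding excess.simps term_bits_def
  by (intro arg_cong2[where f = "(+)"] case_bool_cong)
    (auto simp: sym[of q p] copy_bits_def flag_of_swap_root[of "E p _"] pair_gram_swap)

lemma excess_swap_first: "excess E [p, q, w, v, x, y] = excess E [p, q, v, w, x, y]"
  unfolding excess.simps term_bits_def
  by (intro arg_cong2[where f = "(+)"] case_bool_cong)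
    (auto simp: sym[of w v] copy_bits_def flag_of_swap_pair[of "E p w"])

lemma excess_swap_pairs: "excess E [p, q, x, y, v, w] = excess E [p, q, v, w, x, y]"
  unfolding excess.simps term_bits_def
  by (intro arg_cong2[where f = "(+)"] case_bool_cong)
    (auto simp: sym copy_bits_def intro: pair_gram_commute)

lemma excess_swap_second: "excess E [p, q, v, w, y, x] = excess E [p, q, v, w, x, y]"
  by (metis excess_swap_first excess_swap_pairs)

end

lemma sum_permutations_of_set_step:
  assumes "finite A" "A \<noteq> {}"
  shows "(\<Sum>xs\<in>permutations_of_set A. f xs) =
    (\<Sum>x\<in>A. \<Sum>ys\<in>permutations_of_set (A - {x}). f (x # ys))"
proof -
  have "(\<Sum>xs\<in>permutations_of_set A. f xs) =
      (\<Sum>x\<in>A. \<Sum>xs\<in>(#) x ` permutations_of_set (A - {x}). f xs)"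
    unfolding permutations_of_set_nonempty[OF assms(2)]
    by (rule sum.UNION_disjoint) (use assms in auto)
  also have "\<dots> = (\<Sum>x\<in>A. \<Sum>ys\<in>permutations_of_set (A - {x}). f (x # ys))"
    by (intro sum.cong sum.reindex[THEN trans]) (auto simp: inj_on_def)
  finally show ?thesis .
qed

lemma sum_permutations_of_three:
  assumes "distinct [a, b, c]"
  shows "(\<Sum>xs\<in>permutations_of_set {a, b, c}. f xs) =
    f [a, b, c] + f [a, c, b] + (f [b, a, c] + f [b, c, a]) + (f [c, a, b] + f [c, b, a])"
proof -
  have "{a, b, c} - {a} = {b, c}" "{a, b, c} - {b} = {a, c}" "{a, b, c} - {c} = {a, b}"
    using assms by auto
  then show ?thesis
    using assms by (subst sum_permutations_of_set_step)
      (simp_all add: permutations_of_set_doubleton add.assoc)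
qed

text \<open>The symmetries of a square of pairs, of order \<open>8\<close>, leave three ways to split four vertices into two pairs.\<close>

lemma sum_permutations_of_four:
  fixes f :: "'a list \<Rightarrow> int"
  assumes "distinct [a, b, c, d]"
    and first: "\<And>v w x y. f [w, v, x, y] = f [v, w, x, y]"
    and second: "\<And>v w x y. f [v, w, y, x] = f [v, w, x, y]"
    and pairs: "\<And>v w x y. f [x, y, v, w] = f [v, w, x, y]"
  shows "(\<Sum>xs\<in>permutations_of_set {a, b, c, d}. f xs) = 8 * (f [a, b, c, d] + f [a, c, b, d] + f [a, d, b, c])"
proof -
  have diff: "{a, b, c, d} - {a} = {b, c, d}" "{a, b, c, d} - {b} = {a, c, d}"
    "{a, b, c, d} - {c} = {a, b, d}" "{a, b, c, d} - {d} = {a, b, c}"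
    using assms(1) by auto
  have three: "(\<Sum>xs\<in>permutations_of_set {x, y, z}. f (u # xs)) =
      f [u, x, y, z] + f [u, x, z, y] + (f [u, y, x, z] + f [u, y, z, x]) + (f [u, z, x, y] + f [u, z, y, x])"
    if "distinct [x, y, z]" for u x y z
    using sum_permutations_of_three[OF that, of "\<lambda>xs. f (u # xs)"] .
  have "(\<Sum>xs\<in>permutations_of_set {a, b, c, d}. f xs) =
     (\<Sum>u\<in>{a, b, c, d}. \<Sum>ys\<in>permutations_of_set ({a, b, c, d} - {u}). f (u # ys))"
    by (rule sum_permutations_of_set_step) simp_all
  also have "\<dots> = (\<Sum>ys\<in>permutations_of_set {b, c, d}. f (a # ys)) +
      ((\<Sum>ys\<in>permutations_of_set {a, c, d}. f (b # ys)) +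
      ((\<Sum>ys\<in>permutations_of_set {a, b, d}. f (c # ys)) +
       (\<Sum>ys\<in>permutations_of_set {a, b, c}. f (d # ys))))"
    using assms(1) by (simp add: diff)
  also have "\<dots> = 8 * (f [a, b, c, d] + f [a, c, b, d] + f [a, d, b, c])"
    using assms(1) by (simp add: three first second pairs)
  finally show ?thesis .
qed

lemma sum_excess_eq_total:
  assumes sym: "\<And>i j. E i j = E j i"
  shows "(\<Sum>xs\<in>permutations_of_set {..<6}. excess E xs) = 16 * total_of E"
proof -
  define T where "T p q A = (\<Sum>ys\<in>permutations_of_set A. excess E (p # q # ys))" for p q A
  have four: "T p q {a, b, c, d} = 8 * (excess E [p, q, a, b, c, d] + excess E [p, q, a, c, b, d] + excess E [p, q, a, d, b, c])"
    if "distinct [a, b, c, d]" for p q a b c d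
    unfolding T_def using that
    by (rule sum_permutations_of_four)
      (simp_all only: excess_swap_first[of E, OF sym] excess_swap_second[of E, OF sym] excess_swap_pairs[of E, OF sym, symmetric])
  have swap: "T q p A = T p q A" if "card A = 4" for p q A
    unfolding T_def
  proof (rule sum.cong[OF refl])
    fix ys assume "ys \<in> permutations_of_set A"
    then have "length ys = 4" using that by (simp add: length_finite_permutations_of_set)
    then obtain v w x y where "ys = [v, w, x, y]"
      by (auto simp: length_Suc_conv numeral_eq_Suc)
    then show "excess E (q # p # ys) = excess E (p # q # ys)"
      by (simp only: excess_swap_root[of E, OF sym])
  qed
  have I: "{..<6} = {0, 1, 2, 3, 4, 5::nat}" by auto
  have "(\<Sum>xs\<in>permutations_of_set {..<6}. excess E xs) =
      (\<Sum>p\<in>{..<6}. \<Sum>ys\<in>permutations_of_set ({..<6} - {p}). excess E (p # ys))"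
    by (rule sum_permutations_of_set_step) (auto simp: I)
  also have "\<dots> = (\<Sum>p\<in>{..<6}. \<Sum>q\<in>{..<6} - {p}. T p q ({..<6} - {p} - {q}))"
    unfolding T_def
  proof (rule sum.cong[OF refl])
    fix p :: nat
    have "{..<6} - {p} \<noteq> {}"
      by (cases "p = 0") (auto simp: I)
    then show "(\<Sum>ys\<in>permutations_of_set ({..<6} - {p}). excess E (p # ys)) =
      (\<Sum>q\<in>{..<6} - {p}. \<Sum>ys\<in>permutations_of_set ({..<6} - {p} - {q}). excess E (p # q # ys))"
      by (intro sum_permutations_of_set_step) simp_all
  qed
  also have "\<dots> = 2 * (T 0 1 {2,3,4,5} + T 0 2 {1,3,4,5} + T 0 3 {1,2,4,5} + T 0 4 {1,2,3,5} + T 0 5 {1,2,3,4} +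
     T 1 2 {0,3,4,5} + T 1 3 {0,2,4,5} + T 1 4 {0,2,3,5} + T 1 5 {0,2,3,4} + T 2 3 {0,1,4,5} + T 2 4 {0,1,3,5} +
     T 2 5 {0,1,3,4} + T 3 4 {0,1,2,5} + T 3 5 {0,1,2,4} + T 4 5 {0,1,2,3})"
    unfolding I by (simp add: insert_Diff_if swap[of _ "Suc 0" 0] swap[of _ 2 0] swap[of _ 3 0] swap[of _ 4 0] swap[of _ 5 0]
      swap[of _ 2 "Suc 0"] swap[of _ 3 "Suc 0"] swap[of _ 4 "Suc 0"] swap[of _ 5 "Suc 0"] swap[of _ 3 2] swap[of _ 4 2] swap[of _ 5 2]
      swap[of _ 4 3] swap[of _ 5 3] swap[of _ 5 4])
  also have "\<dots> = 16 * total_of E"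
    unfolding total_bits_def
    by (simp add: four)
      (simp only: sym[of 1 0] sym[of "Suc 0" 0] sym[of 2 0] sym[of 3 0] sym[of 4 0] sym[of 5 0] sym[of 2 1] sym[of 2 "Suc 0"] One_nat_def sym[of 3 1] sym[of 3 "Suc 0"] One_nat_def
    sym[of 4 1] sym[of 4 "Suc 0"] One_nat_def sym[of 5 1] sym[of 5 "Suc 0"] One_nat_def sym[of 3 2] sym[of 4 2] sym[of 5 2] sym[of 4 3] sym[of 5 3] sym[of 5 4])
  finally show ?thesis .
qed

lemma ones_Cons: "ones (x # xs) = (if x then Suc (ones xs) else ones xs)" "ones [] = 0"
  by (simp_all add: ones_def)

lemma ones_map_cong_mset:
  assumes "mset xs = mset ys"
  shows "ones (map f xs) = ones (map f ys)"
proof -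
  have "mset (map f xs) = mset (map f ys)"
    using assms by simp
  then show ?thesis
    unfolding ones_def by (metis mset_filter size_mset)
qed

text \<open>Choose a vertex of maximal degree, a neighbour of it of maximal degree, and sort the rest by key.\<close>

lemma exists_canonical_order:
  fixes E :: "nat \<Rightarrow> nat \<Rightarrow> bool"
  assumes sym: "\<And>i j. E i j = E j i" and irr: "\<And>i. \<not> E i i"
    and edge: "u < 6" "u' < 6" "E u u'"
  obtains a b p q r s where "[a, b, p, q, r, s] \<in> permutations_of_set {..<6}" "E a b"
    "canonical_bits True (E a p) (E a q) (E a r) (E a s) (E b p) (E b q) (E b r) (E b s)
       (E p q) (E p r) (E p s) (E q r) (E q s) (E r s)"
proof -
  define d where "d i = ones (map (E i) [0..<6])" for i
  obtain a where a: "a < 6" "\<And>i. i < 6 \<Longrightarrow> d i \<le> d a"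
  proof -
    have "Max (d ` {..<6}) \<in> d ` {..<6}" by (rule Max_in) (auto simp: lessThan_empty_iff)
    then obtain a where "a \<in> {..<6}" "Max (d ` {..<6}) = d a" by auto
    then show thesis using that[of a] Max_ge[of "d ` {..<6}"] by (metis finite_imageI finite_lessThan imageI lessThan_iff)
  qed
  have "filter id (map (E u) [0..<6]) \<noteq> []"
    using edge by (auto simp: filter_empty_conv image_iff)
  then have "0 < d u" unfolding d_def ones_def by blast
  then have "0 < d a" using a(2)[OF edge(1)] by simp
  then obtain b0 where "b0 < 6" "E a b0"
    unfolding d_def ones_def by (auto simp: filter_empty_conv)
  then have ne: "{b. b < 6 \<and> E a b} \<noteq> {}" "finite {b. b < 6 \<and> E a b}" by auto
  then have "Max (d ` {b. b < 6 \<and> E a b}) \<in> d ` {b. b < 6 \<and> E a b}"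
    by (intro Max_in) auto
  then obtain b where b: "b < 6" "E a b" and "Max (d ` {b. b < 6 \<and> E a b}) = d b" by auto
  then have bmax: "d i \<le> d b" if "i < 6" "E a i" for i
    using that ne(2) Max_ge[of "d ` {b. b < 6 \<and> E a b}" "d i"] by auto
  have ab: "a \<noteq> b" using b(2) irr by metis
  define key where "key i = key_of (E a i) (E b i) (d i)" for i
  define ys where "ys = sort_key key (filter (\<lambda>i. i \<noteq> a \<and> i \<noteq> b) [0..<6])"
  have ys: "distinct ys" "set ys = {..<6} - {a, b}" "sorted (map key ys)"
    unfolding ys_def by auto
  have perm: "a # b # ys \<in> permutations_of_set {..<6}"
  proof (rule permutations_of_setI)
    show "set (a # b # ys) = {..<6}" using ys(2) a(1) b(1) by auto
    show "distinct (a # b # ys)" using ys(1,2) ab by auto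
  qed
  have "length (a # b # ys) = 6"
    using length_finite_permutations_of_set[OF perm] by simp
  then obtain p q r s where pqrs: "ys = [p, q, r, s]"
    by (auto simp: length_Suc_conv numeral_eq_Suc)
  have perm': "set [a, b, p, q, r, s] = {..<6}" "distinct [a, b, p, q, r, s]"
    using permutations_of_setD[OF perm] unfolding pqrs by blast+
  have mset: "mset [0..<6] = mset [a, b, p, q, r, s]"
    using perm' by (subst set_eq_iff_mset_eq_distinct[symmetric]) (simp_all only: distinct_upt set_upt atLeast0LessThan)
  have d: "d i = ones (map (E i) [a, b, p, q, r, s])" for i
    unfolding d_def by (rule ones_map_cong_mset[OF mset])
  have lt: "p < 6" "q < 6" "r < 6" "s < 6"
    using perm'(1) by (metis lessThan_iff list.set_intros)+
  have degs: "ones [True, E a p, E a q, E a r, E a s] = d a"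
    "ones [True, E b p, E b q, E b r, E b s] = d b"
    "ones [E a p, E b p, E p q, E p r, E p s] = d p"
    "ones [E a q, E b q, E p q, E q r, E q s] = d q"
    "ones [E a r, E b r, E p r, E q r, E r s] = d r"
    "ones [E a s, E b s, E p s, E q s, E r s] = d s"
    unfolding d using b(2) irr sym[of b a] sym[of p a] sym[of p b] sym[of q a] sym[of q b] sym[of q p]
      sym[of r a] sym[of r b] sym[of r p] sym[of r q] sym[of s a] sym[of s b] sym[of s p] sym[of s q] sym[of s r]
    by (simp_all add: ones_Cons)
  have "canonical_bits True (E a p) (E a q) (E a r) (E a s) (E b p) (E b q) (E b r) (E b s)
       (E p q) (E p r) (E p s) (E q r) (E q s) (E r s)"
    unfolding canonical_bits_def degs ordered_degrees_def
    using a(2) b(1) lt bmax ys(3) unfolding pqrs key_def by simp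
  then show thesis using that perm b(2) unfolding pqrs by blast
qed

lemma sum_excess_relabel:
  assumes "xs \<in> permutations_of_set {..<6}"
  shows "(\<Sum>ys\<in>permutations_of_set {..<6}. excess (\<lambda>i j. E (xs ! i) (xs ! j)) ys) =
    (\<Sum>ys\<in>permutations_of_set {..<6}. excess E ys)"
proof -
  have xs: "set xs = {..<6}" "distinct xs" "length xs = 6"
    by (fact permutations_of_setD(1)[OF assms], fact permutations_of_setD(2)[OF assms],
        simp only: length_finite_permutations_of_set[OF assms] card_lessThan)
  have bij: "bij_betw ((!) xs) {..<6} {..<6}"
    by (rule bij_betw_nth) (simp_all only: xs)
  have "excess (\<lambda>i j. E (xs ! i) (xs ! j)) ys = excess E (map ((!) xs) ys)" for ys
    by (cases "(E, ys)" rule: excess.cases) simp_all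
  then have "(\<Sum>ys\<in>permutations_of_set {..<6}. excess (\<lambda>i j. E (xs ! i) (xs ! j)) ys) =
      (\<Sum>ys\<in>permutations_of_set {..<6}. excess E (map ((!) xs) ys))"
    by simp
  also have "\<dots> = (\<Sum>ys\<in>map ((!) xs) ` permutations_of_set {..<6}. excess E ys)"
  proof (subst sum.reindex)
    show "inj_on (map ((!) xs)) (permutations_of_set {..<6})"
    proof (rule inj_onI)
      fix ys zs assume "ys \<in> permutations_of_set {..<6}" "zs \<in> permutations_of_set {..<6}"
        and eq: "map ((!) xs) ys = map ((!) xs) zs"
      then have "set ys \<union> set zs = {..<6}"
        using permutations_of_setD(1) by blast
      then show "ys = zs"
        using map_inj_on[OF eq] bij_betw_imp_inj_on[OF bij] by simp
    qed
  qed (simp add: o_def)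
  also have "map ((!) xs) ` permutations_of_set {..<6} = permutations_of_set {..<6}"
    using permutations_of_set_image_inj[OF bij_betw_imp_inj_on[OF bij]] bij_betw_imp_surj_on[OF bij] by metis
  finally show ?thesis .
qed

lemma coloured_by_relabel:
  assumes "xs \<in> permutations_of_set {..<6}" "coloured_by (\<lambda>i j. E (xs ! i) (xs ! j)) c"
  shows "\<exists>c. coloured_by E c"
proof -
  have xs: "set xs = {..<6}" "distinct xs" "length xs = 6"
    by (fact permutations_of_setD(1)[OF assms(1)], fact permutations_of_setD(2)[OF assms(1)],
        simp only: length_finite_permutations_of_set[OF assms(1)] card_lessThan)
  have "bij_betw ((!) xs) {..<6} {..<6}"
    by (rule bij_betw_nth) (simp_all only: xs)
  then have ex: "\<exists>k<6. xs ! k = i" if "i < 6" for i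
    using that by (metis bij_betw_imp_surj_on image_iff lessThan_iff)
  define g where "g i = (SOME k. k < 6 \<and> xs ! k = i)" for i
  have g: "g i < 6" "xs ! g i = i" if "i < 6" for i
    using someI_ex[OF ex[OF that, unfolded Bex_def]] unfolding g_def by auto
  have "coloured_by E (c \<circ> g)"
    using assms(2) g unfolding coloured_by_def by (metis comp_apply)
  then show ?thesis by blast
qed

text \<open>With an edge, relabel to a canonical order and use the finite check. A graph without edges is checked
  directly; it is a blowup with all vertices in \<open>Left\<close>. The term \<open>of_bool\<close> is the slack on graphs that are not
  blowups.\<close>

lemma sum_excess_le:
  assumes sym: "\<And>i j. E i j = E j i" and irr: "\<And>i. \<not> E i i"
  shows "(\<Sum>ys\<in>permutations_of_set {..<6}. excess E ys) \<le> 16 * (7200 - of_bool (\<nexists>c. coloured_by E c))"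
proof (cases "\<exists>u<6. \<exists>u'<6. E u u'")
  case True
  then obtain u u' where "u < 6" "u' < 6" "E u u'" by auto
  from exists_canonical_order[of E, OF sym irr this] obtain a b p q r s where
    perm: "[a, b, p, q, r, s] \<in> permutations_of_set {..<6}" and "E a b" and
    can: "canonical_bits True (E a p) (E a q) (E a r) (E a s) (E b p) (E b q) (E b r) (E b s)
       (E p q) (E p r) (E p s) (E q r) (E q s) (E r s)" by metis
  define E' where "E' = (\<lambda>i j. E ([a, b, p, q, r, s] ! i) ([a, b, p, q, r, s] ! j))"
  have sym': "E' i j = E' j i" for i j
    unfolding E'_def by (rule sym)
  have "total_of E' \<le> 7200 - of_bool (\<nexists>c. coloured_by E' c)"
    using good_of_canonical[OF can] \<open>E a b\<close>
    by (intro good_bitsD sym') (simp add: E'_def eval_nat_numeral)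
  moreover have "(\<exists>c. coloured_by E' c) \<longrightarrow> (\<exists>c. coloured_by E c)"
    using coloured_by_relabel[OF perm] unfolding E'_def by blast
  then have "(of_bool (\<nexists>c. coloured_by E c) :: int) \<le> of_bool (\<nexists>c. coloured_by E' c)"
    by auto
  ultimately have "total_of E' \<le> 7200 - of_bool (\<nexists>c. coloured_by E c)"
    by linarith
  then have "16 * total_of E' \<le> 16 * (7200 - of_bool (\<nexists>c. coloured_by E c))"
    by (rule mult_left_mono) simp
  also have "16 * total_of E' = (\<Sum>ys\<in>permutations_of_set {..<6}. excess E ys)"
    using sum_excess_relabel[OF perm, of E, folded E'_def] sum_excess_eq_total[of E', OF sym'] by metis
  finally show ?thesis .
next
  case False
  then have E: "E i j = False" if "i < 6" "j < 6" for i j using that by blast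
  have "total_of E = 7200"
    by (simp add: E total_bits_def term_bits_def copy_bits_def pair_gram_def nonedge_gram_def)
  moreover have "coloured_by E (\<lambda>_. Left)"
    unfolding coloured_by_def using E by simp
  ultimately show ?thesis
    using sum_excess_eq_total[of E, OF sym] by auto
qed

section \<open>The upper bound on copies\<close>

text \<open>The double sum of each product of linear forms is a square.\<close>

lemma double_sum_forms_nonneg:
  fixes fs :: "(real \<times> ('b \<Rightarrow> real)) list"
  assumes "\<forall>(w, L)\<in>set fs. 0 \<le> w"
  shows "0 \<le> (\<Sum>i\<in>A. \<Sum>j\<in>A. \<Sum>(w, L)\<leftarrow>fs. w * L (h i) * L (h j))"
  using assms
proof (induction fs)
  case (Cons f fs)
  obtain w L where f: "f = (w, L)" by (cases f)
  have "(\<Sum>i\<in>A. \<Sum>j\<in>A. w * L (h i) * L (h j)) = w * (\<Sum>i\<in>A. L (h i))\<^sup>2"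
    unfolding power2_eq_square sum_product by (simp only: sum_distrib_left mult.assoc)
  then show ?case
    using Cons unfolding f by (simp add: sum.distrib)
qed simp

lemma double_sum_gram_nonneg: "0 \<le> (\<Sum>i\<in>A. \<Sum>j\<in>A. real_of_int (pair_gram e (h i) (h j)))"
  unfolding pair_gram_forms by (intro double_sum_forms_nonneg) (auto dest: pair_forms_weight)

abbreviation maps_to :: "nat set \<Rightarrow> (nat \<Rightarrow> nat) set" where
  "maps_to V \<equiv> {..<6} \<rightarrow>\<^sub>E V"

definition pullback :: "(nat \<Rightarrow> nat \<Rightarrow> bool) \<Rightarrow> (nat \<Rightarrow> nat) \<Rightarrow> nat \<Rightarrow> nat \<Rightarrow> bool" where
  "pullback E \<phi> = (\<lambda>i j. E (\<phi> i) (\<phi> j))"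

definition F31_edge :: "nat \<Rightarrow> nat \<Rightarrow> bool" where
  "F31_edge i j \<longleftrightarrow> {i, j} \<in> edges F31"

definition copies :: "(nat \<Rightarrow> nat \<Rightarrow> bool) \<Rightarrow> nat set \<Rightarrow> (nat \<Rightarrow> nat) set" where
  "copies E V = {\<phi> \<in> maps_to V. \<forall>i<6. \<forall>j<6. E (\<phi> i) (\<phi> j) = F31_edge i j}"

lemma less_6_cases:
  "i < 6 \<Longrightarrow> i = 0 \<or> i = 1 \<or> i = 2 \<or> i = 3 \<or> i = 4 \<or> i = (5::nat)"
  by linarith

definition map_of_six :: "nat \<Rightarrow> nat \<Rightarrow> nat \<Rightarrow> nat \<Rightarrow> nat \<Rightarrow> nat \<Rightarrow> nat \<Rightarrow> nat" where
  "map_of_six a b c d e f = (\<lambda>i\<in>{..<6}. [a, b, c, d, e, f] ! i)"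

lemma map_of_six_simps:
  "map_of_six a b c d e f 0 = a" "map_of_six a b c d e f 1 = b" "map_of_six a b c d e f 2 = c"
  "map_of_six a b c d e f 3 = d" "map_of_six a b c d e f 4 = e" "map_of_six a b c d e f 5 = f"
  by (simp_all add: map_of_six_def eval_nat_numeral)

lemma map_of_six_mem:
  assumes "a \<in> V" "b \<in> V" "c \<in> V" "d \<in> V" "e \<in> V" "f \<in> V"
  shows "map_of_six a b c d e f \<in> maps_to V"
proof (rule PiE_I)
  fix i :: nat assume "i \<in> {..<6}"
  then have "i < 6" by simp
  then show "map_of_six a b c d e f i \<in> V"
    using less_6_cases[OF \<open>i < 6\<close>] assms by (elim disjE) (simp_all only: map_of_six_simps)
qed (simp add: map_of_six_def)

lemma map_of_six_eta:
  assumes "\<phi> \<in> maps_to V"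
  shows "map_of_six (\<phi> 0) (\<phi> 1) (\<phi> 2) (\<phi> 3) (\<phi> 4) (\<phi> 5) = \<phi>"
proof
  fix i :: nat
  show "map_of_six (\<phi> 0) (\<phi> 1) (\<phi> 2) (\<phi> 3) (\<phi> 4) (\<phi> 5) i = \<phi> i"
  proof (cases "i < 6")
    case True
    then show ?thesis
      using less_6_cases[OF True] by (elim disjE) (simp_all only: map_of_six_simps)
  next
    case False
    then show ?thesis
      using PiE_arb[OF assms, of i] by (simp add: map_of_six_def)
  qed
qed

text \<open>For fixed roots the two pairs range independently, which turns the sum of flag products into a double sum
  of the quadratic form.\<close>

lemma sum_maps_to_nested:
  "(\<Sum>\<phi>\<in>maps_to V. g (\<phi> 4) (\<phi> 5) (\<phi> 0, \<phi> 1) (\<phi> 2, \<phi> 3)) =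
   (\<Sum>a\<in>V. \<Sum>b\<in>V. \<Sum>s\<in>V \<times> V. \<Sum>t\<in>V \<times> V. g a b s t)"
proof -
  let ?i = "\<lambda>(a, b, (c, d), (e, f)). map_of_six c d e f a b"
  have "(\<Sum>\<phi>\<in>maps_to V. g (\<phi> 4) (\<phi> 5) (\<phi> 0, \<phi> 1) (\<phi> 2, \<phi> 3)) =
      (\<Sum>(a, b, s, t)\<in>V \<times> V \<times> (V \<times> V) \<times> (V \<times> V). g a b s t)"
  proof (rule sum.reindex_bij_witness[where i = ?i and
        j = "\<lambda>\<phi>. (\<phi> 4, \<phi> 5, (\<phi> 0, \<phi> 1), (\<phi> 2, \<phi> 3))"])
    fix \<phi> assume \<phi>: "\<phi> \<in> maps_to V"
    show "?i (\<phi> 4, \<phi> 5, (\<phi> 0, \<phi> 1), \<phi> 2, \<phi> 3) = \<phi>"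
      using map_of_six_eta[OF \<phi>] by simp
    show "(\<phi> 4, \<phi> 5, (\<phi> 0, \<phi> 1), \<phi> 2, \<phi> 3) \<in> V \<times> V \<times> (V \<times> V) \<times> (V \<times> V)"
      using PiE_mem[OF \<phi>] by simp
    show "(case (\<phi> 4, \<phi> 5, (\<phi> 0, \<phi> 1), \<phi> 2, \<phi> 3) of (a, b, s, t) \<Rightarrow> g a b s t) =
        g (\<phi> 4) (\<phi> 5) (\<phi> 0, \<phi> 1) (\<phi> 2, \<phi> 3)"
      by simp
  next
    fix t assume t: "t \<in> V \<times> V \<times> (V \<times> V) \<times> (V \<times> V)"
    then obtain a b c d e f where abc: "t = (a, b, (c, d), (e, f))"
      "a \<in> V" "b \<in> V" "c \<in> V" "d \<in> V" "e \<in> V" "f \<in> V" by blast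
    show "?i t \<in> maps_to V"
      unfolding abc(1) prod.case by (intro map_of_six_mem abc)
    show "(?i t 4, ?i t 5, (?i t 0, ?i t 1), ?i t 2, ?i t 3) = t"
      unfolding abc(1) prod.case map_of_six_simps ..
  qed
  also have "\<dots> = (\<Sum>a\<in>V. \<Sum>b\<in>V. \<Sum>s\<in>V \<times> V. \<Sum>t\<in>V \<times> V. g a b s t)"
    by (simp only: sum.cartesian_product)
  finally show ?thesis .
qed

text \<open>Composition with a permutation of the six points permutes the maps, so that each order of the points
  contributes the same sum.\<close>

lemma sum_excess_maps_to:
  assumes "ys \<in> permutations_of_set {..<6}"
  shows "(\<Sum>\<phi>\<in>maps_to V. excess (pullback E \<phi>) ys) = (\<Sum>\<phi>\<in>maps_to V. excess (pullback E \<phi>) [0, 1, 2, 3, 4, 5])"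
proof -
  have ys: "set ys = {..<6}" "distinct ys" "length ys = 6"
    by (fact permutations_of_setD(1)[OF assms], fact permutations_of_setD(2)[OF assms],
        simp only: length_finite_permutations_of_set[OF assms] card_lessThan)
  have bij: "bij_betw ((!) ys) {..<6} {..<6}"
    by (rule bij_betw_nth) (simp_all only: ys)
  let ?h = "the_inv_into {..<6} ((!) ys)"
  have h: "?h i < 6" "ys ! ?h i = i" if "i < 6" for i
    using that f_the_inv_into_f_bij_betw[OF bij] bij_betwE[OF bij_betw_the_inv_into[OF bij]] by auto
  have h': "?h (ys ! i) = i" if "i < 6" for i
    using that the_inv_into_f_f[OF bij_betw_imp_inj_on[OF bij]] by auto
  have lt: "ys ! i < 6" if "i < 6" for i
    using bij_betwE[OF bij] that by auto
  show ?thesis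
  proof (rule sum.reindex_bij_witness[where
        i = "\<lambda>\<psi>. \<lambda>i\<in>{..<6}. \<psi> (?h i)" and j = "\<lambda>\<phi>. \<lambda>i\<in>{..<6}. \<phi> (ys ! i)"])
    fix \<phi> assume "\<phi> \<in> maps_to V"
    show "(\<lambda>i\<in>{..<6}. (\<lambda>i\<in>{..<6}. \<phi> (ys ! i)) (?h i)) = \<phi>"
      by (rule ext) (use h PiE_arb[OF \<open>\<phi> \<in> maps_to V\<close>] in \<open>auto simp: restrict_def\<close>)
    show "(\<lambda>i\<in>{..<6}. \<phi> (ys ! i)) \<in> maps_to V"
      using \<open>\<phi> \<in> maps_to V\<close> lt by auto
    obtain a b c d e f where "ys = [a, b, c, d, e, f]"
      using ys(3) by (auto simp: length_Suc_conv numeral_eq_Suc)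
    then show "excess (pullback E (\<lambda>i\<in>{..<6}. \<phi> (ys ! i))) [0, 1, 2, 3, 4, 5] = excess (pullback E \<phi>) ys"
      by (simp add: pullback_def eval_nat_numeral)
  next
    fix \<psi> assume "\<psi> \<in> maps_to V"
    show "(\<lambda>i\<in>{..<6}. (\<lambda>i\<in>{..<6}. \<psi> (?h i)) (ys ! i)) = \<psi>"
      by (rule ext) (use h' lt PiE_arb[OF \<open>\<psi> \<in> maps_to V\<close>] in \<open>auto simp: restrict_def\<close>)
    show "(\<lambda>i\<in>{..<6}. \<psi> (?h i)) \<in> maps_to V"
      using \<open>\<psi> \<in> maps_to V\<close> h by auto
  qed
qed

lemma copies_iff:
  assumes sym: "\<And>x y. E x y = E y x" and irr: "\<And>x. \<not> E x x"
    and "\<phi> \<in> maps_to V"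
  shows "\<phi> \<in> copies E V \<longleftrightarrow>
    copy_bits (E (\<phi> 4) (\<phi> 5)) (E (\<phi> 4) (\<phi> 0)) (E (\<phi> 4) (\<phi> 1)) (E (\<phi> 4) (\<phi> 2)) (E (\<phi> 4) (\<phi> 3))
      (E (\<phi> 5) (\<phi> 0)) (E (\<phi> 5) (\<phi> 1)) (E (\<phi> 5) (\<phi> 2)) (E (\<phi> 5) (\<phi> 3))
      (E (\<phi> 0) (\<phi> 1)) (E (\<phi> 0) (\<phi> 2)) (E (\<phi> 0) (\<phi> 3)) (E (\<phi> 1) (\<phi> 2)) (E (\<phi> 1) (\<phi> 3)) (E (\<phi> 2) (\<phi> 3))"
  using assms(3) irr
  unfolding copies_def copy_bits_def F31_edge_def F31_def forall_less_6
  by (auto simp: doubleton_eq_iff sym[of "\<phi> (Suc 0)" "\<phi> 0"] sym[of "\<phi> 2" "\<phi> 0"] sym[of "\<phi> 3" "\<phi> 0"] sym[of "\<phi> 4" "\<phi> 0"] sym[of "\<phi> 5" "\<phi> 0"]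
   sym[of "\<phi> 2" "\<phi> (Suc 0)"] sym[of "\<phi> 3" "\<phi> (Suc 0)"] sym[of "\<phi> 4" "\<phi> (Suc 0)"] sym[of "\<phi> 5" "\<phi> (Suc 0)"] sym[of "\<phi> 3" "\<phi> 2"] sym[of "\<phi> 4" "\<phi> 2"] sym[of "\<phi> 5" "\<phi> 2"]
   sym[of "\<phi> 4" "\<phi> 3"] sym[of "\<phi> 5" "\<phi> 3"] sym[of "\<phi> 5" "\<phi> 4"])

text \<open>Sum the bound for six-vertex graphs over all maps. The maps need not be injective: a
  pullback along any map is a graph on six vertices, and the squares become exact. Here \<open>2624400 = 45 * 58320\<close>, and the
  last summand counts the maps whose pullback is not a blowup.\<close>

theorem copies_bound:
  assumes sym: "\<And>x y. E x y = E y x" and irr: "\<And>x. \<not> E x x" and "finite V"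
  shows "2624400 * real (card (copies E V)) + real (card {\<phi> \<in> maps_to V. \<nexists>c. coloured_by (pullback E \<phi>) c})
    \<le> 7200 * real (card V) ^ 6"
proof -
  let ?M = "maps_to V" and ?P = "permutations_of_set {..<6::nat}"
  have fin: "finite ?M" using \<open>finite V\<close> by (intro finite_PiE) auto
  have P: "[0, 1, 2, 3, 4, 5] \<in> ?P" "[4, 5, 0, 1, 2, 3] \<in> ?P"
    by (auto intro!: permutations_of_setI)
  have copy: "excess (pullback E \<phi>) [4, 5, 0, 1, 2, 3] =
     pair_gram (E (\<phi> 4) (\<phi> 5)) (flag_of (E (\<phi> 4) (\<phi> 0)) (E (\<phi> 5) (\<phi> 0)) (E (\<phi> 4) (\<phi> 1)) (E (\<phi> 5) (\<phi> 1)) (E (\<phi> 0) (\<phi> 1)))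
      (flag_of (E (\<phi> 4) (\<phi> 2)) (E (\<phi> 5) (\<phi> 2)) (E (\<phi> 4) (\<phi> 3)) (E (\<phi> 5) (\<phi> 3)) (E (\<phi> 2) (\<phi> 3))) + 58320 * of_bool (\<phi> \<in> copies E V)"
    if "\<phi> \<in> ?M" for \<phi>
    unfolding copies_iff[OF sym irr that] by (simp add: term_bits_def pullback_def split: bool.split)
  define G where "G a b s t = real_of_int (pair_gram (E a b)
      (case s of (c, d) \<Rightarrow> flag_of (E a c) (E b c) (E a d) (E b d) (E c d))
      (case t of (c, d) \<Rightarrow> flag_of (E a c) (E b c) (E a d) (E b d) (E c d)))" for a b s t
  have gram: "0 \<le> (\<Sum>\<phi>\<in>?M. G (\<phi> 4) (\<phi> 5) (\<phi> 0, \<phi> 1) (\<phi> 2, \<phi> 3))"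
    unfolding sum_maps_to_nested unfolding G_def
    by (intro sum_nonneg double_sum_gram_nonneg)
  have "720 * (\<Sum>\<phi>\<in>?M. excess (pullback E \<phi>) [4, 5, 0, 1, 2, 3]) =
      (\<Sum>ys\<in>?P. \<Sum>\<phi>\<in>?M. excess (pullback E \<phi>) ys)"
  proof -
    have "(\<Sum>ys\<in>?P. \<Sum>\<phi>\<in>?M. excess (pullback E \<phi>) ys) =
        (\<Sum>ys\<in>?P. \<Sum>\<phi>\<in>?M. excess (pullback E \<phi>) [4, 5, 0, 1, 2, 3])"
      by (rule sum.cong[OF refl]) (simp only: sum_excess_maps_to P(2))
    then show ?thesis by (simp add: fact_numeral)
  qed
  also have "\<dots> = (\<Sum>\<phi>\<in>?M. \<Sum>ys\<in>?P. excess (pullback E \<phi>) ys)"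
    by (rule sum.swap)
  also have "\<dots> \<le> (\<Sum>\<phi>\<in>?M. 16 * (7200 - of_bool (\<nexists>c. coloured_by (pullback E \<phi>) c)))"
    by (intro sum_mono sum_excess_le) (simp_all add: pullback_def sym irr)
  also have "\<dots> = 16 * (7200 * int (card ?M) - int (card {\<phi> \<in> ?M. \<nexists>c. coloured_by (pullback E \<phi>) c}))"
    using fin by (simp add: sum_distrib_left[symmetric] sum_subtractf sum_of_bool_eq Int_def)
  finally have "real_of_int (720 * (\<Sum>\<phi>\<in>?M. excess (pullback E \<phi>) [4, 5, 0, 1, 2, 3])) \<le>
     real_of_int (16 * (7200 * int (card ?M) - int (card {\<phi> \<in> ?M. \<nexists>c. coloured_by (pullback E \<phi>) c})))"
    by (simp only: of_int_le_iff)
  then have *: "720 * real_of_int (\<Sum>\<phi>\<in>?M. excess (pullback E \<phi>) [4, 5, 0, 1, 2, 3]) \<le>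
     16 * (7200 * real (card ?M) - real (card {\<phi> \<in> ?M. \<nexists>c. coloured_by (pullback E \<phi>) c}))"
    by (simp only: of_int_mult of_int_diff of_int_of_nat_eq of_int_numeral)
  have "real_of_int (\<Sum>\<phi>\<in>?M. excess (pullback E \<phi>) [4, 5, 0, 1, 2, 3]) =
     (\<Sum>\<phi>\<in>?M. G (\<phi> 4) (\<phi> 5) (\<phi> 0, \<phi> 1) (\<phi> 2, \<phi> 3) + 58320 * of_bool (\<phi> \<in> copies E V))"
    unfolding of_int_sum by (intro sum.cong refl) (simp only: copy G_def prod.case of_int_add of_int_mult of_int_numeral of_int_of_bool)
  also have "\<dots> = (\<Sum>\<phi>\<in>?M. G (\<phi> 4) (\<phi> 5) (\<phi> 0, \<phi> 1) (\<phi> 2, \<phi> 3)) + 58320 * real (card (copies E V))"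
  proof -
    have "?M \<inter> {\<phi>. \<phi> \<in> copies E V} = copies E V" unfolding copies_def by auto
    then show ?thesis
      using fin by (simp add: sum.distrib sum_distrib_left[symmetric] sum_of_bool_eq Int_def)
  qed
  finally have "58320 * real (card (copies E V)) \<le> real_of_int (\<Sum>\<phi>\<in>?M. excess (pullback E \<phi>) [4, 5, 0, 1, 2, 3])"
    using gram by linarith
  moreover have "real (card ?M) = real (card V) ^ 6" by (simp add: card_PiE)
  moreover have "2624400 * k + b \<le> 7200 * N"
    if "58320 * k \<le> t" "m = N" "720 * t \<le> 16 * (7200 * m - b)" for k b N t m :: real
  proof -
    have "45 * t \<le> 7200 * m - b" using that(3) by simp
    then show ?thesis using that(1,2) by linarith
  qed
  ultimately show ?thesis using * by blast
qed

section \<open>Colourings of a copy by the parts\<close>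

definition emb :: "(nat \<Rightarrow> nat \<Rightarrow> bool) \<Rightarrow> nat set \<Rightarrow> (nat \<Rightarrow> nat) set" where
  "emb E V = {\<phi> \<in> copies E V. inj_on \<phi> {..<6}}"

fun mirror :: "part \<Rightarrow> part" where
  "mirror Clique = Clique" | "mirror Left = Right" | "mirror Right = Left"

text \<open>The colouring of the target that places the 4-cycle across \<open>Left\<close> and \<open>Right\<close> and the edge in the clique.
  Its only companion is the one with \<open>Left\<close> and \<open>Right\<close> exchanged.\<close>

definition std :: "nat \<Rightarrow> part" where
  "std i = (if i < 2 then Left else if i < 4 then Right else Clique)"

lemma joined_mirror: "joined (mirror c) (mirror d) = joined c d"
  by (cases c; cases d) simp_all

lemma F31_edge_std:
  assumes "i < 6" "j < 6" "i \<noteq> j"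
  shows "F31_edge i j = joined (std i) (std j)"
  using less_6_cases[OF assms(1)] less_6_cases[OF assms(2)] assms(3)
  by (elim disjE) (simp_all add: F31_edge_def F31_def std_def doubleton_eq_iff)

lemma F31_edge_irrefl: "\<not> F31_edge i i"
  by (auto simp: F31_edge_def F31_def)

definition standard_off :: "nat \<Rightarrow> (nat \<Rightarrow> part) \<Rightarrow> bool" where
  "standard_off k c \<longleftrightarrow> (\<forall>i<6. i \<noteq> k \<longrightarrow> c i = std i) \<or> (\<forall>i<6. i \<noteq> k \<longrightarrow> c i = mirror (std i))"

text \<open>A path on three vertices cannot meet the clique part, since there its ends would be adjacent.\<close>

lemma forced_path:
  assumes "joined a b" "joined a b'" "\<not> joined b b'"
  shows "a = Left \<and> b = Right \<and> b' = Right \<or> a = Right \<and> b = Left \<and> b' = Left"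
  using assms by (cases a; cases b; cases b') simp_all

text \<open>Deleting one vertex leaves a path on three vertices and two further vertices, or the 4-cycle and a single
  vertex. The path, or the 4-cycle, fixes the sides, and a vertex isolated from both sides must lie in the clique part.\<close>

lemma colouring_forced:
  assumes k: "k < 6" and right: "\<And>i j. i < 6 \<Longrightarrow> j < 6 \<Longrightarrow> i \<noteq> j \<Longrightarrow> i \<noteq> k \<Longrightarrow> j \<noteq> k \<Longrightarrow> F31_edge i j = joined (c i) (c j)"
  shows "standard_off k c"
proof -
  have r: "joined (std i) (std j) = joined (c i) (c j)" if "i < 6" "j < 6" "i \<noteq> j" "i \<noteq> k" "j \<noteq> k" for i j
    using right[OF that] F31_edge_std that by simp
  show ?thesis
    using less_6_cases[OF k]
  proof (elim disjE)
    assume k: "k = 0"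
    have F: "joined (c 1) (c 2)" "joined (c 1) (c 3)" "\<not> joined (c 2) (c 3)" "\<not> joined (c 4) (c 1)" "\<not> joined (c 4) (c 2)" "\<not> joined (c 5) (c 1)" "\<not> joined (c 5) (c 2)"
      using r[of 1 2] r[of 1 3] r[of 2 3] r[of 4 1] r[of 4 2] r[of 5 1] r[of 5 2] by (simp_all add: k std_def)
    from forced_path[OF F(1-3)] show ?thesis
      by (elim disjE conjE; cases "c 4"; cases "c 5") (use F k in \<open>simp_all add: standard_off_def forall_less_6 std_def\<close>)
  next
    assume k: "k = 1"
    have F: "joined (c 0) (c 2)" "joined (c 0) (c 3)" "\<not> joined (c 2) (c 3)" "\<not> joined (c 4) (c 0)" "\<not> joined (c 4) (c 2)" "\<not> joined (c 5) (c 0)" "\<not> joined (c 5) (c 2)"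
      using r[of 0 2] r[of 0 3] r[of 2 3] r[of 4 0] r[of 4 2] r[of 5 0] r[of 5 2] by (simp_all add: k std_def)
    from forced_path[OF F(1-3)] show ?thesis
      by (elim disjE conjE; cases "c 4"; cases "c 5") (use F k in \<open>simp_all add: standard_off_def forall_less_6 std_def\<close>)
  next
    assume k: "k = 2"
    have F: "joined (c 3) (c 0)" "joined (c 3) (c 1)" "\<not> joined (c 0) (c 1)" "\<not> joined (c 4) (c 3)" "\<not> joined (c 4) (c 0)" "\<not> joined (c 5) (c 3)" "\<not> joined (c 5) (c 0)"
      using r[of 3 0] r[of 3 1] r[of 0 1] r[of 4 3] r[of 4 0] r[of 5 3] r[of 5 0] by (simp_all add: k std_def)
    from forced_path[OF F(1-3)] show ?thesis
      by (elim disjE conjE; cases "c 4"; cases "c 5") (use F k in \<open>simp_all add: standard_off_def forall_less_6 std_def\<close>)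
  next
    assume k: "k = 3"
    have F: "joined (c 2) (c 0)" "joined (c 2) (c 1)" "\<not> joined (c 0) (c 1)" "\<not> joined (c 4) (c 2)" "\<not> joined (c 4) (c 0)" "\<not> joined (c 5) (c 2)" "\<not> joined (c 5) (c 0)"
      using r[of 2 0] r[of 2 1] r[of 0 1] r[of 4 2] r[of 4 0] r[of 5 2] r[of 5 0] by (simp_all add: k std_def)
    from forced_path[OF F(1-3)] show ?thesis
      by (elim disjE conjE; cases "c 4"; cases "c 5") (use F k in \<open>simp_all add: standard_off_def forall_less_6 std_def\<close>)
  next
    assume k: "k = 4"
    have F: "joined (c 0) (c 2)" "joined (c 0) (c 3)" "\<not> joined (c 2) (c 3)" "\<not> joined (c 1) (c 0)" "joined (c 1) (c 2)" "\<not> joined (c 5) (c 0)" "\<not> joined (c 5) (c 2)"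
      using r[of 0 2] r[of 0 3] r[of 2 3] r[of 1 0] r[of 1 2] r[of 5 0] r[of 5 2] by (simp_all add: k std_def)
    from forced_path[OF F(1-3)] show ?thesis
      by (elim disjE conjE; cases "c 1"; cases "c 5") (use F k in \<open>simp_all add: standard_off_def forall_less_6 std_def\<close>)
  next
    assume k: "k = 5"
    have F: "joined (c 0) (c 2)" "joined (c 0) (c 3)" "\<not> joined (c 2) (c 3)" "\<not> joined (c 1) (c 0)" "joined (c 1) (c 2)" "\<not> joined (c 4) (c 0)" "\<not> joined (c 4) (c 2)"
      using r[of 0 2] r[of 0 3] r[of 2 3] r[of 1 0] r[of 1 2] r[of 4 0] r[of 4 2] by (simp_all add: k std_def)
    from forced_path[OF F(1-3)] show ?thesis
      by (elim disjE conjE; cases "c 1"; cases "c 4") (use F k in \<open>simp_all add: standard_off_def forall_less_6 std_def\<close>)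
  qed
qed

text \<open>Off each end of the pair the colouring is standard up to exchange of the sides, so both ends have their standard
  parts and the pair agrees after all. This is why a wrong pair lies in a copy only together with
  another wrong pair.\<close>

lemma one_disagreement_impossible:
  assumes kl: "k < 6" "l < 6" "k \<noteq> l" and "F31_edge k l \<noteq> joined (c k) (c l)"
    and right: "\<And>i j. i < 6 \<Longrightarrow> j < 6 \<Longrightarrow> i \<noteq> j \<Longrightarrow> {i, j} \<noteq> {k, l} \<Longrightarrow> F31_edge i j = joined (c i) (c j)"
  shows False
proof -
  have "standard_off k c" "standard_off l c"
    using right kl by (auto intro!: colouring_forced simp: doubleton_eq_iff)
  moreover have False if "\<forall>i<6. i \<noteq> k' \<longrightarrow> c i = std i" "\<forall>i<6. i \<noteq> l' \<longrightarrow> c i = mirror (std i)" for k' l'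
  proof -
    have "{0, 1, 2, 3} \<subseteq> {k', l'}"
    proof
      fix i :: nat assume i: "i \<in> {0, 1, 2, 3}"
      then have "std i \<noteq> mirror (std i)" "i < 6" by (auto simp: std_def)
      then show "i \<in> {k', l'}" using that by force
    qed
    then have "card {0, 1, 2, 3 :: nat} \<le> card {k', l'}"
      by (intro card_mono) simp_all
    also have "\<dots> \<le> 2" by (simp add: card_insert_if)
    finally show False by simp
  qed
  ultimately consider "\<forall>i<6. c i = std i" | "\<forall>i<6. c i = mirror (std i)"
    using kl unfolding standard_off_def by metis
  then have "joined (c k) (c l) = joined (std k) (std l)"
    by cases (use kl in \<open>simp_all add: joined_mirror\<close>)
  then show False using assms(4) F31_edge_std[OF kl] by simp
qed

lemma card_maps_with_pair:
  assumes "finite V" "i < 6" "j < 6" "i \<noteq> j" "K \<subseteq> {..<6} - {i, j}" "finite R"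
  shows "card {\<phi> \<in> maps_to V. (\<phi> i, \<phi> j) \<in> R \<and> (\<forall>m\<in>K. \<phi> m = f m)} \<le> card R * card V ^ (4 - card K)"
proof -
  let ?A = "{\<phi> \<in> maps_to V. (\<phi> i, \<phi> j) \<in> R \<and> (\<forall>m\<in>K. \<phi> m = f m)}"
  let ?J = "{..<6} - {i, j} - K"
  let ?h = "\<lambda>\<phi>. ((\<phi> i, \<phi> j), restrict \<phi> ?J)"
  have "inj_on ?h ?A"
  proof (rule inj_onI)
    fix \<phi> \<psi> assume A: "\<phi> \<in> ?A" "\<psi> \<in> ?A" and eq: "?h \<phi> = ?h \<psi>"
    from eq have e: "\<phi> i = \<psi> i" "\<phi> j = \<psi> j" "restrict \<phi> ?J = restrict \<psi> ?J"
      by (simp_all only: prod.inject)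
    from A have M: "\<phi> \<in> maps_to V" "\<psi> \<in> maps_to V" and K: "\<forall>m\<in>K. \<phi> m = f m" "\<forall>m\<in>K. \<psi> m = f m"
      by blast+
    show "\<phi> = \<psi>"
    proof
      fix m
      consider "m = i" | "m = j" | "m \<in> K" | "m \<in> ?J" | "m \<notin> {..<6}" by blast
      then show "\<phi> m = \<psi> m"
      proof cases
        case 4
        then show ?thesis using fun_cong[OF e(3), of m] by (simp only: restrict_apply')
      next
        case 5
        then show ?thesis using PiE_arb[OF M(1) 5] PiE_arb[OF M(2) 5] by simp
      qed (use e(1,2) K in simp_all)
    qed
  qed
  moreover have "?h ` ?A \<subseteq> R \<times> (?J \<rightarrow>\<^sub>E V)"
  proof (rule image_subsetI)
    fix \<phi> assume "\<phi> \<in> ?A"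
    then have "(\<phi> i, \<phi> j) \<in> R" "\<forall>m<6. \<phi> m \<in> V" by blast+
    then show "?h \<phi> \<in> R \<times> (?J \<rightarrow>\<^sub>E V)"
      unfolding mem_Times_iff fst_conv snd_conv restrict_PiE_iff by blast
  qed
  moreover have "finite (R \<times> (?J \<rightarrow>\<^sub>E V))"
    using assms by (intro finite_cartesian_product finite_PiE) auto
  ultimately have "card ?A \<le> card (R \<times> (?J \<rightarrow>\<^sub>E V))"
    by (rule card_inj_on_le)
  also have "\<dots> = card R * card V ^ card ?J"
    by (simp add: card_cartesian_product card_PiE)
  also have "card ?J = 4 - card K"
  proof -
    have "card ({..<6} - {i, j}) = 4"
      using assms(2-4) by (subst card_Diff_subset) auto
    then show ?thesis
      using assms(5) finite_subset[OF assms(5)] by (subst card_Diff_subset) auto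
  qed
  finally show ?thesis .
qed

lemma card_UN_pairs_le:
  fixes P :: "nat \<Rightarrow> nat \<Rightarrow> bool"
  assumes "\<And>i j. i < 6 \<Longrightarrow> j < 6 \<Longrightarrow> P i j \<Longrightarrow> card (A i j) \<le> (b::nat)"
    and "S \<subseteq> (\<Union>(i, j)\<in>{(i, j). i < 6 \<and> j < 6 \<and> P i j}. A i j)"
    and "\<And>i j. finite (A i j)"
  shows "card S \<le> 36 * b"
proof -
  let ?I = "{(i, j). i < 6 \<and> j < 6 \<and> P i j}"
  have I: "?I \<subseteq> {..<6} \<times> {..<6}" by auto
  then have fin: "finite ?I" by (rule finite_subset) simp
  have "card ?I \<le> card ({..<6::nat} \<times> {..<6::nat})"
    using I by (intro card_mono) simp_all
  then have I36: "card ?I \<le> 36" by simp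
  have "card S \<le> card (\<Union>(i, j)\<in>?I. A i j)"
    using assms(2,3) fin by (intro card_mono) auto
  also have "\<dots> \<le> (\<Sum>(i, j)\<in>?I. card (A i j))"
    using card_UN_le[OF fin, of "\<lambda>(i, j). A i j"] by (simp add: split_beta)
  also have "\<dots> \<le> (\<Sum>p\<in>?I. b)"
    using assms(1) by (intro sum_mono) auto
  also have "\<dots> \<le> 36 * b" using I36 by simp
  finally show ?thesis .
qed

lemma finite_maps_to: "finite V \<Longrightarrow> finite (maps_to V)"
  by (intro finite_PiE) auto

lemma card_maps_with_some_pair:
  assumes "finite V" "finite R"
  shows "card {\<phi> \<in> maps_to V. \<exists>i<6. \<exists>j<6. i \<noteq> j \<and> (\<phi> i, \<phi> j) \<in> R} \<le> 36 * (card R * card V ^ 4)"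
proof (rule card_UN_pairs_le[where P = "(\<noteq>)" and A = "\<lambda>i j. {\<phi> \<in> maps_to V. (\<phi> i, \<phi> j) \<in> R}"])
  fix i j :: nat assume "i < 6" "j < 6" "i \<noteq> j"
  from card_maps_with_pair[OF assms(1) this _ assms(2), of "{}"]
  show "card {\<phi> \<in> maps_to V. (\<phi> i, \<phi> j) \<in> R} \<le> card R * card V ^ 4" by simp
qed (use finite_maps_to[OF assms(1)] in auto)

lemma card_maps_at_vertex_with_pair:
  assumes "finite V" "finite R" "k < 6"
  shows "card {\<phi> \<in> maps_to V. \<phi> k = v \<and> (\<exists>i<6. \<exists>j<6. i \<noteq> j \<and> i \<noteq> k \<and> j \<noteq> k \<and> (\<phi> i, \<phi> j) \<in> R)} \<le> 36 * (card R * card V ^ 3)"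
proof (rule card_UN_pairs_le[where P = "\<lambda>i j. i \<noteq> j \<and> i \<noteq> k \<and> j \<noteq> k" and
      A = "\<lambda>i j. {\<phi> \<in> maps_to V. (\<phi> i, \<phi> j) \<in> R \<and> (\<forall>m\<in>{k}. \<phi> m = v)}"])
  fix i j :: nat assume ij: "i < 6" "j < 6" "i \<noteq> j \<and> i \<noteq> k \<and> j \<noteq> k"
  then show "card {\<phi> \<in> maps_to V. (\<phi> i, \<phi> j) \<in> R \<and> (\<forall>m\<in>{k}. \<phi> m = v)} \<le> card R * card V ^ 3"
    using card_maps_with_pair[OF assms(1), of i j "{k}" R "\<lambda>_. v"] assms by simp
qed (use finite_maps_to[OF assms(1)] in auto)

lemma card_maps_at_pair_with_pair:
  assumes "finite V" "finite R" "k < 6" "l < 6" "k \<noteq> l" and sym: "\<And>x y. (x, y) \<in> R \<Longrightarrow> (y, x) \<in> R"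
    and deg: "\<And>x. card {y. (x, y) \<in> R} \<le> D"
  shows "card {\<phi> \<in> maps_to V. \<phi> k = u \<and> \<phi> l = v \<and>
     (\<exists>i<6. \<exists>j<6. i \<noteq> j \<and> {i, j} \<noteq> {k, l} \<and> (\<phi> i, \<phi> j) \<in> R)} \<le> 36 * (card R * card V ^ 2 + D * card V ^ 3)"
proof (rule card_UN_pairs_le[where P = "\<lambda>i j. i \<noteq> j \<and> {i, j} \<noteq> {k, l}" and
      A = "\<lambda>i j. {\<phi> \<in> maps_to V. \<phi> k = u \<and> \<phi> l = v \<and> (\<phi> i, \<phi> j) \<in> R}"])
  let ?A = "\<lambda>i j. {\<phi> \<in> maps_to V. \<phi> k = u \<and> \<phi> l = v \<and> (\<phi> i, \<phi> j) \<in> R}"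
  have star: "card (?A i j) \<le> D * card V ^ 3"
    if "i \<in> {k, l}" "j < 6" "j \<notin> {k, l}" for i j
  proof -
    define l' where "l' = (if i = k then l else k)"
    define x where "x = (if i = k then u else v)"
    define y where "y = (if i = k then v else u)"
    have l': "l' \<in> {..<6} - {i, j}" "i < 6" "i \<noteq> j"
      using that assms unfolding l'_def by auto
    have finS: "finite {z. (x, z) \<in> R}"
      by (rule finite_subset[OF _ finite_imageI[OF \<open>finite R\<close>, of snd]]) force
    have "?A i j \<subseteq> {\<phi> \<in> maps_to V. (\<phi> i, \<phi> j) \<in> {x} \<times> {z. (x, z) \<in> R} \<and> (\<forall>m\<in>{l'}. \<phi> m = y)}"
      using that unfolding x_def y_def l'_def by auto
    then have "card (?A i j) \<le> card {\<phi> \<in> maps_to V. (\<phi> i, \<phi> j) \<in> {x} \<times> {z. (x, z) \<in> R} \<and> (\<forall>m\<in>{l'}. \<phi> m = y)}"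
      using finite_maps_to[OF assms(1)] by (intro card_mono) auto
    also have "\<dots> \<le> card ({x} \<times> {z. (x, z) \<in> R}) * card V ^ (4 - card {l'})"
      using l' that finS by (intro card_maps_with_pair assms(1)) auto
    also have "\<dots> \<le> D * card V ^ 3"
      using deg[of x] by (simp add: card_cartesian_product)
    finally show ?thesis .
  qed
  fix i j :: nat assume ij: "i < 6" "j < 6" "i \<noteq> j \<and> {i, j} \<noteq> {k, l}"
  then consider "i \<in> {k, l}" "j \<notin> {k, l}" | "j \<in> {k, l}" "i \<notin> {k, l}" | "i \<notin> {k, l}" "j \<notin> {k, l}"
    by auto
  then show "card (?A i j) \<le> card R * card V ^ 2 + D * card V ^ 3"
  proof cases
    case 1
    then show ?thesis using star[OF 1(1) ij(2) 1(2)] by simp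
  next
    case 2
    have "?A i j = ?A j i" using sym by blast
    then show ?thesis using star[OF 2(1) ij(1) 2(2)] by simp
  next
    case 3
    have "?A i j = {\<phi> \<in> maps_to V. (\<phi> i, \<phi> j) \<in> R \<and> (\<forall>m\<in>{k, l}. \<phi> m = (if m = k then u else v))}"
      using assms(5) by auto
    also have "card \<dots> \<le> card R * card V ^ (4 - card {k, l})"
      using 3 ij assms by (intro card_maps_with_pair) auto
    finally show ?thesis using assms(5) by simp
  qed
qed (use finite_maps_to[OF assms(1)] in auto)

section \<open>Counting copies near a blowup\<close>

text \<open>The Boolean selects one of the two colourings of the target.\<close>

definition scheme :: "bool \<Rightarrow> nat \<Rightarrow> part" where
  "scheme b i = (if b then mirror (std i) else std i)"

lemma F31_edge_scheme:
  "i < 6 \<Longrightarrow> j < 6 \<Longrightarrow> i \<noteq> j \<Longrightarrow> F31_edge i j = joined (scheme b i) (scheme b j)"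
  by (simp add: scheme_def F31_edge_std joined_mirror)

lemma standard_off_iff: "standard_off k c \<longleftrightarrow> (\<exists>b. \<forall>i<6. i \<noteq> k \<longrightarrow> c i = scheme b i)"
  unfolding standard_off_def scheme_def ex_bool_eq by auto

lemma colouring_forced_everywhere:
  assumes right: "\<And>i j. i < 6 \<Longrightarrow> j < 6 \<Longrightarrow> i \<noteq> j \<Longrightarrow> F31_edge i j = joined (c i) (c j)"
  shows "\<exists>b. \<forall>i<6. c i = scheme b i"
proof -
  obtain b where b: "\<forall>i<6. i \<noteq> 4 \<longrightarrow> c i = scheme b i"
    using colouring_forced[of 4 c] right unfolding standard_off_iff by auto
  have "joined (c 4) (c 0) = joined (scheme b 4) (scheme b 0)" "joined (c 4) (c 2) = joined (scheme b 4) (scheme b 2)"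
    using right[of 4 0] right[of 4 2] F31_edge_scheme[of 4 0 b] F31_edge_scheme[of 4 2 b] by simp_all
  then have "c 4 = scheme b 4"
    using b by (cases "c 4"; cases b) (simp_all add: scheme_def std_def)
  then show ?thesis using b by metis
qed

lemma F31_edge_sym: "F31_edge i j = F31_edge j i"
  by (simp add: F31_edge_def insert_commute)

lemma prod_less_6: "(\<Prod>i<6. f i) = f 0 * f 1 * f 2 * f 3 * f 4 * (f (5::nat) :: nat)"
  by (simp add: eval_nat_numeral lessThan_Suc mult.assoc mult.commute mult.left_commute)

definition class_size :: "nat set \<Rightarrow> (nat \<Rightarrow> part) \<Rightarrow> part \<Rightarrow> nat" where
  "class_size V c d = card {w \<in> V. c w = d}"

definition wrong_pairs :: "nat set \<Rightarrow> (nat \<Rightarrow> nat \<Rightarrow> bool) \<Rightarrow> (nat \<Rightarrow> part) \<Rightarrow> (nat \<times> nat) set" where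
  "wrong_pairs V E c = {(x, y) \<in> V \<times> V. x = y \<or> E x y \<noteq> joined (c x) (c y)}"

lemma finite_wrong_pairs: "finite V \<Longrightarrow> finite (wrong_pairs V E c)"
  unfolding wrong_pairs_def by (rule finite_subset[of _ "V \<times> V"]) auto

lemma right_pair:
  "x \<in> V \<Longrightarrow> y \<in> V \<Longrightarrow> (x, y) \<notin> wrong_pairs V E c \<Longrightarrow> x \<noteq> y \<and> E x y = joined (c x) (c y)"
  unfolding wrong_pairs_def by auto

lemma embI:
  assumes "\<phi> \<in> maps_to V" "\<And>i j. i < 6 \<Longrightarrow> j < 6 \<Longrightarrow> i \<noteq> j \<Longrightarrow> \<phi> i \<noteq> \<phi> j \<and> E' (\<phi> i) (\<phi> j) = F31_edge i j"
    "\<And>x. \<not> E' x x"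
  shows "\<phi> \<in> emb E' V"
proof -
  have "E' (\<phi> i) (\<phi> j) = F31_edge i j" if "i < 6" "j < 6" for i j
    using assms(2)[OF that] assms(3) F31_edge_irrefl by (cases "i = j") auto
  moreover have "inj_on \<phi> {..<6}"
    using assms(2) by (intro inj_onI) (metis lessThan_iff)
  ultimately show ?thesis using assms(1) unfolding emb_def copies_def by blast
qed

lemma embD:
  assumes "\<phi> \<in> emb E' V"
  shows "\<phi> \<in> maps_to V" "i < 6 \<Longrightarrow> j < 6 \<Longrightarrow> E' (\<phi> i) (\<phi> j) = F31_edge i j"
    "i < 6 \<Longrightarrow> j < 6 \<Longrightarrow> \<phi> i = \<phi> j \<Longrightarrow> i = j" "i < 6 \<Longrightarrow> \<phi> i \<in> V"
  using assms unfolding emb_def copies_def by (auto dest: inj_onD)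

definition vertex_maps :: "nat set \<Rightarrow> (nat \<Rightarrow> part) \<Rightarrow> nat \<Rightarrow> (nat \<Rightarrow> bool) \<Rightarrow> nat \<Rightarrow> bool \<Rightarrow> (nat \<Rightarrow> nat) set" where
  "vertex_maps V c v N k b = PiE {..<6} (\<lambda>i. if i = k then {v} else {w \<in> V - {v}. c w = scheme b i \<and> N w = F31_edge k i})"

definition nbrs :: "nat set \<Rightarrow> (nat \<Rightarrow> part) \<Rightarrow> nat \<Rightarrow> (nat \<Rightarrow> bool) \<Rightarrow> part \<Rightarrow> nat" where
  "nbrs V c v N d = card {w \<in> V - {v}. c w = d \<and> N w}"

definition non_nbrs :: "nat set \<Rightarrow> (nat \<Rightarrow> part) \<Rightarrow> nat \<Rightarrow> (nat \<Rightarrow> bool) \<Rightarrow> part \<Rightarrow> nat" where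
  "non_nbrs V c v N d = card {w \<in> V - {v}. c w = d \<and> \<not> N w}"

definition vertex_total :: "nat set \<Rightarrow> (nat \<Rightarrow> part) \<Rightarrow> nat \<Rightarrow> (nat \<Rightarrow> bool) \<Rightarrow> nat" where
  "vertex_total V c v N = nbrs V c v N Clique * (non_nbrs V c v N Left)\<^sup>2 * (non_nbrs V c v N Right)\<^sup>2
     + non_nbrs V c v N Left * (nbrs V c v N Right)\<^sup>2 * (non_nbrs V c v N Clique)\<^sup>2
     + non_nbrs V c v N Right * (nbrs V c v N Left)\<^sup>2 * (non_nbrs V c v N Clique)\<^sup>2"

lemma F31_edge_numeral:
  "F31_edge 0 1 = False" "F31_edge 0 2 = True" "F31_edge 0 3 = True" "F31_edge 0 4 = False" "F31_edge 0 5 = False"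
  "F31_edge 1 0 = False" "F31_edge 1 2 = True" "F31_edge 1 3 = True" "F31_edge 1 4 = False" "F31_edge 1 5 = False"
  "F31_edge 2 0 = True" "F31_edge 2 1 = True" "F31_edge 2 3 = False" "F31_edge 2 4 = False" "F31_edge 2 5 = False"
  "F31_edge 3 0 = True" "F31_edge 3 1 = True" "F31_edge 3 2 = False" "F31_edge 3 4 = False" "F31_edge 3 5 = False"
  "F31_edge 4 0 = False" "F31_edge 4 1 = False" "F31_edge 4 2 = False" "F31_edge 4 3 = False" "F31_edge 4 5 = True"
  "F31_edge 5 0 = False" "F31_edge 5 1 = False" "F31_edge 5 2 = False" "F31_edge 5 3 = False" "F31_edge 5 4 = True"
  by (simp_all add: F31_edge_std std_def)

lemma sum_less_6: "(\<Sum>i<6. f i) = f 0 + f 1 + f 2 + f 3 + f 4 + (f (5::nat) :: nat)"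
  by (simp add: eval_nat_numeral lessThan_Suc)

context
  fixes V :: "nat set" and E :: "nat \<Rightarrow> nat \<Rightarrow> bool" and c :: "nat \<Rightarrow> part"
  assumes fin: "finite V" and sym: "\<And>x y. E x y = E y x" and irr: "\<And>x. \<not> E x x"
begin

private abbreviation "R \<equiv> wrong_pairs V E c"

lemma card_scheme_maps:
  "card (PiE {..<6} (\<lambda>i. {w \<in> V. c w = scheme b i})) = (class_size V c Clique * class_size V c Left * class_size V c Right)\<^sup>2"
  by (cases b) (simp_all add: card_PiE prod_less_6 scheme_def std_def class_size_def power2_eq_square mult_ac)

text \<open>An embedding that meets no wrong pair follows one of the two schemes, and each scheme has two points in each
  part; the error counts the maps through some wrong pair. Loops \<open>(x, x)\<close> count as wrong, which also
  disposes of the maps that are not injective.\<close>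

lemma card_emb_le:
  "card (emb E V) \<le> 2 * (class_size V c Clique * class_size V c Left * class_size V c Right)\<^sup>2 + 36 * (card R * card V ^ 4)"
proof -
  let ?B = "{\<phi> \<in> maps_to V. \<exists>i<6. \<exists>j<6. i \<noteq> j \<and> (\<phi> i, \<phi> j) \<in> R}"
  let ?A = "\<lambda>b. PiE {..<6} (\<lambda>i. {w \<in> V. c w = scheme b i})"
  have "emb E V \<subseteq> ?A False \<union> ?A True \<union> ?B"
  proof
    fix \<phi> assume \<phi>: "\<phi> \<in> emb E V"
    show "\<phi> \<in> ?A False \<union> ?A True \<union> ?B"
    proof (cases "\<phi> \<in> ?B")
      case False
      then have "F31_edge i j = joined (c (\<phi> i)) (c (\<phi> j))" if "i < 6" "j < 6" "i \<noteq> j" for i j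
        using right_pair[OF embD(4)[OF \<phi> that(1)] embD(4)[OF \<phi> that(2)]] embD(2)[OF \<phi> that(1,2)]
          embD(1)[OF \<phi>] False that by blast
      then obtain b where "\<forall>i<6. c (\<phi> i) = scheme b i"
        using colouring_forced_everywhere[of "\<lambda>i. c (\<phi> i)"] by auto
      then have "\<phi> \<in> ?A b"
        using embD(1)[OF \<phi>] by (auto simp: PiE_iff)
      then show ?thesis by (cases b) auto
    qed simp
  qed
  moreover have "finite (?A b)" for b using fin by (intro finite_PiE) auto
  ultimately have "card (emb E V) \<le> card (?A False \<union> ?A True \<union> ?B)"
    using finite_maps_to[OF fin] by (intro card_mono) auto
  also have "\<dots> \<le> card (?A False) + card (?A True) + card ?B"
    by (meson card_Un_le order_trans add_right_mono)
  also have "\<dots> \<le> 2 * (class_size V c Clique * class_size V c Left * class_size V c Right)\<^sup>2 + 36 * (card R * card V ^ 4)"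
    using card_maps_with_some_pair[OF fin finite_wrong_pairs[OF fin]] unfolding card_scheme_maps by simp
  finally show ?thesis .
qed

lemma card_emb_ge:
  "2 * (class_size V c Clique * class_size V c Left * class_size V c Right)\<^sup>2 \<le> card (emb E V) + 36 * (card R * card V ^ 4)"
proof -
  let ?B = "{\<phi> \<in> maps_to V. \<exists>i<6. \<exists>j<6. i \<noteq> j \<and> (\<phi> i, \<phi> j) \<in> R}"
  let ?A = "\<lambda>b. PiE {..<6} (\<lambda>i. {w \<in> V. c w = scheme b i})"
  have finA: "finite (?A b)" for b using fin by (intro finite_PiE) auto
  have "?A b \<subseteq> emb E V \<union> ?B" for b
  proof
    fix \<phi> assume \<phi>: "\<phi> \<in> ?A b"
    have m: "\<phi> \<in> maps_to V" using \<phi> by (auto simp: PiE_iff)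
    show "\<phi> \<in> emb E V \<union> ?B"
    proof (cases "\<phi> \<in> ?B")
      case False
      have "\<phi> \<in> emb E V"
      proof (rule embI[OF m _ irr])
        fix i j :: nat assume ij: "i < 6" "j < 6" "i \<noteq> j"
        have mem: "\<phi> i \<in> V" "\<phi> j \<in> V" "c (\<phi> i) = scheme b i" "c (\<phi> j) = scheme b j"
          using \<phi> ij(1,2) by (auto simp: PiE_iff)
        have "(\<phi> i, \<phi> j) \<notin> R" using False m ij by blast
        from right_pair[OF mem(1,2) this] show "\<phi> i \<noteq> \<phi> j \<and> E (\<phi> i) (\<phi> j) = F31_edge i j"
          unfolding mem(3,4) F31_edge_scheme[OF ij, of b] .
      qed
      then show ?thesis ..
    qed simp
  qed
  then have "?A False \<union> ?A True \<subseteq> emb E V \<union> ?B" by blast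
  moreover have finE: "finite (emb E V)"
    by (rule finite_subset[OF _ finite_maps_to[OF fin]]) (auto simp: emb_def copies_def)
  ultimately have "card (?A False \<union> ?A True) \<le> card (emb E V \<union> ?B)"
    using finite_maps_to[OF fin] by (intro card_mono) auto
  also have "\<dots> \<le> card (emb E V) + card ?B" by (rule card_Un_le)
  also have "card ?B \<le> 36 * (card R * card V ^ 4)"
    by (rule card_maps_with_some_pair[OF fin finite_wrong_pairs[OF fin]])
  also have "card (?A False \<union> ?A True) = card (?A False) + card (?A True)"
  proof (rule card_Un_disjoint[OF finA finA])
    have False if "\<phi> \<in> ?A False" "\<phi> \<in> ?A True" for \<phi>
    proof -
      have "c (\<phi> 0) = scheme False 0" "c (\<phi> 0) = scheme True 0"
        using that by (auto simp: PiE_iff)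
      then show False by (simp add: scheme_def std_def)
    qed
    then show "?A False \<inter> ?A True = {}" by blast
  qed
  finally show ?thesis unfolding card_scheme_maps by simp
qed

lemma finite_vertex_maps: "v \<in> V \<Longrightarrow> finite (vertex_maps V c v N k b)"
  unfolding vertex_maps_def using fin by (intro finite_PiE) auto

lemma vertex_mapsD:
  assumes "\<phi> \<in> vertex_maps V c v N k b" "v \<in> V" "k < 6"
  shows "\<phi> \<in> maps_to V" "\<phi> k = v"
    "i < 6 \<Longrightarrow> i \<noteq> k \<Longrightarrow> \<phi> i \<noteq> v \<and> c (\<phi> i) = scheme b i \<and> N (\<phi> i) = F31_edge k i"
proof -
  have *: "\<phi> i \<in> (if i = k then {v} else {w \<in> V - {v}. c w = scheme b i \<and> N w = F31_edge k i})" if "i < 6" for i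
    using PiE_mem[OF assms(1)[unfolded vertex_maps_def], of i] that by (simp only: lessThan_iff)
  show "\<phi> k = v" using *[OF assms(3)] by simp
  show "i < 6 \<Longrightarrow> i \<noteq> k \<Longrightarrow> \<phi> i \<noteq> v \<and> c (\<phi> i) = scheme b i \<and> N (\<phi> i) = F31_edge k i"
    using *[of i] by simp
  show "\<phi> \<in> maps_to V"
  proof (rule PiE_I)
    fix i assume "i \<in> {..<6::nat}" then show "\<phi> i \<in> V" using *[of i] assms(2) by (auto split: if_splits)
  next
    fix i assume "i \<notin> {..<6::nat}" then show "\<phi> i = undefined" by (rule PiE_arb[OF assms(1)[unfolded vertex_maps_def]])
  qed
qed

lemma card_vertex_maps:
  assumes "v \<in> V"
  shows "card (vertex_maps V c v N k b) = (\<Prod>i<6. if i = k then 1 else (if F31_edge k i then nbrs V c v N (scheme b i) else non_nbrs V c v N (scheme b i)))"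
  unfolding vertex_maps_def nbrs_def non_nbrs_def by (simp add: card_PiE) (rule prod.cong, auto)

lemma sum_card_vertex_maps:
  assumes "v \<in> V"
  shows "(\<Sum>k<6. card (vertex_maps V c v N k False) + card (vertex_maps V c v N k True)) = 4 * vertex_total V c v N"
  unfolding sum_less_6 card_vertex_maps[OF assms] prod_less_6
  by (simp add: F31_edge_numeral[unfolded One_nat_def] scheme_def std_def vertex_total_def power2_eq_square algebra_simps)

private abbreviation "bad_off v k \<equiv> {\<phi> \<in> maps_to V. \<phi> k = v \<and> (\<exists>i<6. \<exists>j<6. i \<noteq> j \<and> i \<noteq> k \<and> j \<noteq> k \<and> (\<phi> i, \<phi> j) \<in> R)}"

text \<open>Colour the copies through the vertex by the parts of their other five vertices. The three summands
  of the total are the copies in which the vertex lies on the edge, or on either side of the 4-cycle. Only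
  its adjacency to other vertices matters here, not its own part.\<close>

lemma card_emb_at_vertex_le:
  assumes v: "v \<in> V"
  shows "card {\<phi> \<in> emb E V. v \<in> \<phi> ` {..<6}} \<le> 4 * vertex_total V c v (E v) + 216 * (card R * card V ^ 3)"
proof -
  let ?A = "\<lambda>k. vertex_maps V c v (E v) k False \<union> vertex_maps V c v (E v) k True \<union> bad_off v k"
  have "{\<phi> \<in> emb E V. v \<in> \<phi> ` {..<6}} \<subseteq> (\<Union>k<6. ?A k)"
  proof
    fix \<phi> assume "\<phi> \<in> {\<phi> \<in> emb E V. v \<in> \<phi> ` {..<6}}"
    then obtain k where \<phi>: "\<phi> \<in> emb E V" and k: "k < 6" "\<phi> k = v" by auto
    have "\<phi> \<in> ?A k"
    proof (cases "\<phi> \<in> bad_off v k")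
      case False
      then have "F31_edge i j = joined (c (\<phi> i)) (c (\<phi> j))" if "i < 6" "j < 6" "i \<noteq> j" "i \<noteq> k" "j \<noteq> k" for i j
        using right_pair[OF embD(4)[OF \<phi> that(1)] embD(4)[OF \<phi> that(2)]] embD(2)[OF \<phi> that(1,2)]
          embD(1)[OF \<phi>] False that k by blast
      then have "standard_off k (\<lambda>i. c (\<phi> i))"
        by (intro colouring_forced k)
      then obtain b where b: "\<forall>i<6. i \<noteq> k \<longrightarrow> c (\<phi> i) = scheme b i"
        unfolding standard_off_iff by auto
      have "\<phi> \<in> vertex_maps V c v (E v) k b"
        unfolding vertex_maps_def
      proof (rule PiE_I)
        fix i :: nat assume "i \<in> {..<6}"
        then have i: "i < 6" by simp
        show "\<phi> i \<in> (if i = k then {v} else {w \<in> V - {v}. c w = scheme b i \<and> E v w = F31_edge k i})"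
        proof (cases "i = k")
          case True
          then show ?thesis using k(2) by simp
        next
          case ne: False
          have "\<phi> i \<noteq> v" using embD(3)[OF \<phi> i k(1)] k(2) ne by metis
          moreover have "E v (\<phi> i) = F31_edge k i" using embD(2)[OF \<phi> k(1) i] unfolding k(2) .
          moreover have "c (\<phi> i) = scheme b i" using b i ne by blast
          ultimately show ?thesis using ne embD(4)[OF \<phi> i] by simp
        qed
      next
        fix i :: nat assume "i \<notin> {..<6}"
        then show "\<phi> i = undefined" by (rule PiE_arb[OF embD(1)[OF \<phi>]])
      qed
      then show ?thesis by (cases b) auto
    qed simp
    then show "\<phi> \<in> (\<Union>k<6. ?A k)" using k by blast
  qed
  moreover have finA: "finite (?A k)" for k
    using finite_vertex_maps[OF v] finite_maps_to[OF fin] by auto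
  ultimately have "card {\<phi> \<in> emb E V. v \<in> \<phi> ` {..<6}} \<le> card (\<Union>k<6. ?A k)"
    by (intro card_mono) auto
  also have "\<dots> \<le> (\<Sum>k<6. card (?A k))"
    by (rule card_UN_le) simp
  also have "\<dots> \<le> (\<Sum>k<6. card (vertex_maps V c v (E v) k False) + card (vertex_maps V c v (E v) k True) + 36 * (card R * card V ^ 3))"
  proof (rule sum_mono)
    fix k :: nat assume "k \<in> {..<6}"
    then have "card (bad_off v k) \<le> 36 * (card R * card V ^ 3)"
      by (intro card_maps_at_vertex_with_pair fin finite_wrong_pairs) simp
    then show "card (?A k) \<le> card (vertex_maps V c v (E v) k False) + card (vertex_maps V c v (E v) k True) + 36 * (card R * card V ^ 3)"
      using card_Un_le[of "vertex_maps V c v (E v) k False \<union> vertex_maps V c v (E v) k True" "bad_off v k"]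
        card_Un_le[of "vertex_maps V c v (E v) k False" "vertex_maps V c v (E v) k True"] by linarith
  qed
  also have "\<dots> = 4 * vertex_total V c v (E v) + 216 * (card R * card V ^ 3)"
    by (simp only: sum.distrib[of _ "\<lambda>_. 36 * (card R * card V ^ 3)"] sum_card_vertex_maps[OF v]) simp
  finally show ?thesis .
qed

lemma card_emb_at_vertex_ge:
  assumes v: "v \<in> V" and E': "\<And>x y. x \<noteq> v \<Longrightarrow> y \<noteq> v \<Longrightarrow> E' x y = E x y"
    "\<And>w. w \<in> V \<Longrightarrow> w \<noteq> v \<Longrightarrow> E' v w = joined d (c w)" "\<And>x y. E' x y = E' y x" "\<And>x. \<not> E' x x"
  shows "4 * vertex_total V c v (\<lambda>w. joined d (c w)) \<le> card {\<phi> \<in> emb E' V. v \<in> \<phi> ` {..<6}} + 216 * (card R * card V ^ 3)"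
proof -
  let ?N = "\<lambda>w. joined d (c w)"
  let ?T = "{\<phi> \<in> emb E' V. v \<in> \<phi> ` {..<6}}"
  let ?I = "{..<6::nat} \<times> (UNIV :: bool set)"
  have sub: "vertex_maps V c v ?N k b \<subseteq> ?T \<union> bad_off v k" if k: "k < 6" for k b
  proof
    fix \<phi> assume "\<phi> \<in> vertex_maps V c v ?N k b"
    note \<phi> = vertex_mapsD[OF this v k]
    have inV: "\<phi> i \<in> V" if "i < 6" for i using \<phi>(1) that by auto
    show "\<phi> \<in> ?T \<union> bad_off v k"
    proof (cases "\<phi> \<in> bad_off v k")
      case False
      have "\<phi> \<in> emb E' V"
      proof (rule embI[OF \<phi>(1) _ E'(4)])
        fix i j :: nat assume ij: "i < 6" "j < 6" "i \<noteq> j"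
        have kj: "v \<noteq> \<phi> j \<and> E' v (\<phi> j) = F31_edge k j" if "j < 6" "j \<noteq> k" for j
          using \<phi>(3)[OF that] E'(2)[OF inV[OF that(1)]] by metis
        consider "i = k" | "j = k" "i \<noteq> k" | "i \<noteq> k" "j \<noteq> k" by blast
        then show "\<phi> i \<noteq> \<phi> j \<and> E' (\<phi> i) (\<phi> j) = F31_edge i j"
        proof cases
          case 1
          then show ?thesis using kj[OF ij(2)] ij(3) \<phi>(2) by simp
        next
          case 2
          have "v \<noteq> \<phi> i \<and> E' (\<phi> i) v = F31_edge i k"
            using kj[OF ij(1) 2(2)] E'(3)[of v "\<phi> i"] F31_edge_sym[of i k] by simp
          then show ?thesis using 2(1) \<phi>(2) by simp
        next
          case 3
          then have "(\<phi> i, \<phi> j) \<notin> R" using False ij \<phi>(1,2) by blast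
          from right_pair[OF inV[OF ij(1)] inV[OF ij(2)] this]
          have "\<phi> i \<noteq> \<phi> j \<and> E (\<phi> i) (\<phi> j) = F31_edge i j"
            using \<phi>(3)[OF ij(1) 3(1)] \<phi>(3)[OF ij(2) 3(2)] F31_edge_scheme[OF ij, of b] by simp
          then show ?thesis
            using E'(1)[of "\<phi> i" "\<phi> j"] \<phi>(3)[OF ij(1) 3(1)] \<phi>(3)[OF ij(2) 3(2)] by blast
        qed
      qed
      then show ?thesis using \<phi>(2) k by blast
    qed simp
  qed
  have "4 * vertex_total V c v ?N = (\<Sum>k<6. \<Sum>b\<in>UNIV. card (vertex_maps V c v ?N k b))"
    unfolding sum_card_vertex_maps[OF v, symmetric] UNIV_bool by (simp add: add.commute)
  also have "\<dots> = (\<Sum>(k, b)\<in>?I. card (vertex_maps V c v ?N k b))"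
    by (simp only: sum.cartesian_product)
  also have "\<dots> = card (\<Union>(k, b)\<in>?I. vertex_maps V c v ?N k b)"
  proof (subst card_UN_disjoint)
    show "\<forall>i\<in>?I. \<forall>j\<in>?I. i \<noteq> j \<longrightarrow> (case i of (k, b) \<Rightarrow> vertex_maps V c v ?N k b) \<inter> (case j of (k, b) \<Rightarrow> vertex_maps V c v ?N k b) = {}"
    proof (intro ballI impI)
      fix i j assume "i \<in> ?I" "j \<in> ?I" and ne: "i \<noteq> j"
      then obtain k b k' b' where i: "i = (k, b)" "k < 6" and j: "j = (k', b')" "k' < 6" by auto
      have False if "\<phi> \<in> vertex_maps V c v ?N k b" "\<phi> \<in> vertex_maps V c v ?N k' b'" for \<phi>
      proof -
        note D = vertex_mapsD[OF that(1) v i(2)] and D' = vertex_mapsD[OF that(2) v j(2)]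
        have "k = k'" using D(2) D'(3)[of k] i(2) by blast
        then have bb: "b \<noteq> b'" using ne i j by simp
        define m :: nat where "m = (if k = 0 then 1 else 0)"
        have "m < 4" "m \<noteq> k" by (auto simp: m_def)
        then have "scheme b m = scheme b' m"
          using D(3)[of m] D'(3)[of m] \<open>k = k'\<close> by simp
        then show False using bb \<open>m < 4\<close> by (cases b; cases b') (auto simp: scheme_def std_def split: if_splits)
      qed
      then show "(case i of (k, b) \<Rightarrow> vertex_maps V c v ?N k b) \<inter> (case j of (k, b) \<Rightarrow> vertex_maps V c v ?N k b) = {}"
        unfolding i(1) j(1) prod.case by blast
    qed
    show "finite ?I" by simp
    show "\<forall>i\<in>?I. finite (case i of (k, b) \<Rightarrow> vertex_maps V c v ?N k b)"
      using finite_vertex_maps[OF v] by (simp add: split_beta)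
  qed (simp add: split_beta)
  also have "\<dots> \<le> card (?T \<union> (\<Union>k<6. bad_off v k))"
  proof (rule card_mono)
    have "finite (emb E' V)"
      by (rule finite_subset[OF _ finite_maps_to[OF fin]]) (auto simp: emb_def copies_def)
    then have "finite ?T" by (rule rev_finite_subset) (rule Collect_restrict)
    moreover have "finite (bad_off v k)" for k
      by (rule finite_subset[OF Collect_restrict finite_maps_to[OF fin]])
    ultimately show "finite (?T \<union> (\<Union>k<6. bad_off v k))" by (intro finite_UnI finite_UN_I) simp_all
    show "(\<Union>(k, b)\<in>?I. vertex_maps V c v ?N k b) \<subseteq> ?T \<union> (\<Union>k<6. bad_off v k)"
    proof (rule UN_least)
      fix p assume "p \<in> ?I"
      then obtain k b where p: "p = (k, b)" and k: "k < 6" by auto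
      have "bad_off v k \<subseteq> (\<Union>k<6. bad_off v k)" using k by (intro UN_upper) simp
      then show "(case p of (k, b) \<Rightarrow> vertex_maps V c v ?N k b) \<subseteq> ?T \<union> (\<Union>k<6. bad_off v k)"
        unfolding p prod.case using sub[OF k, of b] by (meson Un_mono order_refl order_trans)
    qed
  qed
  also have "\<dots> \<le> card ?T + card (\<Union>k<6. bad_off v k)" by (rule card_Un_le)
  also have "card (\<Union>k<6. bad_off v k) \<le> (\<Sum>k<6. card (bad_off v k))" by (rule card_UN_le) simp
  also have "\<dots> \<le> (\<Sum>k<6::nat. 36 * (card R * card V ^ 3))"
    by (intro sum_mono card_maps_at_vertex_with_pair fin finite_wrong_pairs) simp
  finally show ?thesis by simp
qed

end

section \<open>Correcting one pair\<close>

lemma finite_emb: "finite V \<Longrightarrow> finite (emb E V)"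
  by (rule finite_subset[OF _ finite_maps_to]) (auto simp: emb_def copies_def)

text \<open>Before the change, a copy through the pair contains a second wrong pair, either disjoint from the first
  (hence the number of wrong pairs times \<open>n\<^sup>2\<close>) or sharing a vertex with it (hence the degree bound times
  \<open>n\<^sup>3\<close>). After it, all placements of the other four vertices in their parts are copies,
  up to errors of the same two kinds.\<close>

lemma card_emb_flip_pair:
  assumes fin: "finite V" and sym: "\<And>x y. E x y = E y x" and irr: "\<And>x. \<not> E x x"
    and sym': "\<And>x y. E' x y = E' y x" and irr': "\<And>x. \<not> E' x x"
    and uv: "u \<in> V" "v \<in> V" "u \<noteq> v" "E u v \<noteq> joined (c u) (c v)"
    and E': "\<And>x y. {x, y} \<noteq> {u, v} \<Longrightarrow> E' x y = E x y" "E' u v = joined (c u) (c v)"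
    and deg: "\<And>x. card {y. (x, y) \<in> wrong_pairs V E c} \<le> D"
    and m: "\<And>d. m \<le> class_size V c d"
  shows "m ^ 4 + card (emb E V) \<le> card (emb E' V) +
    1332 * (card (wrong_pairs V E c) * card V ^ 2 + D * card V ^ 3)"
proof -
  let ?R = "wrong_pairs V E c"
  let ?b = "36 * (card ?R * card V ^ 2 + D * card V ^ 3)"
  have symR: "(y, x) \<in> ?R" if "(x, y) \<in> ?R" for x y
  proof -
    have "(x, y) \<in> V \<times> V \<and> (x = y \<or> E x y \<noteq> joined (c x) (c y))"
      using that unfolding wrong_pairs_def by blast
    then have "(y, x) \<in> V \<times> V \<and> (y = x \<or> E y x \<noteq> joined (c y) (c x))"
      unfolding sym[of y x] joined_commute[of "c y" "c x"] by blast
    then show ?thesis unfolding wrong_pairs_def by blast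
  qed
  define B where "B k l = {\<phi> \<in> maps_to V. \<phi> k = u \<and> \<phi> l = v \<and>
     (\<exists>i<6. \<exists>j<6. i \<noteq> j \<and> {i, j} \<noteq> {k, l} \<and> (\<phi> i, \<phi> j) \<in> ?R)}" for k l
  have B: "card (B k l) \<le> ?b" if "k < 6" "l < 6" "k \<noteq> l" for k l
    unfolding B_def by (rule card_maps_at_pair_with_pair[OF fin finite_wrong_pairs[OF fin] that symR deg])
  have finB: "finite (B k l)" for k l
    unfolding B_def by (rule finite_subset[OF Collect_restrict finite_maps_to[OF fin]])
  let ?both = "\<lambda>\<phi>. u \<in> \<phi> ` {..<6} \<and> v \<in> \<phi> ` {..<6::nat}"
  define Q where "Q = {\<phi> \<in> emb E V. ?both \<phi>}"
  define Q' where "Q' = {\<phi> \<in> emb E' V. ?both \<phi>}"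
  have "Q \<subseteq> (\<Union>(k, l)\<in>{(k, l). k < 6 \<and> l < 6 \<and> k \<noteq> l}. B k l)"
  proof
    fix \<phi> assume "\<phi> \<in> Q"
    then obtain k l where \<phi>: "\<phi> \<in> emb E V" and kl: "k < 6" "l < 6" "\<phi> k = u" "\<phi> l = v"
      unfolding Q_def by auto
    have ne: "k \<noteq> l" using uv(3) kl by auto
    have "\<phi> \<in> B k l"
    proof (rule ccontr)
      assume nB: "\<phi> \<notin> B k l"
      have right: "F31_edge i j = joined (c (\<phi> i)) (c (\<phi> j))" if "i < 6" "j < 6" "i \<noteq> j" "{i, j} \<noteq> {k, l}" for i j
      proof -
        have "(\<phi> i, \<phi> j) \<notin> ?R"
          using nB that kl embD(1)[OF \<phi>] unfolding B_def by blast
        from right_pair[OF embD(4)[OF \<phi> that(1)] embD(4)[OF \<phi> that(2)] this]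
        show ?thesis using embD(2)[OF \<phi> that(1,2)] by simp
      qed
      have "F31_edge k l \<noteq> joined (c (\<phi> k)) (c (\<phi> l))"
        using embD(2)[OF \<phi> kl(1,2)] uv(4) kl by simp
      from one_disagreement_impossible[of k l "\<lambda>i. c (\<phi> i)", OF kl(1,2) ne this right] show False by simp
    qed
    then show "\<phi> \<in> (\<Union>(k, l)\<in>{(k, l). k < 6 \<and> l < 6 \<and> k \<noteq> l}. B k l)"
      using kl ne by blast
  qed
  then have cQ: "card Q \<le> 36 * ?b"
    using card_UN_pairs_le[where P = "(\<noteq>)" and A = B and b = ?b and S = Q] B finB by blast
  obtain k l where kl: "k < 6" "l < 6" "k \<noteq> l" "std k = c u" "std l = c v"
  proof -
    have "\<exists>k<6. \<exists>l<6. k \<noteq> l \<and> std k = a \<and> std l = b" for a b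
    proof -
      define k :: nat where "k = (case a of Left \<Rightarrow> 0 | Right \<Rightarrow> 2 | Clique \<Rightarrow> 4)"
      define l :: nat where "l = (case b of Left \<Rightarrow> 1 | Right \<Rightarrow> 3 | Clique \<Rightarrow> 5)"
      have "k < 6 \<and> l < 6 \<and> k \<noteq> l \<and> std k = a \<and> std l = b"
        by (cases a; cases b) (simp_all add: k_def l_def std_def)
      then show ?thesis by blast
    qed
    then show thesis using that by blast
  qed
  define A where "A = PiE {..<6} (\<lambda>i. if i = k then {u} else if i = l then {v} else {w \<in> V. c w = std i})"
  have "m ^ 4 \<le> card A"
  proof -
    have "card {..<6::nat} = 6" by simp
    have "m ^ 4 = (\<Prod>i\<in>{..<6} - {k, l}. m)"
    proof -
      have "card ({..<6} - {k, l}) = 4" using kl by (subst card_Diff_subset) auto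
      then show ?thesis by simp
    qed
    also have "\<dots> \<le> (\<Prod>i\<in>{..<6} - {k, l}. class_size V c (std i))"
      using m by (intro prod_mono) simp
    also have "\<dots> = (\<Prod>i\<in>{..<6} - {k, l}. card (if i = k then {u} else if i = l then {v} else {w \<in> V. c w = std i}))"
      by (rule prod.cong) (auto simp: class_size_def)
    also have "\<dots> = (\<Prod>i<6. card (if i = k then {u} else if i = l then {v} else {w \<in> V. c w = std i}))"
      by (rule prod.mono_neutral_left) auto
    finally show ?thesis unfolding A_def by (simp add: card_PiE)
  qed
  also have "card A \<le> card (Q' \<union> B k l)"
  proof (rule card_mono)
    show "finite (Q' \<union> B k l)" using finite_emb[OF fin] finB unfolding Q'_def by simp
    show "A \<subseteq> Q' \<union> B k l"
    proof
      fix \<phi> assume \<phi>A: "\<phi> \<in> A"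
      have mem: "\<phi> i \<in> (if i = k then {u} else if i = l then {v} else {w \<in> V. c w = std i})" if "i < 6" for i
        using PiE_mem[OF \<phi>A[unfolded A_def], of i] that by (simp only: lessThan_iff)
      have \<phi>k: "\<phi> k = u" "\<phi> l = v" using mem[OF kl(1)] mem[OF kl(2)] kl(3) by simp_all
      have V: "\<phi> i \<in> V" and col: "c (\<phi> i) = std i" if "i < 6" for i
        using mem[OF that] uv(1,2) kl(4,5) by (simp_all split: if_split_asm)
      have maps: "\<phi> \<in> maps_to V"
      proof (rule PiE_I)
        fix i :: nat assume "i \<in> {..<6}" then show "\<phi> i \<in> V" using V by simp
      next
        fix i :: nat assume "i \<notin> {..<6}"
        then show "\<phi> i = undefined" by (rule PiE_arb[OF \<phi>A[unfolded A_def]])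
      qed
      show "\<phi> \<in> Q' \<union> B k l"
      proof (cases "\<phi> \<in> B k l")
        case False
        have "\<phi> \<in> emb E' V"
        proof (rule embI[OF maps _ irr'])
          fix i j :: nat assume ij: "i < 6" "j < 6" "i \<noteq> j"
          have goal: "F31_edge i j = joined (c (\<phi> i)) (c (\<phi> j))"
            unfolding col[OF ij(1)] col[OF ij(2)] by (rule F31_edge_std[OF ij])
          consider "i = k" "j = l" | "i = l" "j = k" | "{i, j} \<noteq> {k, l}"
            by (metis doubleton_eq_iff)
          then show "\<phi> i \<noteq> \<phi> j \<and> E' (\<phi> i) (\<phi> j) = F31_edge i j"
          proof cases
            case 1 show ?thesis using goal E'(2) uv(3) unfolding 1 \<phi>k by simp
          next
            case 2 show ?thesis using goal E'(2) uv(3) unfolding 2 \<phi>k sym'[of v u] joined_commute[of "c v" "c u"] by simp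
          next
            case 3
            have nR: "(\<phi> i, \<phi> j) \<notin> ?R"
              using False 3 ij maps \<phi>k unfolding B_def by blast
            from right_pair[OF V[OF ij(1)] V[OF ij(2)] nR]
            have r: "\<phi> i \<noteq> \<phi> j" "E (\<phi> i) (\<phi> j) = F31_edge i j" using goal by simp_all
            have "(u, v) \<in> ?R" using uv by (simp add: wrong_pairs_def)
            with symR have "(u, v) \<in> ?R" "(v, u) \<in> ?R" by blast+
            then have "{\<phi> i, \<phi> j} \<noteq> {u, v}" using nR by (metis doubleton_eq_iff)
            then show ?thesis using r E'(1) by simp
          qed
        qed
        then have "\<phi> \<in> Q'" unfolding Q'_def using \<phi>k kl(1,2) by blast
        then show ?thesis ..
      qed simp
    qed
  qed
  also have "\<dots> \<le> card Q' + card (B k l)" by (rule card_Un_le)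
  also have "card (B k l) \<le> ?b" by (rule B[OF kl(1-3)])
  finally have lower: "m ^ 4 \<le> card Q' + ?b" by simp
  have "emb E V - Q \<subseteq> emb E' V - Q'"
  proof
    fix \<phi> assume "\<phi> \<in> emb E V - Q"
    then have \<phi>: "\<phi> \<in> emb E V" and nb: "\<not> ?both \<phi>" unfolding Q_def by auto
    have "\<phi> \<in> emb E' V"
    proof (rule embI[OF embD(1)[OF \<phi>] _ irr'])
      fix i j :: nat assume ij: "i < 6" "j < 6" "i \<noteq> j"
      have "{\<phi> i, \<phi> j} \<noteq> {u, v}"
        using nb ij by (metis doubleton_eq_iff image_eqI lessThan_iff)
      then show "\<phi> i \<noteq> \<phi> j \<and> E' (\<phi> i) (\<phi> j) = F31_edge i j"
        using E'(1) embD(2)[OF \<phi> ij(1,2)] embD(3)[OF \<phi> ij(1,2)] ij(3) by metis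
    qed
    then show "\<phi> \<in> emb E' V - Q'" using nb unfolding Q'_def by blast
  qed
  then have "card (emb E V - Q) \<le> card (emb E' V - Q')"
    using finite_emb[OF fin] by (intro card_mono) auto
  moreover have "card (emb E V) = card (emb E V - Q) + card Q" "card (emb E' V) = card (emb E' V - Q') + card Q'"
    using finite_emb[OF fin] by (auto simp: card_Diff_subset Q_def Q'_def card_mono intro!: le_add_diff_inverse2[symmetric])
  ultimately show ?thesis using cQ lower by simp
qed

section \<open>Nearly optimal attachment of a vertex\<close>

text \<open>The displayed polynomial is the probability that exactly one of three independent events occurs. It is
  close to \<open>1\<close> only near the three vertices of the cube with a single \<open>1\<close>.\<close>

lemma exactly_one_bit:
  fixes a b c \<epsilon> :: real
  assumes bits: "0 \<le> a" "a \<le> 1" "0 \<le> b" "b \<le> 1" "0 \<le> c" "c \<le> 1" and eps: "0 < \<epsilon>" "\<epsilon> \<le> 1/2"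
    and one: "1 - \<epsilon>\<^sup>2 \<le> a * (1 - b) * (1 - c) + (1 - a) * (c * (1 - b) + b * (1 - c))"
  shows "1 - 4 * \<epsilon>\<^sup>2 \<le> a \<and> b \<le> \<epsilon> \<and> c \<le> \<epsilon> \<or> 1 - 4 * \<epsilon>\<^sup>2 \<le> b \<and> a \<le> \<epsilon> \<and> c \<le> \<epsilon> \<or>
    1 - 4 * \<epsilon>\<^sup>2 \<le> c \<and> a \<le> \<epsilon> \<and> b \<le> \<epsilon>"
proof -
  define P where "P = a * (1 - b) * (1 - c) + (1 - a) * (c * (1 - b) + b * (1 - c))"
  define z p q r w where "z = (1 - a) * (1 - b) * (1 - c)" and "p = a * b * (1 - c)" and "q = a * c * (1 - b)"
    and "r = b * c * (1 - a)" and "w = a * b * c"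
  have nonneg: "0 \<le> z" "0 \<le> p" "0 \<le> q" "0 \<le> r" "0 \<le> w"
    using bits by (simp_all add: z_def p_def q_def r_def w_def)
  have sum: "z + p + q + r + w = 1 - P"
    by (simp add: z_def p_def q_def r_def w_def P_def algebra_simps)
  have "1 - \<epsilon>\<^sup>2 \<le> P" using one unfolding P_def .
  then have "z \<le> \<epsilon>\<^sup>2" "p + w \<le> \<epsilon>\<^sup>2" "q + w \<le> \<epsilon>\<^sup>2" "r + w \<le> \<epsilon>\<^sup>2"
    using nonneg sum by linarith+
  moreover have "a * b = p + w" "a * c = q + w" "b * c = r + w"
    by (simp_all add: p_def q_def r_def w_def algebra_simps)
  ultimately have prods: "a * b \<le> \<epsilon>\<^sup>2" "a * c \<le> \<epsilon>\<^sup>2" "b * c \<le> \<epsilon>\<^sup>2" "(1 - a) * (1 - b) * (1 - c) \<le> \<epsilon>\<^sup>2"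
    by (simp_all add: z_def)
  have small: "y \<le> \<epsilon>" if "x * y \<le> \<epsilon>\<^sup>2" "\<epsilon> < x" for x y :: real
  proof (rule ccontr)
    assume "\<not> y \<le> \<epsilon>"
    then have "\<epsilon> * \<epsilon> < x * y" using that(2) eps(1) by (intro mult_strict_mono) auto
    then show False using that(1) by (simp add: power2_eq_square)
  qed
  have large: "1 - 4 * \<epsilon>\<^sup>2 \<le> x" if "(1 - x) * (1 - y) * (1 - z) \<le> \<epsilon>\<^sup>2" "y \<le> \<epsilon>" "z \<le> \<epsilon>" "x \<le> 1" for x y z :: real
  proof -
    have "1/4 \<le> (1 - y) * (1 - z)"
      using mult_mono[of "1/2" "1 - y" "1/2" "1 - z"] that eps by simp
    then have "(1 - x) * (1/4) \<le> (1 - x) * ((1 - y) * (1 - z))"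
      using that(4) by (intro mult_left_mono) auto
    also have "\<dots> \<le> \<epsilon>\<^sup>2" using that(1) by (simp only: mult.assoc)
    finally show ?thesis by (simp add: field_simps)
  qed
  consider "b \<le> \<epsilon>" "c \<le> \<epsilon>" | "a \<le> \<epsilon>" "c \<le> \<epsilon>" | "a \<le> \<epsilon>" "b \<le> \<epsilon>"
    using small[OF prods(1)] small[OF prods(2)] small[OF prods(3)] by (meson not_le)
  then show ?thesis
  proof cases
    case 1
    then show ?thesis using large[OF prods(4) 1 bits(2)] by blast
  next
    case 2
    have "(1 - b) * (1 - a) * (1 - c) \<le> \<epsilon>\<^sup>2" using prods(4) by (simp add: mult_ac)
    then show ?thesis using large[OF _ 2 bits(4)] 2 by blast
  next
    case 3
    have "(1 - c) * (1 - a) * (1 - b) \<le> \<epsilon>\<^sup>2" using prods(4) by (simp add: mult_ac)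
    then show ?thesis using large[OF _ 3 bits(6)] 3 by blast
  qed
qed

text \<open>Here \<open>x\<close> and \<open>y\<close> count neighbours and non-neighbours of a vertex in each part, and \<open>F\<close> counts the
  copies through it. The products in the hypotheses are the values of \<open>F\<close> for a vertex attached exactly like one of the
  parts. After dividing by the largest of them, \<open>F\<close> is at most the probability that exactly one
  of three events occurs, with the proportions of neighbours as probabilities.\<close>

lemma nearly_best_attachment:
  fixes xC yC xL yL xR yR m n \<epsilon> :: real
  assumes nonneg: "0 \<le> xC" "0 \<le> yC" "0 \<le> xL" "0 \<le> yL" "0 \<le> xR" "0 \<le> yR"
    and size: "m * n \<le> xC + yC" "m * n \<le> xL + yL" "m * n \<le> xR + yR" "xC + yC \<le> n" "xL + yL \<le> n" "xR + yR \<le> n"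
    and pos: "0 < m" "0 < n" "0 < \<epsilon>" "\<epsilon> \<le> 1/2"
    and best: "(xC + yC) * (xL + yL)\<^sup>2 * (xR + yR)\<^sup>2 - \<epsilon>\<^sup>2 * m^5 * n^5 \<le> F"
      "(xL + yL) * (xR + yR)\<^sup>2 * (xC + yC)\<^sup>2 - \<epsilon>\<^sup>2 * m^5 * n^5 \<le> F"
      "(xR + yR) * (xL + yL)\<^sup>2 * (xC + yC)\<^sup>2 - \<epsilon>\<^sup>2 * m^5 * n^5 \<le> F"
    and F: "F = xC * yL\<^sup>2 * yR\<^sup>2 + yL * xR\<^sup>2 * yC\<^sup>2 + yR * xL\<^sup>2 * yC\<^sup>2"
  shows "yC + xL + xR \<le> 4 * \<epsilon> * n \<or> xC + xL + yR \<le> 4 * \<epsilon> * n \<or> xC + yL + xR \<le> 4 * \<epsilon> * n"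
proof -
  define C L R where "C = xC + yC" and "L = xL + yL" and "R = xR + yR"
  have mn: "0 < m * n" using pos by simp
  then have CLR: "0 < C" "0 < L" "0 < R" using size unfolding C_def L_def R_def by linarith+
  define a b c where "a = xC / C" and "b = xL / L" and "c = xR / R"
  have x: "xC = a * C" "xL = b * L" "xR = c * R" and y: "yC = (1 - a) * C" "yL = (1 - b) * L" "yR = (1 - c) * R"
    using CLR by (auto simp: a_def b_def c_def C_def L_def R_def field_simps)
  have bits: "0 \<le> a" "a \<le> 1" "0 \<le> b" "b \<le> 1" "0 \<le> c" "c \<le> 1"
    using nonneg CLR by (auto simp: a_def b_def c_def C_def L_def R_def)
  define M where "M = max (C * L\<^sup>2 * R\<^sup>2) (max (L * R\<^sup>2 * C\<^sup>2) (R * L\<^sup>2 * C\<^sup>2))"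
  have M: "C * L\<^sup>2 * R\<^sup>2 \<le> M" "L * R\<^sup>2 * C\<^sup>2 \<le> M" "R * L\<^sup>2 * C\<^sup>2 \<le> M" unfolding M_def by simp_all
  have "(m * n) * (m * n)\<^sup>2 * (m * n)\<^sup>2 \<le> C * L\<^sup>2 * R\<^sup>2"
    using size mn CLR unfolding C_def L_def R_def by (intro mult_mono power_mono) auto
  then have Mlow: "m^5 * n^5 \<le> M" using M(1) by (simp add: power_mult_distrib[symmetric] power2_eq_square eval_nat_numeral algebra_simps)
  then have Mpos: "0 < M" using pos by (meson less_le_trans mult_pos_pos zero_less_power)
  define P where "P = a * (1 - b) * (1 - c) + (1 - a) * (c * (1 - b) + b * (1 - c))"
  have sq: "t\<^sup>2 \<le> t" if "0 \<le> t" "t \<le> 1" for t :: real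
    using that by (simp add: power2_eq_square mult_left_le)
  have "F \<le> M * P"
  proof -
    have 1: "xC * yL\<^sup>2 * yR\<^sup>2 = (C * L\<^sup>2 * R\<^sup>2) * (a * (1 - b)\<^sup>2 * (1 - c)\<^sup>2)"
      and 2: "yL * xR\<^sup>2 * yC\<^sup>2 = (L * R\<^sup>2 * C\<^sup>2) * ((1 - b) * c\<^sup>2 * (1 - a)\<^sup>2)"
      and 3: "yR * xL\<^sup>2 * yC\<^sup>2 = (R * L\<^sup>2 * C\<^sup>2) * ((1 - c) * b\<^sup>2 * (1 - a)\<^sup>2)"
      unfolding x y by (simp_all add: power_mult_distrib mult_ac)
    have "(C * L\<^sup>2 * R\<^sup>2) * (a * (1 - b)\<^sup>2 * (1 - c)\<^sup>2) \<le> M * (a * (1 - b) * (1 - c))"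
      using bits M Mpos CLR by (intro mult_mono sq) auto
    moreover have "(L * R\<^sup>2 * C\<^sup>2) * ((1 - b) * c\<^sup>2 * (1 - a)\<^sup>2) \<le> M * ((1 - b) * c * (1 - a))"
      using bits M Mpos CLR by (intro mult_mono sq) auto
    moreover have "(R * L\<^sup>2 * C\<^sup>2) * ((1 - c) * b\<^sup>2 * (1 - a)\<^sup>2) \<le> M * ((1 - c) * b * (1 - a))"
      using bits M Mpos CLR by (intro mult_mono sq) auto
    ultimately show ?thesis unfolding F 1 2 3 P_def by (simp add: algebra_simps)
  qed
  moreover have "M - \<epsilon>\<^sup>2 * (m^5 * n^5) \<le> F"
    using best unfolding M_def C_def L_def R_def by (simp add: max_def mult.assoc)
  moreover have "\<epsilon>\<^sup>2 * (m^5 * n^5) \<le> \<epsilon>\<^sup>2 * M" using Mlow by (intro mult_left_mono) auto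
  ultimately have "M * (1 - \<epsilon>\<^sup>2) \<le> M * P" by (simp add: algebra_simps)
  then have "1 - \<epsilon>\<^sup>2 \<le> P" using Mpos by simp
  then have one: "1 - 4 * \<epsilon>\<^sup>2 \<le> a \<and> b \<le> \<epsilon> \<and> c \<le> \<epsilon> \<or> 1 - 4 * \<epsilon>\<^sup>2 \<le> b \<and> a \<le> \<epsilon> \<and> c \<le> \<epsilon> \<or>
    1 - 4 * \<epsilon>\<^sup>2 \<le> c \<and> a \<le> \<epsilon> \<and> b \<le> \<epsilon>"
    unfolding P_def by (rule exactly_one_bit[OF bits pos(3,4)])
  have le: "t * S \<le> \<epsilon> * n" if "t \<le> \<epsilon>" "0 < S" "S \<le> n" for t S
    using that pos by (intro mult_mono) auto
  have le': "(1 - t) * S \<le> 2 * \<epsilon> * n" if "1 - 4 * \<epsilon>\<^sup>2 \<le> t" "0 < S" "S \<le> n" for t S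
  proof -
    have "4 * \<epsilon>\<^sup>2 \<le> 2 * \<epsilon>" using pos by (simp add: power2_eq_square)
    then have "1 - t \<le> 2 * \<epsilon>" using that(1) by linarith
    then show ?thesis using that pos by (intro mult_mono) auto
  qed
  have S: "C \<le> n" "L \<le> n" "R \<le> n" using size unfolding C_def L_def R_def by auto
  show ?thesis
    using one
  proof (elim disjE conjE)
    assume "1 - 4 * \<epsilon>\<^sup>2 \<le> a" "b \<le> \<epsilon>" "c \<le> \<epsilon>"
    then have "yC + xL + xR \<le> 4 * \<epsilon> * n"
      using le'[of a C] le[of b L] le[of c R] CLR S unfolding x y by linarith
    then show ?thesis ..
  next
    assume "1 - 4 * \<epsilon>\<^sup>2 \<le> b" "a \<le> \<epsilon>" "c \<le> \<epsilon>"
    then have "xC + yL + xR \<le> 4 * \<epsilon> * n"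
      using le'[of b L] le[of a C] le[of c R] CLR S unfolding x y by linarith
    then show ?thesis by blast
  next
    assume "1 - 4 * \<epsilon>\<^sup>2 \<le> c" "a \<le> \<epsilon>" "b \<le> \<epsilon>"
    then have "xC + xL + yR \<le> 4 * \<epsilon> * n"
      using le'[of c R] le[of a C] le[of b L] CLR S unfolding x y by linarith
    then show ?thesis by blast
  qed
qed

section \<open>Embeddings and copies\<close>

text \<open>Stated for lists, so that the automorphisms can be counted by evaluation.\<close>

fun aut_list :: "nat list \<Rightarrow> bool" where
  "aut_list [a, b, c, d, e, f] \<longleftrightarrow>
     (let adjacent = (\<lambda>x y. joined (std x) (std y)) in
      \<not> adjacent a b \<and> adjacent a c \<and> adjacent a d \<and> \<not> adjacent a e \<and> \<not> adjacent a f \<and>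
      adjacent b c \<and> adjacent b d \<and> \<not> adjacent b e \<and> \<not> adjacent b f \<and>
      \<not> adjacent c d \<and> \<not> adjacent c e \<and> \<not> adjacent c f \<and> \<not> adjacent d e \<and> \<not> adjacent d f \<and> adjacent e f)"
| "aut_list _ = False"

lemma length_aut_lists: "length (filter aut_list (permutations_of_set_list [0, 1, 2, 3, 4, 5])) = 16"
  by code_simp

lemma card_automorphisms: "card (emb F31_edge {..<6}) = 16"
proof -
  have I: "{..<6} = set [0, 1, 2, 3, 4, 5::nat]" by auto
  have "card (emb F31_edge {..<6}) = card {xs \<in> permutations_of_set {..<6}. aut_list xs}"
  proof (rule bij_betw_same_card[where f = "\<lambda>\<phi>. [\<phi> 0, \<phi> 1, \<phi> 2, \<phi> 3, \<phi> 4, \<phi> 5]"],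
      rule bij_betwI[where g = "\<lambda>xs. map_of_six (xs ! 0) (xs ! 1) (xs ! 2) (xs ! 3) (xs ! 4) (xs ! 5)"])
    show "(\<lambda>\<phi>. [\<phi> 0, \<phi> 1, \<phi> 2, \<phi> 3, \<phi> 4, \<phi> 5]) \<in> emb F31_edge {..<6} \<rightarrow> {xs \<in> permutations_of_set {..<6}. aut_list xs}"
    proof
      fix \<phi> assume \<phi>: "\<phi> \<in> emb F31_edge {..<6}"
      have ne: "\<phi> i \<noteq> \<phi> j" if "i < 6" "j < 6" "i \<noteq> j" for i j using embD(3)[OF \<phi> that(1,2)] that(3) by blast
      have lt: "\<phi> i < 6" if "i < 6" for i using embD(4)[OF \<phi> that] by simp
      have dist: "distinct [\<phi> 0, \<phi> 1, \<phi> 2, \<phi> 3, \<phi> 4, \<phi> 5]" by (simp add: ne)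
      have "set [\<phi> 0, \<phi> 1, \<phi> 2, \<phi> 3, \<phi> 4, \<phi> 5] = {..<6}"
      proof (rule card_subset_eq)
        show "set [\<phi> 0, \<phi> 1, \<phi> 2, \<phi> 3, \<phi> 4, \<phi> 5] \<subseteq> {..<6}" by (simp add: lt)
        show "card (set [\<phi> 0, \<phi> 1, \<phi> 2, \<phi> 3, \<phi> 4, \<phi> 5]) = card {..<6::nat}"
          using distinct_card[OF dist] by simp
      qed simp
      then have "[\<phi> 0, \<phi> 1, \<phi> 2, \<phi> 3, \<phi> 4, \<phi> 5] \<in> permutations_of_set {..<6}"
        using dist by (rule permutations_of_setI)
      moreover have e: "joined (std (\<phi> i)) (std (\<phi> j)) = F31_edge i j" if "i < 6" "j < 6" "i \<noteq> j" for i j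
        using embD(2)[OF \<phi> that(1,2)] F31_edge_std[OF lt[OF that(1)] lt[OF that(2)] ne[OF that]] by simp
      have "aut_list [\<phi> 0, \<phi> 1, \<phi> 2, \<phi> 3, \<phi> 4, \<phi> 5]"
        by (simp add: Let_def e) (simp add: F31_edge_std std_def)
      ultimately show "[\<phi> 0, \<phi> 1, \<phi> 2, \<phi> 3, \<phi> 4, \<phi> 5] \<in> {xs \<in> permutations_of_set {..<6}. aut_list xs}" by simp
    qed
    show "(\<lambda>xs. map_of_six (xs ! 0) (xs ! 1) (xs ! 2) (xs ! 3) (xs ! 4) (xs ! 5)) \<in> {xs \<in> permutations_of_set {..<6}. aut_list xs} \<rightarrow> emb F31_edge {..<6}"
    proof
      fix xs assume "xs \<in> {xs \<in> permutations_of_set {..<6}. aut_list xs}"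
      then have xs: "xs \<in> permutations_of_set {..<6}" "aut_list xs" by auto
      then obtain a b c d e f where abc: "xs = [a, b, c, d, e, f]" by (cases xs rule: aut_list.cases) auto
      have S: "set [a, b, c, d, e, f] = {..<6}" and D: "distinct [a, b, c, d, e, f]"
        using permutations_of_setD[OF xs(1)] unfolding abc by blast+
      have lt: "a < 6" "b < 6" "c < 6" "d < 6" "e < 6" "f < 6" using S by (auto simp del: lessThan_iff simp add: set_eq_iff lessThan_iff[symmetric])
      let ?\<phi> = "map_of_six a b c d e f"
      have "?\<phi> \<in> emb F31_edge {..<6}"
      proof (rule embI)
        show "?\<phi> \<in> maps_to {..<6}" using lt by (intro map_of_six_mem) auto
        fix i j :: nat assume ij: "i < 6" "j < 6" "i \<noteq> j"
        have "?\<phi> i \<noteq> ?\<phi> j"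
          using less_6_cases[OF ij(1)] less_6_cases[OF ij(2)] ij(3) D
          by (elim disjE) (simp_all only: map_of_six_simps, auto)
        moreover have "?\<phi> i < 6" "?\<phi> j < 6"
          using map_of_six_mem[of a "{..<6}" b c d e f] lt ij by (auto dest: PiE_mem)
        moreover have "joined (std (?\<phi> i)) (std (?\<phi> j)) = joined (std i) (std j)"
        proof -
          have A: "joined (std x) (std y) = joined (std y) (std x)" for x y by (rule joined_commute)
          show ?thesis
            using less_6_cases[OF ij(1)] less_6_cases[OF ij(2)] ij(3) xs(2) unfolding abc aut_list.simps Let_def
            by (elim disjE) (simp_all only: map_of_six_simps, simp_all add: std_def joined_commute A)
        qed
        ultimately show "?\<phi> i \<noteq> ?\<phi> j \<and> F31_edge (?\<phi> i) (?\<phi> j) = F31_edge i j"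
          using F31_edge_std ij by simp
      qed (rule F31_edge_irrefl)
      then show "map_of_six (xs ! 0) (xs ! 1) (xs ! 2) (xs ! 3) (xs ! 4) (xs ! 5) \<in> emb F31_edge {..<6}"
        unfolding abc by (simp add: eval_nat_numeral)
    qed
    show "map_of_six ([\<phi> 0, \<phi> 1, \<phi> 2, \<phi> 3, \<phi> 4, \<phi> 5] ! 0) ([\<phi> 0, \<phi> 1, \<phi> 2, \<phi> 3, \<phi> 4, \<phi> 5] ! 1)
        ([\<phi> 0, \<phi> 1, \<phi> 2, \<phi> 3, \<phi> 4, \<phi> 5] ! 2) ([\<phi> 0, \<phi> 1, \<phi> 2, \<phi> 3, \<phi> 4, \<phi> 5] ! 3)
        ([\<phi> 0, \<phi> 1, \<phi> 2, \<phi> 3, \<phi> 4, \<phi> 5] ! 4) ([\<phi> 0, \<phi> 1, \<phi> 2, \<phi> 3, \<phi> 4, \<phi> 5] ! 5) = \<phi>"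
      if "\<phi> \<in> emb F31_edge {..<6}" for \<phi>
      using map_of_six_eta[OF embD(1)[OF that]] by (simp add: eval_nat_numeral)
    show "(\<lambda>\<phi>. [\<phi> 0, \<phi> 1, \<phi> 2, \<phi> 3, \<phi> 4, \<phi> 5]) (map_of_six (xs ! 0) (xs ! 1) (xs ! 2) (xs ! 3) (xs ! 4) (xs ! 5)) = xs"
      if "xs \<in> {xs \<in> permutations_of_set {..<6}. aut_list xs}" for xs
    proof -
      from that have "aut_list xs" by blast
      then obtain a b c d e f where abc: "xs = [a, b, c, d, e, f]" by (cases xs rule: aut_list.cases) auto
      show ?thesis unfolding map_of_six_simps unfolding abc by (simp add: eval_nat_numeral)
    qed
  qed
  also have "{xs \<in> permutations_of_set {..<6}. aut_list xs} = set (filter aut_list (permutations_of_set_list [0, 1, 2, 3, 4, 5]))"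
  proof -
    have "remdups [0, 1, 2, 3, 4, 5::nat] = [0, 1, 2, 3, 4, 5]" by simp
    then have "permutations_of_set {..<6} = set (permutations_of_set_list [0, 1, 2, 3, 4, 5::nat])"
      unfolding I by (simp only: permutations_of_list)
    then show ?thesis by (simp only: set_filter)
  qed
  also have "card \<dots> = length (filter aut_list (permutations_of_set_list [0, 1, 2, 3, 4, 5]))"
    by (intro distinct_card distinct_filter distinct_permutations_of_set_list) simp
  finally show ?thesis by (simp only: length_aut_lists)
qed

definition adj :: "nat pattern \<Rightarrow> nat \<Rightarrow> nat \<Rightarrow> bool" where
  "adj G x y \<longleftrightarrow> {x, y} \<in> edges G"

lemma adj_commute: "adj G x y = adj G y x"
  by (simp add: adj_def insert_commute)

lemma adj_irrefl: "simple_graph G \<Longrightarrow> \<not> adj G x x"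
  by (auto simp: adj_def simple_graph_def)

definition copy_sets :: "nat pattern \<Rightarrow> nat set set" where
  "copy_sets G = {S. S \<subseteq> verts G \<and> card S = 6 \<and> isomorphic (induced G S) F31}"

lemma iso_F31_iff:
  assumes "simple_graph G"
  shows "pattern_iso f (induced G S) F31 \<longleftrightarrow>
    bij_betw f S {..<6} \<and> (\<forall>x\<in>S. \<forall>y\<in>S. adj G x y = F31_edge (f x) (f y))"
  unfolding pattern_iso_def induced_def adj_def F31_edge_def
  by (auto simp: F31_def atLeast0LessThan)

text \<open>Each copy is the image of as many embeddings as the target has automorphisms.\<close>

lemma card_emb_eq:
  assumes G: "simple_graph G"
  shows "card (emb (adj G) (verts G)) = 16 * card (copy_sets G)"
proof -
  let ?V = "verts G"
  have fin: "finite ?V" using G by (simp add: simple_graph_def)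
  have finC: "finite (copy_sets G)"
    by (rule finite_subset[of _ "Pow ?V"]) (auto simp: copy_sets_def fin)
  let ?fib = "\<lambda>S. {\<phi> \<in> emb (adj G) ?V. \<phi> ` {..<6} = S}"
  have img: "\<phi> ` {..<6} \<in> copy_sets G" if \<phi>: "\<phi> \<in> emb (adj G) ?V" for \<phi>
  proof -
    have inj: "inj_on \<phi> {..<6}" using \<phi> unfolding emb_def by blast
    let ?g = "the_inv_into {..<6} \<phi>"
    have bij: "bij_betw ?g (\<phi> ` {..<6}) {..<6}"
      using inj by (intro bij_betw_the_inv_into) (auto simp: bij_betw_def)
    have "\<forall>x\<in>\<phi> ` {..<6}. \<forall>y\<in>\<phi> ` {..<6}. adj G x y = F31_edge (?g x) (?g y)"
      using embD(2)[OF \<phi>] the_inv_into_f_f[OF inj] by auto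
    then have "pattern_iso ?g (induced G (\<phi> ` {..<6})) F31"
      using bij unfolding iso_F31_iff[OF G] by blast
    moreover have "card (\<phi> ` {..<6}) = 6" using card_image[OF inj] by simp
    moreover have "\<phi> ` {..<6} \<subseteq> ?V" using embD(4)[OF \<phi>] by auto
    ultimately show ?thesis unfolding copy_sets_def isomorphic_def by blast
  qed
  have fibre: "card (?fib S) = 16" if S: "S \<in> copy_sets G" for S
  proof -
    obtain f where f: "bij_betw f S {..<6}" "\<And>x y. x \<in> S \<Longrightarrow> y \<in> S \<Longrightarrow> adj G x y = F31_edge (f x) (f y)"
      using S iso_F31_iff[OF G] unfolding copy_sets_def isomorphic_def by blast
    have SV: "S \<subseteq> ?V" using S unfolding copy_sets_def by blast
    let ?g = "the_inv_into S f"
    have g: "?g i \<in> S" "f (?g i) = i" if "i < 6" for i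
      using that f_the_inv_into_f_bij_betw[OF f(1)] bij_betwE[OF bij_betw_the_inv_into[OF f(1)]] by auto
    have g': "?g (f x) = x" "f x < 6" if "x \<in> S" for x
      using that the_inv_into_f_f[OF bij_betw_imp_inj_on[OF f(1)]] bij_betwE[OF f(1)] by auto
    have "bij_betw (\<lambda>\<phi>. \<lambda>i\<in>{..<6}. f (\<phi> i)) (?fib S) (emb F31_edge {..<6})"
    proof (rule bij_betwI[where g = "\<lambda>\<alpha>. \<lambda>i\<in>{..<6}. ?g (\<alpha> i)"])
      show "(\<lambda>\<phi>. \<lambda>i\<in>{..<6}. f (\<phi> i)) \<in> ?fib S \<rightarrow> emb F31_edge {..<6}"
      proof
        fix \<phi> assume "\<phi> \<in> ?fib S"
        then have \<phi>: "\<phi> \<in> emb (adj G) ?V" and im: "\<phi> ` {..<6} = S" by auto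
        have mem: "\<phi> i \<in> S" if "i < 6" for i using im that by blast
        show "(\<lambda>i\<in>{..<6}. f (\<phi> i)) \<in> emb F31_edge {..<6}"
        proof (rule embI)
          show "(\<lambda>i\<in>{..<6}. f (\<phi> i)) \<in> maps_to {..<6}" using g'(2) mem by simp
          fix i j :: nat assume ij: "i < 6" "j < 6" "i \<noteq> j"
          have "f (\<phi> i) \<noteq> f (\<phi> j)"
            using embD(3)[OF \<phi> ij(1,2)] ij(3) g'(1)[OF mem[OF ij(1)]] g'(1)[OF mem[OF ij(2)]] by metis
          moreover have "F31_edge (f (\<phi> i)) (f (\<phi> j)) = F31_edge i j"
            using f(2)[OF mem[OF ij(1)] mem[OF ij(2)]] embD(2)[OF \<phi> ij(1,2)] by simp
          ultimately show "(\<lambda>i\<in>{..<6}. f (\<phi> i)) i \<noteq> (\<lambda>i\<in>{..<6}. f (\<phi> i)) j \<and>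
              F31_edge ((\<lambda>i\<in>{..<6}. f (\<phi> i)) i) ((\<lambda>i\<in>{..<6}. f (\<phi> i)) j) = F31_edge i j"
            using ij by simp
        qed (rule F31_edge_irrefl)
      qed
      show "(\<lambda>\<alpha>. \<lambda>i\<in>{..<6}. ?g (\<alpha> i)) \<in> emb F31_edge {..<6} \<rightarrow> ?fib S"
      proof
        fix \<alpha> assume \<alpha>: "\<alpha> \<in> emb F31_edge {..<6}"
        have lt: "\<alpha> i < 6" if "i < 6" for i using embD(4)[OF \<alpha> that] by simp
        have "(\<lambda>i\<in>{..<6}. ?g (\<alpha> i)) \<in> emb (adj G) ?V"
        proof (rule embI)
          show "(\<lambda>i\<in>{..<6}. ?g (\<alpha> i)) \<in> maps_to ?V" using g(1)[OF lt] SV by auto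
          fix i j :: nat assume ij: "i < 6" "j < 6" "i \<noteq> j"
          have "?g (\<alpha> i) \<noteq> ?g (\<alpha> j)"
            using embD(3)[OF \<alpha> ij(1,2)] ij(3) g(2)[OF lt[OF ij(1)]] g(2)[OF lt[OF ij(2)]] by metis
          moreover have "adj G (?g (\<alpha> i)) (?g (\<alpha> j)) = F31_edge i j"
            using f(2)[OF g(1)[OF lt[OF ij(1)]] g(1)[OF lt[OF ij(2)]]] g(2)[OF lt[OF ij(1)]] g(2)[OF lt[OF ij(2)]]
              embD(2)[OF \<alpha> ij(1,2)] by simp
          ultimately show "(\<lambda>i\<in>{..<6}. ?g (\<alpha> i)) i \<noteq> (\<lambda>i\<in>{..<6}. ?g (\<alpha> i)) j \<and>
              adj G ((\<lambda>i\<in>{..<6}. ?g (\<alpha> i)) i) ((\<lambda>i\<in>{..<6}. ?g (\<alpha> i)) j) = F31_edge i j"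
            using ij by simp
        qed (rule adj_irrefl[OF G])
        moreover have "\<alpha> ` {..<6} = {..<6}"
        proof (rule endo_inj_surj)
          show "\<alpha> ` {..<6} \<subseteq> {..<6}" using lt by auto
          show "inj_on \<alpha> {..<6}" using \<alpha> unfolding emb_def by blast
        qed simp
        then have "(\<lambda>i\<in>{..<6}. ?g (\<alpha> i)) ` {..<6} = ?g ` {..<6}"
          by (metis (no_types, lifting) image_cong image_image restrict_apply')
        then have "(\<lambda>i\<in>{..<6}. ?g (\<alpha> i)) ` {..<6} = S"
          using bij_betw_imp_surj_on[OF bij_betw_the_inv_into[OF f(1)]] by simp
        ultimately show "(\<lambda>i\<in>{..<6}. ?g (\<alpha> i)) \<in> ?fib S" by blast
      qed
      show "(\<lambda>i\<in>{..<6}. ?g ((\<lambda>i\<in>{..<6}. f (\<phi> i)) i)) = \<phi>" if "\<phi> \<in> ?fib S" for \<phi>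
      proof -
        have m: "\<phi> \<in> maps_to ?V" and im: "\<phi> ` {..<6} = S" using that embD(1) by auto
        have "?g (f (\<phi> i)) = \<phi> i" if "i < 6" for i using g'(1) im that by blast
        then show ?thesis by (intro ext) (use PiE_arb[OF m] in \<open>auto simp: restrict_def\<close>)
      qed
      show "(\<lambda>i\<in>{..<6}. f ((\<lambda>i\<in>{..<6}. ?g (\<alpha> i)) i)) = \<alpha>" if "\<alpha> \<in> emb F31_edge {..<6}" for \<alpha>
      proof -
        note m = embD(1)[OF that]
        have "f (?g (\<alpha> i)) = \<alpha> i" if "i < 6" for i
          using g(2) PiE_mem[OF m, of i] that by simp
        then show ?thesis by (intro ext) (use PiE_arb[OF m] in \<open>auto simp: restrict_def\<close>)
      qed
    qed
    from bij_betw_same_card[OF this] show ?thesis unfolding card_automorphisms .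
  qed
  have "emb (adj G) ?V = (\<Union>S\<in>copy_sets G. ?fib S)"
  proof (rule equalityI)
    show "emb (adj G) ?V \<subseteq> (\<Union>S\<in>copy_sets G. ?fib S)"
      by (rule subsetI, rule UN_I[OF img]) simp_all
  qed (rule UN_least, rule Collect_restrict)
  also have "card \<dots> = (\<Sum>S\<in>copy_sets G. card (?fib S))"
  proof (rule card_UN_disjoint[OF finC])
    show "\<forall>S\<in>copy_sets G. finite (?fib S)"
      by (intro ballI finite_subset[OF Collect_restrict finite_emb[OF fin]])
    show "\<forall>S\<in>copy_sets G. \<forall>S'\<in>copy_sets G. S \<noteq> S' \<longrightarrow> ?fib S \<inter> ?fib S' = {}"
      by blast
  qed
  also have "\<dots> = (\<Sum>S\<in>copy_sets G. 16)" by (rule sum.cong[OF refl fibre])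
  also have "\<dots> = 16 * card (copy_sets G)" by simp
  finally show ?thesis .
qed

section \<open>Closeness of near-extremal graphs to blowups\<close>

text \<open>By \<open>copies_bound\<close> few maps have a pullback that is not a blowup, and by hypothesis there are at least
  \<open>t n\<^sup>4\<close> roots, that is, quadruples inducing a path on three vertices and an isolated vertex. Some root is therefore
  extended to few bad maps by two more vertices. Colour each vertex by its adjacency to this
  root; a pair that disagrees with the colouring extends the root to a bad map.\<close>

lemma close_to_blowup:
  assumes fin: "finite V" and sym: "\<And>x y. E x y = E y x" and irr: "\<And>x. \<not> E x x"
    and t: "0 < t" "t * real (card V) ^ 6 \<le> real (card (emb E V))"
    and near: "(2 / 729 - e) * real (card V) ^ 6 \<le> real (card (emb E V))" and "V \<noteq> {}"
  shows "\<exists>c. real (card {(x, y) \<in> V \<times> V. x \<noteq> y \<and> E x y \<noteq> joined (c x) (c y)}) \<le> 2624400 * e / t * real (card V) ^ 2"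
proof -
  define n where "n = card V"
  have n: "0 < n" using fin \<open>V \<noteq> {}\<close> by (simp add: n_def card_gt_0_iff)
  define Bad where "Bad = {\<phi> \<in> maps_to V. \<nexists>c. coloured_by (pullback E \<phi>) c}"
  have finBad: "finite Bad" unfolding Bad_def by (rule finite_subset[OF Collect_restrict finite_maps_to[OF fin]])
  have emb_copies: "emb E V \<subseteq> copies E V" unfolding emb_def by blast
  have "finite (copies E V)" unfolding copies_def by (rule finite_subset[OF Collect_restrict finite_maps_to[OF fin]])
  then have "card (emb E V) \<le> card (copies E V)" using emb_copies by (rule card_mono)
  then have "2624400 * real (card (emb E V)) + real (card Bad) \<le> 7200 * real n ^ 6"
    using copies_bound[of E, OF sym irr fin] unfolding Bad_def n_def by simp
  moreover have "2624400 * ((2 / 729 - e) * real n ^ 6) \<le> 2624400 * real (card (emb E V))"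
    using near unfolding n_def by simp
  ultimately have bad: "real (card Bad) \<le> 2624400 * e * real n ^ 6"
    by (simp add: algebra_simps)
  define Rt where "Rt = {(a, b, p, q). a \<in> V \<and> b \<in> V \<and> p \<in> V \<and> q \<in> V \<and>
     E a b \<and> E p b \<and> \<not> E a p \<and> \<not> E q a \<and> \<not> E q b \<and> \<not> E q p}"
  have finRt: "finite Rt"
    by (rule finite_subset[of _ "V \<times> V \<times> V \<times> V"]) (use fin in \<open>auto simp: Rt_def\<close>)
  have "card (emb E V) \<le> card (Rt \<times> V \<times> V)"
  proof (rule card_inj_on_le[where f = "\<lambda>\<phi>. ((\<phi> 0, \<phi> 2, \<phi> 1, \<phi> 4), \<phi> 3, \<phi> 5)"])
    show "inj_on (\<lambda>\<phi>. ((\<phi> 0, \<phi> 2, \<phi> 1, \<phi> 4), \<phi> 3, \<phi> 5)) (emb E V)"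
    proof (rule inj_onI)
      fix \<phi> \<psi> assume m: "\<phi> \<in> emb E V" and m': "\<psi> \<in> emb E V"
        and eq: "((\<phi> 0, \<phi> 2, \<phi> 1, \<phi> 4), \<phi> 3, \<phi> 5) = ((\<psi> 0, \<psi> 2, \<psi> 1, \<psi> 4), \<psi> 3, \<psi> 5)"
      have "map_of_six (\<phi> 0) (\<phi> 1) (\<phi> 2) (\<phi> 3) (\<phi> 4) (\<phi> 5) = \<phi>"
        "map_of_six (\<psi> 0) (\<psi> 1) (\<psi> 2) (\<psi> 3) (\<psi> 4) (\<psi> 5) = \<psi>"
        using map_of_six_eta[OF embD(1)[OF m]] map_of_six_eta[OF embD(1)[OF m']] by blast+
      then show "\<phi> = \<psi>" using eq by (metis prod.inject)
    qed
    show "(\<lambda>\<phi>. ((\<phi> 0, \<phi> 2, \<phi> 1, \<phi> 4), \<phi> 3, \<phi> 5)) ` emb E V \<subseteq> Rt \<times> V \<times> V"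
    proof (rule image_subsetI)
      fix \<phi> assume \<phi>: "\<phi> \<in> emb E V"
      note A = embD(2)[OF \<phi>] and B = embD(4)[OF \<phi>]
      show "((\<phi> 0, \<phi> 2, \<phi> 1, \<phi> 4), \<phi> 3, \<phi> 5) \<in> Rt \<times> V \<times> V"
        using A[of 0 2] A[of 1 2] A[of 0 1] A[of 4 0] A[of 4 2] A[of 4 1] B
        by (simp add: Rt_def F31_edge_std std_def)
    qed
  qed (use fin finRt in simp)
  then have "card (emb E V) \<le> card Rt * n\<^sup>2" by (simp add: card_cartesian_product n_def power2_eq_square)
  then have "real (card (emb E V)) \<le> real (card Rt * n\<^sup>2)" by (rule of_nat_mono)
  then have "t * real n ^ 6 \<le> real (card Rt) * real n ^ 2"
    using t(2) unfolding n_def by simp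
  then have "(t * real n ^ 4) * real n ^ 2 \<le> real (card Rt) * real n ^ 2"
    by (simp add: mult.assoc flip: power_add)
  then have Rt: "t * real n ^ 4 \<le> real (card Rt)" using n by simp
  have Rtpos: "0 < real (card Rt)"
    using Rt t(1) n by (meson less_le_trans mult_pos_pos of_nat_0_less_iff zero_less_power)
  define Bd where "Bd = (\<lambda>(a, b, p, q). {(x, y) \<in> V \<times> V. map_of_six a p b x q y \<in> Bad})"
  have finBd: "finite (Bd r)" for r
    unfolding Bd_def by (cases r) (auto intro: finite_subset[of _ "V \<times> V"] simp: fin)
  have "card (Sigma Rt Bd) \<le> card Bad"
  proof (rule card_inj_on_le[where f = "\<lambda>((a, b, p, q), (x, y)). map_of_six a p b x q y"])
    show "inj_on (\<lambda>((a, b, p, q), (x, y)). map_of_six a p b x q y) (Sigma Rt Bd)"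
    proof (rule inj_onI)
      fix s s' assume "(\<lambda>((a, b, p, q), (x, y)). map_of_six a p b x q y) s = (\<lambda>((a, b, p, q), (x, y)). map_of_six a p b x q y) s'"
      moreover obtain a b p q x y where s: "s = ((a, b, p, q), (x, y))" by (metis surj_pair)
      moreover obtain a' b' p' q' x' y' where s': "s' = ((a', b', p', q'), (x', y'))" by (metis surj_pair)
      ultimately have eq: "map_of_six a p b x q y = map_of_six a' p' b' x' q' y'" by simp
      show "s = s'"
        using fun_cong[OF eq, of 0] fun_cong[OF eq, of 1] fun_cong[OF eq, of 2] fun_cong[OF eq, of 3]
          fun_cong[OF eq, of 4] fun_cong[OF eq, of 5] unfolding map_of_six_simps s s' by blast
    qed
  qed (use finBad in \<open>auto simp: Bd_def\<close>)
  then have sum: "(\<Sum>r\<in>Rt. card (Bd r)) \<le> card Bad"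
    using finRt finBd by simp
  have "\<exists>r\<in>Rt. card (Bd r) * card Rt \<le> card Bad"
  proof (rule ccontr)
    assume "\<not> ?thesis"
    then have "card Bad < card (Bd r) * card Rt" if "r \<in> Rt" for r using that by auto
    moreover have "Rt \<noteq> {}" using Rtpos by auto
    ultimately have "(\<Sum>r\<in>Rt. card Bad) < (\<Sum>r\<in>Rt. card (Bd r) * card Rt)"
      using finRt by (intro sum_strict_mono) auto
    then have "card Rt * card Bad < (\<Sum>r\<in>Rt. card (Bd r)) * card Rt" by (simp add: sum_distrib_right)
    also have "\<dots> \<le> card Bad * card Rt" using sum by (intro mult_right_mono) auto
    finally show False by (simp add: mult.commute)
  qed
  then obtain r where r: "r \<in> Rt" "card (Bd r) * card Rt \<le> card Bad" by blast
  obtain a b p q where rr: "r = (a, b, p, q)" by (metis surj_pair)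
  have root: "a \<in> V" "b \<in> V" "p \<in> V" "q \<in> V" "E a b" "E p b" "\<not> E a p" "\<not> E q a" "\<not> E q b" "\<not> E q p"
    using r(1) unfolding rr Rt_def by auto
  define c where "c x = (if E x b then Left else if E x a then Right else Clique)" for x
  let ?W = "{(x, y) \<in> V \<times> V. x \<noteq> y \<and> E x y \<noteq> joined (c x) (c y)}"
  have "?W \<subseteq> Bd r"
  proof
    fix s assume "s \<in> ?W"
    then obtain x y where s: "s = (x, y)" and xy: "x \<in> V" "y \<in> V" "E x y \<noteq> joined (c x) (c y)" by auto
    let ?\<phi> = "map_of_six a p b x q y"
    have "?\<phi> \<in> maps_to V" using root xy by (intro map_of_six_mem)
    moreover have False if col: "coloured_by (pullback E ?\<phi>) g" for g
    proof -
      have pair: "E (?\<phi> i) (?\<phi> j) = joined (g i) (g j)" if "i < 6" "j < 6" "i \<noteq> j" for i j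
        using col that unfolding coloured_by_def pullback_def by blast
      have F: "joined (g 2) (g 0)" "joined (g 2) (g 1)" "\<not> joined (g 0) (g 1)" "\<not> joined (g 4) (g 0)" "\<not> joined (g 4) (g 2)"
        using pair[of 0 2] pair[of 1 2] pair[of 0 1] pair[of 4 0] pair[of 4 2] root joined_commute
        unfolding map_of_six_simps by auto
      have G: "E x b = joined (g 3) (g 2)" "E x a = joined (g 3) (g 0)" "E y b = joined (g 5) (g 2)" "E y a = joined (g 5) (g 0)"
        "E x y = joined (g 3) (g 5)"
        using pair[of 3 2] pair[of 3 0] pair[of 5 2] pair[of 5 0] pair[of 3 5] unfolding map_of_six_simps by auto
      have "E x y = joined (c x) (c y)"
        unfolding c_def G using forced_path[OF F(1-3)]
        by (elim disjE conjE; cases "g 3"; cases "g 5") simp_all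
      then show False using xy(3) by simp
    qed
    ultimately have "?\<phi> \<in> Bad" unfolding Bad_def by blast
    then show "s \<in> Bd r" unfolding s rr Bd_def using xy by simp
  qed
  then have "card ?W \<le> card (Bd r)" using finBd by (intro card_mono)
  then have "real (card ?W) * real (card Rt) \<le> real (card (Bd r)) * real (card Rt)"
    by (intro mult_right_mono) auto
  also have "\<dots> = real (card (Bd r) * card Rt)" by simp
  also have "\<dots> \<le> real (card Bad)" using r(2) by (rule of_nat_mono)
  finally have W: "real (card ?W) * real (card Rt) \<le> 2624400 * e * real n ^ 6" using bad by linarith
  have "real (card ?W) * (t * real n ^ 4) \<le> real (card ?W) * real (card Rt)"
    using Rt by (intro mult_left_mono) auto
  with W have "(real (card ?W) * t) * real n ^ 4 \<le> (2624400 * e * real n ^ 2) * real n ^ 4"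
    by (simp add: mult.assoc flip: power_add)
  then have "real (card ?W) * t \<le> 2624400 * e * real n ^ 2" using n by simp
  then have "real (card ?W) \<le> 2624400 * e / t * real n ^ 2"
    using t(1) by (simp add: field_simps)
  then show ?thesis unfolding n_def by blast
qed

section \<open>Distance to the blowups\<close>

definition disagreement :: "nat set \<Rightarrow> (nat \<Rightarrow> nat \<Rightarrow> bool) \<Rightarrow> (nat \<Rightarrow> part) \<Rightarrow> (nat \<times> nat) set" where
  "disagreement V E c = {(x, y) \<in> V \<times> V. x \<noteq> y \<and> E x y \<noteq> joined (c x) (c y)}"

definition blowup_distance :: "nat set \<Rightarrow> (nat \<Rightarrow> nat \<Rightarrow> bool) \<Rightarrow> nat" where
  "blowup_distance V E = (LEAST k. \<exists>c. k = card (disagreement V E c))"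

definition blowup_rel :: "(nat \<Rightarrow> part) \<Rightarrow> nat \<Rightarrow> nat \<Rightarrow> bool" where
  "blowup_rel c x y \<longleftrightarrow> x \<noteq> y \<and> joined (c x) (c y)"

definition graph_rel :: "(nat \<Rightarrow> nat \<Rightarrow> bool) \<Rightarrow> bool" where
  "graph_rel E \<longleftrightarrow> (\<forall>x y. E x y = E y x) \<and> (\<forall>x. \<not> E x x)"

lemma graph_rel_blowup: "graph_rel (blowup_rel c)"
  unfolding graph_rel_def blowup_rel_def using joined_commute by blast

lemma disagreement_subset: "disagreement V E c \<subseteq> V \<times> V"
  unfolding disagreement_def by blast

lemma finite_disagreement: "finite V \<Longrightarrow> finite (disagreement V E c)"
  by (rule finite_subset[OF disagreement_subset]) simp

lemma card_disagreement_le: "finite V \<Longrightarrow> card (disagreement V E c) \<le> card V ^ 2"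
  using card_mono[OF _ disagreement_subset, of V E c] by (simp add: card_cartesian_product power2_eq_square)

lemma blowup_distance_le: "blowup_distance V E \<le> card (disagreement V E c)"
  unfolding blowup_distance_def by (rule Least_le) blast

lemma blowup_distance_attained: "\<exists>c. blowup_distance V E = card (disagreement V E c)"
  unfolding blowup_distance_def by (rule LeastI_ex) blast

lemma blowup_distance_change:
  assumes "\<And>c. card (disagreement V E c) \<le> card (disagreement V E' c) + k"
  shows "blowup_distance V E \<le> blowup_distance V E' + k"
proof -
  obtain c where "blowup_distance V E' = card (disagreement V E' c)" using blowup_distance_attained by blast
  then show ?thesis using assms[of c] blowup_distance_le[of V E c] by linarith
qed

lemma emb_cong:
  assumes "\<And>x y. x \<in> V \<Longrightarrow> y \<in> V \<Longrightarrow> E x y = E' x y"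
  shows "emb E V = emb E' V"
proof -
  have "copies E V = copies E' V"
    unfolding copies_def using assms by (intro Collect_cong conj_cong refl) (auto simp: PiE_iff)
  then show ?thesis unfolding emb_def by simp
qed

lemma card_wrong_pairs:
  assumes "finite V"
  shows "card (wrong_pairs V E c) \<le> card V + card (disagreement V E c)"
proof -
  have "wrong_pairs V E c \<subseteq> (\<lambda>x. (x, x)) ` V \<union> disagreement V E c"
    unfolding wrong_pairs_def disagreement_def by auto
  then have "card (wrong_pairs V E c) \<le> card ((\<lambda>x. (x, x)) ` V \<union> disagreement V E c)"
    using assms finite_disagreement by (intro card_mono) auto
  also have "\<dots> \<le> card ((\<lambda>x. (x, x)) ` V) + card (disagreement V E c)" by (rule card_Un_le)
  also have "card ((\<lambda>x. (x, x)) ` V) \<le> card V" using assms by (rule card_image_le)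
  finally show ?thesis by simp
qed

text \<open>Number the vertices and cut at \<open>n div 3\<close> and twice that; the clique part takes the remainder.\<close>

lemma balanced_colouring:
  assumes "finite V"
  shows "\<exists>c. \<forall>d. real (card V) / 3 - 1 \<le> real (class_size V c d)"
proof -
  define n where "n = card V"
  obtain h where h: "bij_betw h V {0..<n}"
    using ex_bij_betw_finite_nat[OF assms] n_def by auto
  define q where "q = n div 3"
  define c where "c w = (if h w < q then Left else if h w < 2 * q then Right else Clique)" for w
  have colour: "c w = Left \<longleftrightarrow> h w < q" "c w = Right \<longleftrightarrow> \<not> h w < q \<and> h w < 2 * q"
    "c w = Clique \<longleftrightarrow> \<not> h w < q \<and> \<not> h w < 2 * q" for w
    by (simp_all add: c_def)
  have cs: "card {w \<in> V. P (h w)} = card {i \<in> {0..<n}. P i}" for P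
  proof (rule bij_betw_same_card[of h])
    show "bij_betw h {w \<in> V. P (h w)} {i \<in> {0..<n}. P i}"
      using h unfolding bij_betw_def inj_on_def by auto
  qed
  have q: "3 * q \<le> n" "n < 3 * q + 3" unfolding q_def by auto
  have "{i \<in> {0..<n}. i < q} = {0..<q}" "{i \<in> {0..<n}. \<not> i < q \<and> i < 2 * q} = {q..<2*q}"
    "{i \<in> {0..<n}. \<not> i < q \<and> \<not> i < 2 * q} = {2*q..<n}" using q by auto
  then have "class_size V c Left = q" "class_size V c Right = q" "class_size V c Clique = n - 2 * q"
    using cs[of "\<lambda>i. i < q"] cs[of "\<lambda>i. \<not> i < q \<and> i < 2 * q"] cs[of "\<lambda>i. \<not> i < q \<and> \<not> i < 2 * q"]
    unfolding class_size_def colour by simp_all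
  then have "q \<le> class_size V c d" for d using q by (cases d) auto
  moreover have "real n / 3 - 1 \<le> real q" using q by linarith
  ultimately have "\<forall>d. real n / 3 - 1 \<le> real (class_size V c d)"
    by (meson of_nat_le_iff order_trans)
  then show ?thesis unfolding n_def by blast
qed

lemma balanced_blowup_has_many_copies:
  assumes "finite V" "3 \<le> card V"
  shows "\<exists>c. 2 / 729 * real (card V) ^ 6 - 37 * real (card V) ^ 5 \<le> real (card (emb (blowup_rel c) V))"
proof -
  define n where "n = real (card V)"
  have n: "3 \<le> n" using assms(2) unfolding n_def by simp
  obtain c where c: "\<And>d. n / 3 - 1 \<le> real (class_size V c d)" using balanced_colouring[OF assms(1)] n_def by auto
  have "disagreement V (blowup_rel c) c = {}" unfolding disagreement_def blowup_rel_def by auto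
  then have R: "card (wrong_pairs V (blowup_rel c) c) \<le> card V" using card_wrong_pairs[OF assms(1), of "blowup_rel c" c] by simp
  have "2 * (class_size V c Clique * class_size V c Left * class_size V c Right)\<^sup>2 \<le> card (emb (blowup_rel c) V) + 36 * (card (wrong_pairs V (blowup_rel c) c) * card V ^ 4)"
    using graph_rel_blowup[of c] unfolding graph_rel_def by (intro card_emb_ge assms) blast+
  also have "\<dots> \<le> card (emb (blowup_rel c) V) + 36 * (card V * card V ^ 4)"
    using R by (intro add_left_mono mult_left_mono mult_right_mono) auto
  finally have "real (2 * (class_size V c Clique * class_size V c Left * class_size V c Right)\<^sup>2) \<le> real (card (emb (blowup_rel c) V) + 36 * (card V * card V ^ 4))"
    by (rule of_nat_mono)
  then have low: "2 * (real (class_size V c Clique) * real (class_size V c Left) * real (class_size V c Right))\<^sup>2 \<le> real (card (emb (blowup_rel c) V)) + 36 * n ^ 5"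
    unfolding n_def by (simp add: eval_nat_numeral mult_ac)
  have "(n / 3 - 1) * (n / 3 - 1) * (n / 3 - 1) \<le> real (class_size V c Clique) * real (class_size V c Left) * real (class_size V c Right)"
    using c n by (intro mult_mono) auto
  then have "((n / 3 - 1) ^ 3)\<^sup>2 \<le> (real (class_size V c Clique) * real (class_size V c Left) * real (class_size V c Right))\<^sup>2"
    using n by (intro power_mono) (auto simp: eval_nat_numeral mult.assoc)
  moreover have "(n / 3) ^ 6 * (1 - 18 / n) \<le> ((n / 3 - 1) ^ 3)\<^sup>2"
  proof -
    have "1 + of_nat 6 * (- 3 / n) \<le> (1 + (- 3 / n)) ^ 6"
      using n by (intro Bernoulli_inequality) (simp add: field_simps)
    then have "(n / 3) ^ 6 * (1 - 18 / n) \<le> (n / 3) ^ 6 * (1 - 3 / n) ^ 6"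
      using n by (intro mult_left_mono) auto
    also have "\<dots> = (n / 3 * (1 - 3 / n)) ^ 6" by (rule power_mult_distrib[symmetric])
    also have "n / 3 * (1 - 3 / n) = n / 3 - 1" using n by (simp add: field_simps)
    finally show ?thesis by (simp add: power_mult[symmetric])
  qed
  moreover have "2 / 729 * n ^ 6 - n ^ 5 \<le> 2 * ((n / 3) ^ 6 * (1 - 18 / n))"
    using n by (simp add: field_simps eval_nat_numeral)
  ultimately have "2 / 729 * n ^ 6 - n ^ 5 \<le> real (card (emb (blowup_rel c) V)) + 36 * n ^ 5"
    using low by linarith
  then have "2 / 729 * n ^ 6 - 37 * n ^ 5 \<le> real (card (emb (blowup_rel c) V))" by simp
  then show ?thesis unfolding n_def by blast
qed

lemma disagreement_at_vertex:
  assumes fin: "finite V" and sym: "\<And>x y. E x y = E y x" and v: "v \<in> V"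
  shows "card (disagreement V E c) = card (disagreement (V - {v}) E c) + 2 * card {w \<in> V - {v}. E v w \<noteq> joined (c v) (c w)}"
proof -
  let ?A = "{w \<in> V - {v}. E v w \<noteq> joined (c v) (c w)}"
  have finA: "finite ?A" using fin by simp
  have eq: "disagreement V E c = disagreement (V - {v}) E c \<union> (Pair v ` ?A \<union> (\<lambda>w. (w, v)) ` ?A)"
    unfolding disagreement_def using v sym joined_commute by (auto simp: image_iff)
  have "card (Pair v ` ?A \<union> (\<lambda>w. (w, v)) ` ?A) = card (Pair v ` ?A) + card ((\<lambda>w. (w, v)) ` ?A)"
    using finA by (intro card_Un_disjoint) auto
  also have "\<dots> = 2 * card ?A" by (simp add: card_image inj_on_def)
  finally have two: "card (Pair v ` ?A \<union> (\<lambda>w. (w, v)) ` ?A) = 2 * card ?A" .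
  show ?thesis
    unfolding eq
  proof (subst card_Un_disjoint)
    show "finite (disagreement (V - {v}) E c)" using fin by (intro finite_disagreement) simp
    show "disagreement (V - {v}) E c \<inter> (Pair v ` ?A \<union> (\<lambda>w. (w, v)) ` ?A) = {}"
      unfolding disagreement_def by auto
  qed (use finA two in auto)
qed

definition recolour_vertex :: "nat \<Rightarrow> part \<Rightarrow> (nat \<Rightarrow> part) \<Rightarrow> (nat \<Rightarrow> nat \<Rightarrow> bool) \<Rightarrow> nat \<Rightarrow> nat \<Rightarrow> bool" where
  "recolour_vertex v d c E x y =
     (if x = v then y \<noteq> v \<and> joined d (c y) else if y = v then joined d (c x) else E x y)"

lemma graph_rel_recolour: "graph_rel E \<Longrightarrow> graph_rel (recolour_vertex v d c E)"
  unfolding graph_rel_def recolour_vertex_def by auto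

definition flip_pair :: "nat \<Rightarrow> nat \<Rightarrow> (nat \<Rightarrow> nat \<Rightarrow> bool) \<Rightarrow> nat \<Rightarrow> nat \<Rightarrow> bool" where
  "flip_pair u v E x y = (if {x, y} = {u, v} then \<not> E x y else E x y)"

lemma graph_rel_flip: "graph_rel E \<Longrightarrow> u \<noteq> v \<Longrightarrow> graph_rel (flip_pair u v E)"
  unfolding graph_rel_def flip_pair_def by (auto simp: insert_commute doubleton_eq_iff)

lemma class_size_without_vertex:
  assumes "finite V"
  shows "class_size V c d \<le> nbrs V c v N d + non_nbrs V c v N d + 1"
proof -
  have "{w \<in> V. c w = d} \<subseteq> {w \<in> V - {v}. c w = d \<and> N w} \<union> {w \<in> V - {v}. c w = d \<and> \<not> N w} \<union> {v}" by auto
  then have "class_size V c d \<le> card ({w \<in> V - {v}. c w = d \<and> N w} \<union> {w \<in> V - {v}. c w = d \<and> \<not> N w} \<union> {v})"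
    unfolding class_size_def using assms by (intro card_mono) auto
  also have "\<dots> \<le> card ({w \<in> V - {v}. c w = d \<and> N w} \<union> {w \<in> V - {v}. c w = d \<and> \<not> N w}) + card {v}"
    by (rule card_Un_le)
  also have "\<dots> \<le> nbrs V c v N d + non_nbrs V c v N d + 1"
    using card_Un_le[of "{w \<in> V - {v}. c w = d \<and> N w}" "{w \<in> V - {v}. c w = d \<and> \<not> N w}"]
    unfolding nbrs_def non_nbrs_def by simp
  finally show ?thesis .
qed

lemma nbrs_plus_non_nbrs:
  assumes "finite V"
  shows "nbrs V c v N d + non_nbrs V c v N d = card {w \<in> V - {v}. c w = d}"
proof -
  have eq: "{w \<in> V - {v}. c w = d} = {w \<in> V - {v}. c w = d \<and> N w} \<union> {w \<in> V - {v}. c w = d \<and> \<not> N w}" by auto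
  show ?thesis unfolding nbrs_def non_nbrs_def eq using assms
    by (subst card_Un_disjoint) auto
qed

lemma nbrs_of_part:
  "nbrs V c v (\<lambda>w. joined d (c w)) d' = (if joined d d' then card {w \<in> V - {v}. c w = d'} else 0)"
  "non_nbrs V c v (\<lambda>w. joined d (c w)) d' = (if joined d d' then 0 else card {w \<in> V - {v}. c w = d'})"
  unfolding nbrs_def non_nbrs_def by (auto intro!: arg_cong[where f = card] simp: card_eq_0_iff)

lemma card_disagreeing_neighbours:
  assumes "finite V"
  shows "card {w \<in> V - {v}. N w \<noteq> joined d (c w)} = (case d of
      Clique \<Rightarrow> non_nbrs V c v N Clique + nbrs V c v N Left + nbrs V c v N Right
    | Left \<Rightarrow> nbrs V c v N Clique + nbrs V c v N Left + non_nbrs V c v N Right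
    | Right \<Rightarrow> nbrs V c v N Clique + non_nbrs V c v N Left + nbrs V c v N Right)"
proof -
  have "card {w \<in> V - {v}. N w \<noteq> joined d (c w)} = (\<Sum>e\<in>{Clique, Left, Right}. card {w \<in> V - {v}. c w = e \<and> N w \<noteq> joined d e})"
  proof (subst card_UN_disjoint[symmetric])
    show "card {w \<in> V - {v}. N w \<noteq> joined d (c w)} = card (\<Union>e\<in>{Clique, Left, Right}. {w \<in> V - {v}. c w = e \<and> N w \<noteq> joined d e})"
    proof (rule arg_cong[where f = card], rule set_eqI)
      fix w show "w \<in> {w \<in> V - {v}. N w \<noteq> joined d (c w)} \<longleftrightarrow> w \<in> (\<Union>e\<in>{Clique, Left, Right}. {w \<in> V - {v}. c w = e \<and> N w \<noteq> joined d e})"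
        by (cases "c w") auto
    qed
  qed (use assms in auto)
  then show ?thesis
    unfolding nbrs_def non_nbrs_def by (cases d) simp_all
qed

section \<open>Maximisers of copies plus distance\<close>

definition at_vertex :: "nat \<Rightarrow> (nat \<Rightarrow> nat \<Rightarrow> bool) \<Rightarrow> nat set \<Rightarrow> nat" where
  "at_vertex v E V = card {\<phi> \<in> emb E V. v \<in> \<phi> ` {..<6}}"

text \<open>Embeddings that avoid the vertex are the same before and after it is attached anew.\<close>

lemma card_emb_recolour:
  assumes "finite V" "graph_rel E"
  shows "card (emb E V) + at_vertex v (recolour_vertex v d c E) V = card (emb (recolour_vertex v d c E) V) + at_vertex v E V"
proof -
  let ?E' = "recolour_vertex v d c E"
  have away: "{\<phi> \<in> emb E1 V. v \<notin> \<phi> ` {..<6}} \<subseteq> {\<phi> \<in> emb E2 V. v \<notin> \<phi> ` {..<6}}"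
    if E: "\<And>x y. x \<noteq> v \<Longrightarrow> y \<noteq> v \<Longrightarrow> E1 x y = E2 x y" and "graph_rel E2" for E1 E2
  proof
    fix \<phi> assume "\<phi> \<in> {\<phi> \<in> emb E1 V. v \<notin> \<phi> ` {..<6}}"
    then have \<phi>: "\<phi> \<in> emb E1 V" and nv: "\<And>i. i < 6 \<Longrightarrow> \<phi> i \<noteq> v" by auto
    have "\<phi> \<in> emb E2 V"
    proof (rule embI[OF embD(1)[OF \<phi>]])
      fix i j :: nat assume ij: "i < 6" "j < 6" "i \<noteq> j"
      have "\<phi> i \<noteq> \<phi> j" using embD(3)[OF \<phi> ij(1,2)] ij(3) by blast
      then show "\<phi> i \<noteq> \<phi> j \<and> E2 (\<phi> i) (\<phi> j) = F31_edge i j"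
        using E[OF nv[OF ij(1)] nv[OF ij(2)]] embD(2)[OF \<phi> ij(1,2)] by simp
    qed (use that(2) in \<open>simp add: graph_rel_def\<close>)
    then show "\<phi> \<in> {\<phi> \<in> emb E2 V. v \<notin> \<phi> ` {..<6}}" using nv by auto
  qed
  have "{\<phi> \<in> emb E V. v \<notin> \<phi> ` {..<6}} = {\<phi> \<in> emb ?E' V. v \<notin> \<phi> ` {..<6}}"
    by (rule equalityI; rule away) (use assms(2) graph_rel_recolour in \<open>auto simp: recolour_vertex_def\<close>)
  moreover have "card (emb E1 V) = card {\<phi> \<in> emb E1 V. v \<notin> \<phi> ` {..<6}} + at_vertex v E1 V" for E1
  proof -
    have eq: "emb E1 V = {\<phi> \<in> emb E1 V. v \<notin> \<phi> ` {..<6}} \<union> {\<phi> \<in> emb E1 V. v \<in> \<phi> ` {..<6}}" by auto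
    have f: "finite {\<phi> \<in> emb E1 V. P \<phi>}" for P
      by (rule finite_subset[OF Collect_restrict finite_emb[OF assms(1)]])
    show ?thesis unfolding at_vertex_def by (subst eq, rule card_Un_disjoint) (auto intro: f)
  qed
  ultimately show ?thesis by simp
qed

lemma distance_recolour:
  assumes "finite V" "graph_rel E" "v \<in> V"
  shows "blowup_distance V E \<le> blowup_distance V (recolour_vertex v d c E) + 2 * card V"
proof (rule blowup_distance_change)
  fix c'
  let ?E' = "recolour_vertex v d c E"
  have sym: "E x y = E y x" "?E' x y = ?E' y x" for x y
    using assms(2) graph_rel_recolour[OF assms(2)] unfolding graph_rel_def by blast+
  have "disagreement (V - {v}) E c' = disagreement (V - {v}) ?E' c'"
    unfolding disagreement_def recolour_vertex_def by auto
  moreover have "card {w \<in> V - {v}. E v w \<noteq> joined (c' v) (c' w)} \<le> card V"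
    using assms(1) by (intro card_mono) auto
  ultimately show "card (disagreement V E c') \<le> card (disagreement V ?E' c') + 2 * card V"
    using disagreement_at_vertex[of V E v c', OF assms(1) sym(1) assms(3)]
      disagreement_at_vertex[of V ?E' v c', OF assms(1) sym(2) assms(3)] by simp
qed

lemma distance_flip:
  assumes "finite V"
  shows "blowup_distance V E \<le> blowup_distance V (flip_pair u v E) + 2"
proof (rule blowup_distance_change)
  fix c
  have "disagreement V E c \<subseteq> disagreement V (flip_pair u v E) c \<union> {(u, v), (v, u)}"
  proof (rule subrelI)
    fix x y assume xy: "(x, y) \<in> disagreement V E c"
    show "(x, y) \<in> disagreement V (flip_pair u v E) c \<union> {(u, v), (v, u)}"
    proof (cases "{x, y} = {u, v}")
      case True
      then show ?thesis by (auto simp: doubleton_eq_iff)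
    next
      case False
      then have "flip_pair u v E x y = E x y" by (simp add: flip_pair_def)
      then show ?thesis using xy by (simp add: disagreement_def)
    qed
  qed
  then have "card (disagreement V E c) \<le> card (disagreement V (flip_pair u v E) c \<union> {(u, v), (v, u)})"
    by (rule card_mono[rotated]) (simp add: finite_disagreement[OF assms])
  moreover have "card (disagreement V (flip_pair u v E) c \<union> {(u, v), (v, u)}) \<le>
      card (disagreement V (flip_pair u v E) c) + card {(u, v), (v, u)}"
    by (rule card_Un_le)
  moreover have "card {(u, v), (v, u)} \<le> 2"
    by (rule order_trans[OF card_insert_le_m1[of 2]]) simp_all
  ultimately show "card (disagreement V E c) \<le> card (disagreement V (flip_pair u v E) c) + 2"
    by linarith
qed

lemma class_lower_bound:
  fixes a b c n :: real
  assumes "0 \<le> a" "0 \<le> b" "0 \<le> c" "a \<le> n" "b \<le> n" "c \<le> n" "0 < n" "n ^ 6 / 2500 \<le> (a * b * c)\<^sup>2"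
  shows "n / 50 \<le> a"
proof -
  have "(n ^ 3 / 50)\<^sup>2 = n ^ 6 / 2500"
    by (simp add: power_divide flip: power_mult)
  then have "(n ^ 3 / 50)\<^sup>2 \<le> (a * b * c)\<^sup>2"
    using assms(8) by (simp only:)
  moreover have "0 \<le> a * b * c" by (intro mult_nonneg_nonneg assms(1-3))
  ultimately have "n ^ 3 / 50 \<le> a * b * c" by (rule power2_le_imp_le)
  also have "\<dots> \<le> a * (n * n)"
    unfolding mult.assoc by (intro mult_left_mono mult_mono assms order_less_imp_le[OF assms(7)])
  finally have "n / 50 * (n * n) \<le> a * (n * n)" by (simp add: eval_nat_numeral)
  then show ?thesis by (rule mult_right_le_imp_le) (simp add: assms(7))
qed

text \<open>The distance counts ordered pairs. The chosen constants make the following hierarchy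
  hold, with much room: the proportion of wrong pairs (\<open>10\<^sup>-\<^sup>3\<^sup>6\<close>) is far below the proportion of wrong neighbours of
  one vertex (\<open>10\<^sup>-\<^sup>1\<^sup>2\<close>), which is far below the proportion \<open>60\<^sup>-\<^sup>4\<close> of copies gained by correcting one pair.\<close>

theorem extremal_graphs_are_blowups:
  fixes V :: "nat set"
  assumes fin: "finite V" and large: "10 ^ 50 \<le> real (card V)" and E0: "graph_rel E0"
  shows "\<exists>c. real (card (emb E0 V)) + real (card V) ^ 4 / 10 ^ 46 * real (blowup_distance V E0) \<le> real (card (emb (blowup_rel c) V))"
proof -
  define n where "n = real (card V)"
  define \<kappa> where "\<kappa> = n ^ 4 / 10 ^ 46"
  have n: "10 ^ 50 \<le> n" "0 < n" using large unfolding n_def by (auto intro: less_le_trans[OF _ large])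
  \<comment> \<open>the potential to be maximised; its distance term is at most \<open>n ^ 6 / 10 ^ 46\<close>\<close>
  define \<Phi> where "\<Phi> E = real (card (emb E V)) + \<kappa> * real (blowup_distance V E)" for E
  have "finite (\<Phi> ` Collect graph_rel)"
  proof (rule finite_subset)
    show "\<Phi> ` Collect graph_rel \<subseteq> (\<lambda>(a, b). real a + \<kappa> * real b) ` ({..card (maps_to V)} \<times> {..card V ^ 2})"
    proof (rule image_subsetI)
      fix E
      have "emb E V \<subseteq> maps_to V" unfolding emb_def copies_def by blast
      then have "card (emb E V) \<le> card (maps_to V)" using finite_maps_to[OF fin] by (rule card_mono[rotated])
      moreover have "blowup_distance V E \<le> card V ^ 2"
        using blowup_distance_le[of V E "\<lambda>_. Left"] card_disagreement_le[OF fin, of E "\<lambda>_. Left"] by linarith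
      ultimately show "\<Phi> E \<in> (\<lambda>(a, b). real a + \<kappa> * real b) ` ({..card (maps_to V)} \<times> {..card V ^ 2})"
        unfolding \<Phi>_def by (intro image_eqI[where x = "(card (emb E V), blowup_distance V E)"]) auto
    qed
  qed simp
  moreover have "\<Phi> E0 \<in> \<Phi> ` Collect graph_rel" using E0 by blast
  ultimately obtain E where E: "graph_rel E" and max: "\<And>E'. graph_rel E' \<Longrightarrow> \<Phi> E' \<le> \<Phi> E"
  proof -
    assume fin\<Phi>: "finite (\<Phi> ` Collect graph_rel)" and mem: "\<Phi> E0 \<in> \<Phi> ` Collect graph_rel"
      and that: "\<And>E. graph_rel E \<Longrightarrow> (\<And>E'. graph_rel E' \<Longrightarrow> \<Phi> E' \<le> \<Phi> E) \<Longrightarrow> thesis"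
    have "Max (\<Phi> ` Collect graph_rel) \<in> \<Phi> ` Collect graph_rel" using fin\<Phi> mem by (intro Max_in) auto
    then obtain E where "graph_rel E" "Max (\<Phi> ` Collect graph_rel) = \<Phi> E" by auto
    then show thesis using that[of E] Max_ge[OF fin\<Phi>] by (metis imageI mem_Collect_eq)
  qed
  have sym: "E x y = E y x" and irr: "\<not> E x x" for x y using E unfolding graph_rel_def by blast+
  have \<kappa>: "0 < \<kappa>" using n unfolding \<kappa>_def by simp
  have dist_le: "real (blowup_distance V E) \<le> n ^ 2"
    using blowup_distance_le[of V E "\<lambda>_. Left"] card_disagreement_le[OF fin, of E "\<lambda>_. Left"]
    unfolding n_def by (metis le_trans of_nat_le_iff of_nat_power)
  \<comment> \<open>a colouring by the parts with fewest disagreements\<close>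
  obtain c where c: "blowup_distance V E = card (disagreement V E c)" using blowup_distance_attained by blast
  have min: "card (disagreement V E c) \<le> card (disagreement V E c')" for c'
    using blowup_distance_le[of V E c'] c by simp
  have "disagreement V E c = {}"
  proof (rule ccontr)
    assume "disagreement V E c \<noteq> {}"
    then obtain u v where uv: "u \<in> V" "v \<in> V" "u \<noteq> v" "E u v \<noteq> joined (c u) (c v)"
      unfolding disagreement_def by auto
    have "3 \<le> n" using n(1) by (rule order_trans[rotated]) simp
    then have "3 \<le> card V" unfolding n_def by simp
    then obtain cb where cb: "2 / 729 * n ^ 6 - 37 * n ^ 5 \<le> real (card (emb (blowup_rel cb) V))"
      using balanced_blowup_has_many_copies[OF fin] unfolding n_def by blast
    also have "\<dots> \<le> \<Phi> (blowup_rel cb)" unfolding \<Phi>_def using \<kappa> by simp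
    also have "\<dots> \<le> \<Phi> E" by (rule max[OF graph_rel_blowup])
    also have "\<dots> \<le> real (card (emb E V)) + \<kappa> * n ^ 2"
      unfolding \<Phi>_def using \<kappa> dist_le by (intro add_left_mono mult_left_mono) auto
    finally have T0: "2 / 729 * n ^ 6 - 37 * n ^ 5 \<le> real (card (emb E V)) + n ^ 6 / 10 ^ 46"
      unfolding \<kappa>_def by (simp add: power_add[symmetric])
    have "37 * 10 ^ 46 \<le> n" using n(1) by (rule order_trans[rotated]) simp
    then have "37 * 10 ^ 46 * n ^ 5 \<le> n * n ^ 5" using n(2) by (intro mult_right_mono) auto
    then have "37 * n ^ 5 \<le> n ^ 6 / 10 ^ 46" by (simp add: eval_nat_numeral field_simps)
    with T0 have T: "(2 / 729 - 2 / 10 ^ 46) * n ^ 6 \<le> real (card (emb E V))" by (simp add: algebra_simps)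
    have "1 / 1000 * n ^ 6 \<le> (2 / 729 - 2 / 10 ^ 46) * n ^ 6"
      using n(2) by (intro mult_right_mono) (simp_all add: field_simps)
    \<comment> \<open>a constant proportion of the maps are copies, so no part can be small\<close>
    with T have T1: "1 / 1000 * n ^ 6 \<le> real (card (emb E V))" by linarith
    have "V \<noteq> {}" using uv(1) by blast
    then obtain c0 where "real (card (disagreement V E c0)) \<le> 2624400 * (2 / 10 ^ 46) / (1 / 1000) * n ^ 2"
      using close_to_blowup[of V E "1/1000" "2 / 10 ^ 46", OF fin sym irr _ T1[unfolded n_def] T[unfolded n_def]]
      unfolding disagreement_def n_def by auto
    then have "real (card (disagreement V E c)) \<le> 2624400 * (2 / 10 ^ 46) / (1 / 1000) * n ^ 2"
      using min[of c0] by linarith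
    also have "\<dots> \<le> 1 / 10 ^ 36 * n ^ 2" by (intro mult_right_mono) simp_all
    finally have D: "real (card (disagreement V E c)) \<le> 1 / 10 ^ 36 * n ^ 2" .
    have "10 ^ 36 * n \<le> n * n" using n by (intro mult_right_mono) (auto intro: order_trans[rotated])
    then have "n \<le> 1 / 10 ^ 36 * n ^ 2" by (simp add: power2_eq_square)
    moreover define r where "r = real (card (wrong_pairs V E c))"
    moreover have "r \<le> n + real (card (disagreement V E c))"
      using card_wrong_pairs[OF fin, of E c] unfolding r_def n_def by (metis of_nat_add of_nat_le_iff)
    ultimately have r: "0 \<le> r" "r \<le> 2 / 10 ^ 36 * n ^ 2" using D by auto
    have r3: "r * n ^ 3 \<le> 2 / 10 ^ 36 * n ^ 5" and r4: "r * n ^ 4 \<le> 2 / 10 ^ 36 * n ^ 6" and r2: "r * n ^ 2 \<le> 2 / 10 ^ 36 * n ^ 4"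
      using mult_right_mono[OF r(2), of "n ^ 3"] mult_right_mono[OF r(2), of "n ^ 4"] mult_right_mono[OF r(2), of "n ^ 2"] n(2)
      by (simp_all add: power_add[symmetric])
    define s where "s d = real (class_size V c d)" for d
    have s_le: "s d \<le> n" "0 \<le> s d" for d
      unfolding s_def class_size_def n_def using fin by (auto intro!: card_mono)
    have "real (card (emb E V)) \<le> real (2 * (class_size V c Clique * class_size V c Left * class_size V c Right)\<^sup>2 + 36 * (card (wrong_pairs V E c) * card V ^ 4))"
      by (intro of_nat_mono card_emb_le[OF fin sym irr])
    also have "\<dots> = 2 * (s Clique * s Left * s Right)\<^sup>2 + 36 * (r * n ^ 4)"
      unfolding s_def r_def n_def by simp
    finally have "1 / 1000 * n ^ 6 \<le> 2 * (s Clique * s Left * s Right)\<^sup>2 + 36 * (2 / 10 ^ 36 * n ^ 6)"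
      using T1 r4 by linarith
    moreover have "36 * (2 / 10 ^ 36 * n ^ 6) \<le> 1 / 10000 * n ^ 6"
      unfolding mult.assoc[symmetric] using n(2) by (intro mult_right_mono) simp_all
    moreover have "0 \<le> n ^ 6" using n(2) by simp
    ultimately have prod: "n ^ 6 / 2500 \<le> (s Clique * s Left * s Right)\<^sup>2" by linarith
    have big: "n / 50 \<le> s d" for d
    proof (cases d)
      case Clique then show ?thesis using class_lower_bound[of "s Clique" "s Left" "s Right" n] prod s_le n(2) by simp
    next
      case Left then show ?thesis using class_lower_bound[of "s Left" "s Clique" "s Right" n] prod s_le n(2) by (simp add: mult_ac)
    next
      case Right then show ?thesis using class_lower_bound[of "s Right" "s Clique" "s Left" n] prod s_le n(2) by (simp add: mult_ac)
    qed
    have deg: "real (card {w \<in> V - {v}. E v w \<noteq> joined (c v) (c w)}) \<le> 4 / 10 ^ 12 * n" if v: "v \<in> V" for v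
    proof -
      define x where "x d = real (nbrs V c v (E v) d)" for d
      define y where "y d = real (non_nbrs V c v (E v) d)" for d
      define F where "F = x Clique * (y Left)\<^sup>2 * (y Right)\<^sup>2 + y Left * (x Right)\<^sup>2 * (y Clique)\<^sup>2 + y Right * (x Left)\<^sup>2 * (y Clique)\<^sup>2"
      have xy: "x d + y d = real (card {w \<in> V - {v}. c w = d})" for d
        unfolding x_def y_def using nbrs_plus_non_nbrs[OF fin] by (metis of_nat_add)
      have up: "x d + y d \<le> n" for d
        unfolding xy n_def using fin by (auto intro!: card_mono)
      have low: "1 / 60 * n \<le> x d + y d" for d
      proof -
        have "s d \<le> x d + y d + 1"
          using class_size_without_vertex[OF fin, of c d v "E v"] unfolding s_def x_def y_def by linarith
        moreover have "300 \<le> n" using n(1) by (rule order_trans[rotated]) simp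
        ultimately show ?thesis using big[of d] by linarith
      qed
      have tot: "real (vertex_total V c v (E v)) = F" unfolding vertex_total_def F_def x_def y_def by simp
      have above: "real (at_vertex v E V) \<le> 4 * F + 216 * (r * n ^ 3)"
      proof -
        have "real (at_vertex v E V) \<le> real (4 * vertex_total V c v (E v) + 216 * (card (wrong_pairs V E c) * card V ^ 3))"
          unfolding at_vertex_def by (intro of_nat_mono card_emb_at_vertex_le[OF fin sym irr v])
        then show ?thesis unfolding tot[symmetric] r_def n_def by simp
      qed
      \<comment> \<open>attaching the vertex like one of part \<open>d\<close> does not raise the potential, and costs at most \<open>2 n\<close> in distance\<close>
      have below: "real (vertex_total V c v (\<lambda>w. joined d (c w))) - (1 / 10 ^ 12)\<^sup>2 * (1 / 60) ^ 5 * n ^ 5 \<le> F" for d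
      proof -
        let ?E' = "recolour_vertex v d c E"
        have E': "graph_rel ?E'" using E by (rule graph_rel_recolour)
        have "4 * vertex_total V c v (\<lambda>w. joined d (c w)) \<le> at_vertex v ?E' V + 216 * (card (wrong_pairs V E c) * card V ^ 3)"
          unfolding at_vertex_def using E' unfolding graph_rel_def
          by (intro card_emb_at_vertex_ge[OF fin sym irr v]) (auto simp: recolour_vertex_def)
        then have "real (4 * vertex_total V c v (\<lambda>w. joined d (c w))) \<le> real (at_vertex v ?E' V + 216 * (card (wrong_pairs V E c) * card V ^ 3))"
          by (rule of_nat_mono)
        then have 1: "4 * real (vertex_total V c v (\<lambda>w. joined d (c w))) \<le> real (at_vertex v ?E' V) + 216 * (r * n ^ 3)"
          unfolding r_def n_def by simp
        have "real (card (emb E V) + at_vertex v ?E' V) = real (card (emb ?E' V) + at_vertex v E V)"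
          using card_emb_recolour[OF fin E, of v d c] by simp
        moreover have "\<Phi> ?E' \<le> \<Phi> E" by (rule max[OF E'])
        moreover have "\<kappa> * real (blowup_distance V E) \<le> \<kappa> * (real (blowup_distance V ?E') + 2 * n)"
          using distance_recolour[OF fin E v, of d c] \<kappa> unfolding n_def by (intro mult_left_mono) linarith+
        ultimately have "real (at_vertex v ?E' V) \<le> real (at_vertex v E V) + \<kappa> * (2 * n)"
          unfolding \<Phi>_def distrib_left by simp
        moreover have "\<kappa> * (2 * n) = 2 / 10 ^ 46 * n ^ 5" unfolding \<kappa>_def by (simp add: eval_nat_numeral)
        ultimately have "4 * real (vertex_total V c v (\<lambda>w. joined d (c w))) \<le> 4 * F + (432 * (2 / 10 ^ 36 * n ^ 5) + 2 / 10 ^ 46 * n ^ 5)"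
          using 1 above r3 by linarith
        also have "\<dots> \<le> 4 * F + 4 * ((1 / 10 ^ 12)\<^sup>2 * (1 / 60) ^ 5 * n ^ 5)"
        proof -
          have "(432 * (2 / 10 ^ 36) + 2 / 10 ^ 46) * n ^ 5 \<le> (4 * ((1 / 10 ^ 12)\<^sup>2 * (1 / 60) ^ 5)) * n ^ 5"
            using n(2) by (intro mult_right_mono) (simp_all add: field_simps)
          then show ?thesis by (simp add: algebra_simps)
        qed
        finally show ?thesis by linarith
      qed
      have totd: "real (vertex_total V c v (\<lambda>w. joined Clique (c w))) = (x Clique + y Clique) * (x Left + y Left)\<^sup>2 * (x Right + y Right)\<^sup>2"
        "real (vertex_total V c v (\<lambda>w. joined Left (c w))) = (x Left + y Left) * (x Right + y Right)\<^sup>2 * (x Clique + y Clique)\<^sup>2"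
        "real (vertex_total V c v (\<lambda>w. joined Right (c w))) = (x Right + y Right) * (x Left + y Left)\<^sup>2 * (x Clique + y Clique)\<^sup>2"
        unfolding vertex_total_def nbrs_of_part xy by simp_all
      have "y Clique + x Left + x Right \<le> 4 * (1 / 10 ^ 12) * n \<or> x Clique + x Left + y Right \<le> 4 * (1 / 10 ^ 12) * n \<or>
        x Clique + y Left + x Right \<le> 4 * (1 / 10 ^ 12) * n"
      proof (rule nearly_best_attachment[where m = "1 / 60" and F = F])
        show "(x Clique + y Clique) * (x Left + y Left)\<^sup>2 * (x Right + y Right)\<^sup>2 - (1 / 10 ^ 12)\<^sup>2 * (1 / 60) ^ 5 * n ^ 5 \<le> F"
          using below[of Clique] unfolding totd .
        show "(x Left + y Left) * (x Right + y Right)\<^sup>2 * (x Clique + y Clique)\<^sup>2 - (1 / 10 ^ 12)\<^sup>2 * (1 / 60) ^ 5 * n ^ 5 \<le> F"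
          using below[of Left] unfolding totd .
        show "(x Right + y Right) * (x Left + y Left)\<^sup>2 * (x Clique + y Clique)\<^sup>2 - (1 / 10 ^ 12)\<^sup>2 * (1 / 60) ^ 5 * n ^ 5 \<le> F"
          using below[of Right] unfolding totd .
      qed (use low up n(2) F_def in \<open>auto simp: x_def y_def\<close>)
      note near = this
      have N: "real (card {w \<in> V - {v}. E v w \<noteq> joined Clique (c w)}) = y Clique + x Left + x Right"
        "real (card {w \<in> V - {v}. E v w \<noteq> joined Left (c w)}) = x Clique + x Left + y Right"
        "real (card {w \<in> V - {v}. E v w \<noteq> joined Right (c w)}) = x Clique + y Left + x Right"
        unfolding card_disagreeing_neighbours[OF fin] x_def y_def by simp_all
      have "\<exists>d. real (card {w \<in> V - {v}. E v w \<noteq> joined d (c w)}) \<le> 4 * (1 / 10 ^ 12) * n"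
        using near unfolding N[symmetric] by blast
      then obtain d where "real (card {w \<in> V - {v}. E v w \<noteq> joined d (c w)}) \<le> 4 * (1 / 10 ^ 12) * n" ..
      then have d: "real (card {w \<in> V - {v}. E v w \<noteq> joined d (c w)}) \<le> 4 / 10 ^ 12 * n" by (simp only: times_divide_eq_right mult_1_right)
      \<comment> \<open>recolouring the vertex to \<open>d\<close> cannot reduce the disagreements, so the present colour is as good\<close>
      let ?c' = "c(v := d)"
      have "disagreement (V - {v}) E ?c' = disagreement (V - {v}) E c" unfolding disagreement_def by auto
      moreover have "{w \<in> V - {v}. E v w \<noteq> joined (?c' v) (?c' w)} = {w \<in> V - {v}. E v w \<noteq> joined d (c w)}" by auto
      ultimately have "card {w \<in> V - {v}. E v w \<noteq> joined (c v) (c w)} \<le> card {w \<in> V - {v}. E v w \<noteq> joined d (c w)}"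
        using min[of ?c'] disagreement_at_vertex[of V E v c, OF fin sym v] disagreement_at_vertex[of V E v ?c', OF fin sym v] by simp
      then show ?thesis using d by linarith
    qed
    \<comment> \<open>one more per vertex than above, because loops count as wrong pairs\<close>
    define Dg where "Dg = nat \<lfloor>5 / 10 ^ 12 * n\<rfloor>"
    have Dg: "real Dg \<le> 5 / 10 ^ 12 * n" unfolding Dg_def by (rule of_nat_floor) (use n(2) in simp)
    have degR: "card {y. (x, y) \<in> wrong_pairs V E c} \<le> Dg" for x
    proof (cases "x \<in> V")
      case True
      have "{y. (x, y) \<in> wrong_pairs V E c} \<subseteq> insert x {w \<in> V - {x}. E x w \<noteq> joined (c x) (c w)}"
        unfolding wrong_pairs_def by auto
      then have "card {y. (x, y) \<in> wrong_pairs V E c} \<le> card (insert x {w \<in> V - {x}. E x w \<noteq> joined (c x) (c w)})"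
        using fin by (intro card_mono) auto
      also have "\<dots> \<le> Suc (card {w \<in> V - {x}. E x w \<noteq> joined (c x) (c w)})" by (rule card_insert_le_m1) simp_all
      finally have "real (card {y. (x, y) \<in> wrong_pairs V E c}) \<le> 4 / 10 ^ 12 * n + 1" using deg[OF True] by linarith
      moreover have "10 ^ 12 \<le> n" using n(1) by (rule order_trans[rotated]) simp
      ultimately have "real (card {y. (x, y) \<in> wrong_pairs V E c}) \<le> 5 / 10 ^ 12 * n" by simp
      then show ?thesis unfolding Dg_def by linarith
    next
      case False
      then have "{y. (x, y) \<in> wrong_pairs V E c} = {}" unfolding wrong_pairs_def by auto
      then show ?thesis by (simp only: card.empty)
    qed
    define m where "m = card V div 50"
    have m: "m \<le> class_size V c d" for d
    proof -
      have "real m \<le> n / 50" unfolding m_def n_def by linarith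
      then have "real m \<le> s d" using big[of d] by linarith
      then show ?thesis unfolding s_def by simp
    qed
    have "300 \<le> n" using n(1) by (rule order_trans[rotated]) simp
    then have mlow: "n / 60 \<le> real m" unfolding m_def n_def by linarith
    let ?E' = "flip_pair u v E"
    have E': "graph_rel ?E'" using E uv(3) by (rule graph_rel_flip)
    have "m ^ 4 + card (emb E V) \<le> card (emb ?E' V) + 1332 * (card (wrong_pairs V E c) * card V ^ 2 + Dg * card V ^ 3)"
    proof (rule card_emb_flip_pair[OF fin sym irr _ _ uv _ _ degR m])
      show "?E' x y = ?E' y x" "\<not> ?E' x x" for x y using E' unfolding graph_rel_def by blast+
      show "?E' x y = E x y" if "{x, y} \<noteq> {u, v}" for x y using that unfolding flip_pair_def by simp
      show "?E' u v = joined (c u) (c v)" using uv(4) unfolding flip_pair_def by simp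
    qed
    then have "real (m ^ 4 + card (emb E V)) \<le> real (card (emb ?E' V) + 1332 * (card (wrong_pairs V E c) * card V ^ 2 + Dg * card V ^ 3))"
      by (rule of_nat_mono)
    then have 1: "real m ^ 4 + real (card (emb E V)) \<le> real (card (emb ?E' V)) + 1332 * (r * n ^ 2 + real Dg * n ^ 3)"
      unfolding r_def n_def by simp
    have "\<Phi> ?E' \<le> \<Phi> E" by (rule max[OF E'])
    moreover have "\<kappa> * real (blowup_distance V E) \<le> \<kappa> * (real (blowup_distance V ?E') + 2)"
      using distance_flip[OF fin, of E u v] \<kappa> by (intro mult_left_mono) linarith+
    ultimately have "real (card (emb ?E' V)) \<le> real (card (emb E V)) + \<kappa> * 2"
      unfolding \<Phi>_def distrib_left by linarith
    then have "real m ^ 4 \<le> \<kappa> * 2 + 1332 * (r * n ^ 2 + real Dg * n ^ 3)" using 1 by linarith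
    moreover have Dg3: "real Dg * n ^ 3 \<le> 5 / 10 ^ 12 * n ^ 4"
      using mult_right_mono[OF Dg, of "n ^ 3"] n(2) by (simp add: eval_nat_numeral)
    moreover from this have "1332 * (r * n ^ 2 + real Dg * n ^ 3) \<le> 1332 * (2 / 10 ^ 36 * n ^ 4 + 5 / 10 ^ 12 * n ^ 4)"
      by (intro mult_left_mono add_mono r2) simp_all
    moreover have "1332 * (2 / 10 ^ 36 * n ^ 4 + 5 / 10 ^ 12 * n ^ 4) \<le> 1 / 10 ^ 8 * n ^ 4"
      unfolding distrib_right[symmetric] mult.assoc[symmetric] using n(2) by (intro mult_right_mono) simp_all
    moreover have "\<dots> \<le> n ^ 4 / 100000000" by simp
    moreover have "\<kappa> * 2 \<le> 1 / 10 ^ 8 * n ^ 4" unfolding \<kappa>_def using n(2) by (simp add: divide_simps)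
    moreover have "(n / 60) ^ 4 \<le> real m ^ 4" using mlow n(2) by (intro power_mono) auto
    moreover have "(n / 60) ^ 4 = n ^ 4 / 12960000" by (simp add: power_divide)
    moreover have "0 < n ^ 4" using n(2) by simp
    ultimately show False by linarith
  qed
  then have "\<Phi> E = real (card (emb E V))" unfolding \<Phi>_def c by simp
  also have "emb E V = emb (blowup_rel c) V"
  proof (rule emb_cong)
    fix x y assume "x \<in> V" "y \<in> V"
    then show "E x y = blowup_rel c x y"
      using \<open>disagreement V E c = {}\<close> irr unfolding disagreement_def blowup_rel_def by auto
  qed
  finally have "\<Phi> E0 \<le> real (card (emb (blowup_rel c) V))" using max[OF E0] by simp
  then show ?thesis unfolding \<Phi>_def \<kappa>_def n_def by blast
qed

section \<open>Densities\<close>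

lemma card_copy_sets_le:
  assumes "simple_graph G"
  shows "card (copy_sets G) \<le> card (verts G) choose 6"
proof -
  have fin: "finite (verts G)" using assms by (simp add: simple_graph_def)
  have "copy_sets G \<subseteq> {S. S \<subseteq> verts G \<and> card S = 6}" unfolding copy_sets_def by blast
  moreover have "finite {S. S \<subseteq> verts G \<and> card S = 6}"
    by (rule finite_subset[of _ "Pow (verts G)"]) (use fin in auto)
  ultimately have "card (copy_sets G) \<le> card {S. S \<subseteq> verts G \<and> card S = 6}" by (rule card_mono[rotated])
  then show ?thesis using n_subsets[OF fin, of 6] by simp
qed

lemma density_eq_copy_sets:
  "induced_density F31 G = real (card (copy_sets G)) / real (card (verts G) choose 6)"
  unfolding induced_density_def copy_sets_def by (simp add: F31_def)

lemma density_eq_embeddings: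
  assumes "simple_graph G"
  shows "induced_density F31 G = real (card (emb (adj G) (verts G))) / 16 / real (card (verts G) choose 6)"
  unfolding density_eq_copy_sets card_emb_eq[OF assms] by simp

text \<open>There are infinitely many graphs with \<open>n\<close> vertices among the natural numbers, but the density takes
  finitely many values; this makes the maximum meaningful.\<close>

lemma densities_finite:
  "finite {induced_density F31 G | G :: nat pattern. simple_graph G \<and> card (verts G) = n}" (is "finite ?D")
proof (rule finite_subset)
  show "?D \<subseteq> (\<lambda>k. real k / real (n choose 6)) ` {..n choose 6}"
  proof
    fix d assume "d \<in> ?D"
    then obtain G :: "nat pattern" where G: "d = induced_density F31 G" "simple_graph G" "card (verts G) = n" by blast
    then have "d = real (card (copy_sets G)) / real (n choose 6)" "card (copy_sets G) \<le> n choose 6"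
      using density_eq_copy_sets[of G] card_copy_sets_le[OF G(2)] by (simp_all only: G(3))
    then show "d \<in> (\<lambda>k. real k / real (n choose 6)) ` {..n choose 6}" by blast
  qed
qed simp

lemma max_density_upper:
  fixes G :: "nat pattern"
  assumes "simple_graph G"
  shows "induced_density F31 G \<le> max_density F31 (card (verts G))"
  unfolding max_density_def by (rule Max_ge[OF densities_finite]) (use assms in blast)

lemma max_density_attained:
  "\<exists>G :: nat pattern. simple_graph G \<and> card (verts G) = n \<and> max_density F31 n = induced_density F31 G"
proof -
  have "simple_graph ({..<n}, {})" "card (verts ({..<n}, {} :: nat set set)) = n"
    by (simp_all add: simple_graph_def)
  then have "{induced_density F31 G | G :: nat pattern. simple_graph G \<and> card (verts G) = n} \<noteq> {}" by blast
  from Max_in[OF densities_finite this] show ?thesis unfolding max_density_def by blast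
qed

lemma graph_rel_adj: "simple_graph G \<Longrightarrow> graph_rel (adj G)"
  unfolding graph_rel_def using adj_commute adj_irrefl by blast

fun index :: "part \<Rightarrow> nat" where
  "index Clique = 0"
| "index Left = 1"
| "index Right = 2"

lemma joined_iff_edge: "joined p q \<longleftrightarrow> {index p, index q} \<in> edges B31"
  by (cases p; cases q) (simp_all add: B31_def doubleton_eq_iff)

lemma verts_B31: "i \<in> verts B31 \<longleftrightarrow> (\<exists>p. i = index p)"
proof
  assume "i \<in> verts B31"
  then have "i = 0 \<or> i = 1 \<or> i = 2" by (auto simp: B31_def)
  then show "\<exists>p. i = index p" by (metis index.simps)
next
  assume "\<exists>p. i = index p"
  then obtain p where "i = index p" ..
  then show "i \<in> verts B31" by (cases p) (simp_all add: B31_def)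
qed

lemma ex_verts_B31: "(\<exists>i\<in>verts B31. P i) \<longleftrightarrow> (\<exists>p. P (index p))"
  using verts_B31 by auto

lemma index_inject: "index p = index q \<longleftrightarrow> p = q"
  by (cases p; cases q) simp_all

definition coloured_graph :: "nat set \<Rightarrow> (nat \<Rightarrow> part) \<Rightarrow> nat pattern" where
  "coloured_graph V c = (V, {{x, y} | x y. x \<in> V \<and> y \<in> V \<and> x \<noteq> y \<and> joined (c x) (c y)})"

lemma verts_coloured_graph: "verts (coloured_graph V c) = V"
  by (simp add: coloured_graph_def)

lemma simple_coloured_graph: "finite V \<Longrightarrow> simple_graph (coloured_graph V c)"
  unfolding simple_graph_def coloured_graph_def by auto

lemma adj_coloured_graph:
  assumes "x \<in> V" "y \<in> V"
  shows "adj (coloured_graph V c) x y = blowup_rel c x y"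
proof
  assume "adj (coloured_graph V c) x y"
  then obtain x' y' where "{x, y} = {x', y'}" "x' \<noteq> y'" "joined (c x') (c y')"
    unfolding adj_def coloured_graph_def by auto
  then show "blowup_rel c x y" unfolding blowup_rel_def doubleton_eq_iff using joined_commute by blast
next
  assume "blowup_rel c x y"
  then show "adj (coloured_graph V c) x y"
    unfolding adj_def coloured_graph_def blowup_rel_def using assms by auto
qed

lemma emb_coloured_graph: "emb (adj (coloured_graph V c)) V = emb (blowup_rel c) V"
  by (rule emb_cong[OF adj_coloured_graph])

lemma coloured_graph_is_blowup:
  assumes "finite V"
  shows "coloured_graph V c \<in> blowups B31"
proof -
  let ?W = "\<lambda>i. {w \<in> V. index (c w) = i}"
  have "blowup_parts B31 ?W" unfolding blowup_parts_def disjoint_family_on_def using assms by auto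
  moreover have "coloured_graph V c = blowup B31 ?W"
  proof (rule prod_eqI)
    show "verts (coloured_graph V c) = verts (blowup B31 ?W)"
      unfolding coloured_graph_def blowup_def using verts_B31 by auto
    have "(x \<noteq> y \<and> (\<exists>i\<in>verts B31. \<exists>j\<in>verts B31. x \<in> ?W i \<and> y \<in> ?W j \<and> {i, j} \<in> edges B31)) \<longleftrightarrow>
        (x \<in> V \<and> y \<in> V \<and> x \<noteq> y \<and> joined (c x) (c y))" for x y
      unfolding joined_iff_edge ex_verts_B31 mem_Collect_eq index_inject by auto
    then show "edges (coloured_graph V c) = edges (blowup B31 ?W)"
      unfolding coloured_graph_def blowup_def by simp
  qed
  ultimately show ?thesis unfolding blowups_def by blast
qed

text \<open>Each edge to be changed comes from a disagreeing ordered pair.\<close>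

lemma edit_distance_le:
  assumes "simple_graph G"
  shows "edit_distance G B31 \<le> card (disagreement (verts G) (adj G) c)"
proof -
  let ?V = "verts G" and ?H = "coloured_graph (verts G) c"
  let ?D = "\<lambda>H. (edges G - edges H) \<union> (edges H - edges G)"
  have fin: "finite ?V" using assms by (simp add: simple_graph_def)
  let ?S = "{card (?D H) | H. simple_graph H \<and> verts H = ?V \<and> (\<exists>K :: nat pattern. K \<in> blowups B31 \<and> isomorphic H K)}"
  have "?S \<subseteq> card ` Pow (Pow ?V)"
  proof
    fix k assume "k \<in> ?S"
    then obtain H where H: "k = card (?D H)" "simple_graph H" "verts H = ?V" by blast
    have "?D H \<in> Pow (Pow ?V)" using assms H(2,3) unfolding simple_graph_def by blast
    then show "k \<in> card ` Pow (Pow ?V)" unfolding H(1) by (rule imageI)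
  qed
  then have "finite ?S" by (rule finite_subset) (use fin in simp)
  moreover have "card (?D ?H) \<in> ?S"
  proof -
    have "pattern_iso id ?H ?H" by (simp add: pattern_iso_def)
    then show ?thesis
      using simple_coloured_graph[OF fin, of c] verts_coloured_graph[of ?V c] coloured_graph_is_blowup[OF fin, of c]
      unfolding isomorphic_def by blast
  qed
  ultimately have "edit_distance G B31 \<le> card (?D ?H)" unfolding edit_distance_def by (rule Min_le)
  also have "?D ?H \<subseteq> (\<lambda>(x, y). {x, y}) ` disagreement ?V (adj G) c"
  proof
    fix e assume e: "e \<in> ?D ?H"
    have "e \<subseteq> ?V \<and> card e = 2"
      using e assms simple_coloured_graph[OF fin, of c] verts_coloured_graph[of ?V c] unfolding simple_graph_def by blast
    then obtain x y where xy: "e = {x, y}" "x \<noteq> y" "x \<in> ?V" "y \<in> ?V" unfolding card_2_iff by auto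
    have "adj G x y \<noteq> adj ?H x y" using e unfolding xy(1) adj_def by blast
    then have "(x, y) \<in> disagreement ?V (adj G) c"
      using xy unfolding disagreement_def adj_coloured_graph[OF xy(3,4)] blowup_rel_def by simp
    then show "e \<in> (\<lambda>(x, y). {x, y}) ` disagreement ?V (adj G) c" unfolding xy(1) by (rule rev_image_eqI) simp
  qed
  then have "card (?D ?H) \<le> card ((\<lambda>(x, y). {x, y}) ` disagreement ?V (adj G) c)"
    by (rule card_mono[rotated]) (simp add: finite_disagreement[OF fin])
  also have "\<dots> \<le> card (disagreement ?V (adj G) c)" by (rule card_image_le[OF finite_disagreement[OF fin]])
  finally show ?thesis .
qed

text \<open>Compare with the blowup supplied by the maximisation: an embedding count is \<open>16\<close> times the number of copies, and
  the number of six-sets is at most \<open>n\<^sup>6\<close>, so that the estimate holds with \<open>16 * 10\<^sup>4\<^sup>6\<close>; the larger constant also serves as the threshold for the number of vertices.\<close>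

lemma F31_perfectly_stable: "perfectly_stable F31 B31"
  unfolding perfectly_stable_def
proof (intro exI[of _ "10 ^ 50 :: real"] conjI allI impI)
  fix G :: "nat pattern" assume "simple_graph G \<and> (10 ^ 50 :: real) \<le> real (card (verts G))"
  then have G: "simple_graph G" and large: "10 ^ 50 \<le> real (card (verts G))" by blast+
  let ?V = "verts G"
  define n where "n = real (card ?V)"
  define b where "b = real (card ?V choose 6)"
  define gap where "gap = max_density F31 (card ?V) - induced_density F31 G"
  have n: "0 < n" unfolding n_def by (rule less_le_trans[OF _ large]) simp
  have fin: "finite ?V" using G by (simp add: simple_graph_def)
  obtain c where c: "real (card (emb (adj G) ?V)) + n ^ 4 / 10 ^ 46 * real (blowup_distance ?V (adj G))
      \<le> real (card (emb (blowup_rel c) ?V))"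
    using extremal_graphs_are_blowups[OF fin large graph_rel_adj[OF G]] unfolding n_def by blast
  let ?H = "coloured_graph ?V c"
  have H: "simple_graph ?H" "verts ?H = ?V" using simple_coloured_graph[OF fin] verts_coloured_graph by blast+
  have "6 \<le> n" unfolding n_def by (rule order_trans[OF _ large]) simp
  then have "6 \<le> card ?V" unfolding n_def by simp
  then have b: "0 < b" "b \<le> n ^ 6"
    using binomial_le_pow[of 6 "card ?V"] unfolding b_def n_def by (simp_all flip: of_nat_power)
  have "real (card (emb (blowup_rel c) ?V)) = 16 * b * induced_density F31 ?H"
    using density_eq_embeddings[OF H(1)] b(1) unfolding H(2) emb_coloured_graph b_def by simp
  also have "\<dots> \<le> 16 * b * max_density F31 (card ?V)"
    using max_density_upper[OF H(1)] b(1) unfolding H(2) by (intro mult_left_mono) auto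
  finally have "n ^ 4 / 10 ^ 46 * real (blowup_distance ?V (adj G)) + 16 * b * induced_density F31 G
      \<le> 16 * b * max_density F31 (card ?V)"
    using c density_eq_embeddings[OF G] b(1) unfolding b_def by simp
  then have 1: "n ^ 4 / 10 ^ 46 * real (blowup_distance ?V (adj G)) \<le> 16 * b * gap"
    unfolding gap_def by (simp add: algebra_simps)
  have gap: "0 \<le> gap" unfolding gap_def using max_density_upper[OF G] by simp
  have "16 * b * gap \<le> 16 * n ^ 6 * gap" using b(2) gap by (intro mult_right_mono) auto
  with 1 have "n ^ 4 / 10 ^ 46 * real (blowup_distance ?V (adj G)) \<le> n ^ 4 / 10 ^ 46 * (16 * 10 ^ 46 * gap * n ^ 2)"
    by (simp add: field_simps eval_nat_numeral)
  then have "real (blowup_distance ?V (adj G)) \<le> 16 * 10 ^ 46 * gap * n ^ 2"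
    by (rule mult_left_le_imp_le) (use n in simp)
  also have "\<dots> \<le> 10 ^ 50 * gap * n ^ 2" using gap by (intro mult_right_mono) auto
  finally have "real (blowup_distance ?V (adj G)) \<le> 10 ^ 50 * gap * n ^ 2" .
  moreover obtain c' where "blowup_distance ?V (adj G) = card (disagreement ?V (adj G) c')"
    using blowup_distance_attained by blast
  ultimately show "real (edit_distance G B31) \<le>
      10 ^ 50 * (max_density F31 (card ?V) - induced_density F31 G) * (real (card ?V))\<^sup>2"
    using edit_distance_le[OF G, of c'] unfolding gap_def n_def by linarith
qed simp

lemma choose_six_limit: "(\<lambda>n. real (n choose 6) / real n ^ 6) \<longlonglongrightarrow> 1 / 720"
proof -
  have "(\<lambda>n. (\<Prod>i<6. 1 - real i * (1 / real n)) / 720) \<longlonglongrightarrow> (\<Prod>i<6::nat. 1 - real i * 0) / 720"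
    by (intro tendsto_intros lim_1_over_n) simp_all
  moreover have "\<forall>\<^sub>F n in sequentially. (\<Prod>i<6. 1 - real i * (1 / real n)) / 720 = real (n choose 6) / real n ^ 6"
  proof (rule eventually_mono[OF eventually_gt_at_top[of 0]])
    fix n :: nat assume n: "0 < n"
    have "real (n choose 6) = (\<Prod>i<6. real n - real i) / 720"
      unfolding binomial_gbinomial gbinomial_prod_rev by (simp add: atLeast0LessThan fact_numeral)
    moreover have "(\<Prod>i<6. real n - real i) = (\<Prod>i<6. real n * (1 - real i * (1 / real n)))"
      using n by (intro prod.cong refl) (simp add: field_simps)
    moreover have "\<dots> = real n ^ 6 * (\<Prod>i<6. 1 - real i * (1 / real n))"
      unfolding prod.distrib by simp
    ultimately show "(\<Prod>i<6. 1 - real i * (1 / real n)) / 720 = real (n choose 6) / real n ^ 6"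
      using n by simp
  qed
  ultimately have "(\<lambda>n. real (n choose 6) / real n ^ 6) \<longlonglongrightarrow> (\<Prod>i<6::nat. 1 - real i * 0) / 720"
    by (rule Lim_transform_eventually)
  then show ?thesis by simp
qed

lemma max_density_limit: "max_density F31 \<longlonglongrightarrow> 10 / 81"
proof -
  let ?q = "\<lambda>n. real (n choose 6) / real n ^ 6"
  have lower: "(2 / 729 - 37 * (1 / real n)) / 16 / ?q n \<le> max_density F31 n" if n: "6 \<le> n" for n
  proof -
    obtain c where c: "2 / 729 * real n ^ 6 - 37 * real n ^ 5 \<le> real (card (emb (blowup_rel c) {..<n}))"
      using balanced_blowup_has_many_copies[of "{..<n}"] n by auto
    let ?H = "coloured_graph {..<n} c"
    have H: "simple_graph ?H" "verts ?H = {..<n}"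
      using simple_coloured_graph[OF finite_lessThan[of n], of c] verts_coloured_graph[of "{..<n}" c] .
    have "(2 / 729 - 37 * (1 / real n)) / 16 / ?q n = (2 / 729 * real n ^ 6 - 37 * real n ^ 5) / 16 / real (n choose 6)"
    proof -
      have "real n ^ 6 = real n * real n ^ 5" by (simp flip: power_Suc)
      then have "2 / 729 - 37 * (1 / real n) = (2 / 729 * real n ^ 6 - 37 * real n ^ 5) / real n ^ 6"
        using n by (simp add: diff_divide_distrib)
      then show ?thesis using n by simp
    qed
    also have "\<dots> \<le> real (card (emb (blowup_rel c) {..<n})) / 16 / real (n choose 6)"
      using c by (intro divide_right_mono) auto
    also have "\<dots> = induced_density F31 ?H" using density_eq_embeddings[OF H(1)] unfolding H(2) emb_coloured_graph by simp
    also have "\<dots> \<le> max_density F31 n" using max_density_upper[OF H(1)] unfolding H(2) by simp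
    finally show ?thesis .
  qed
  have upper: "max_density F31 n \<le> 2 / 729 / 16 / ?q n" if n: "6 \<le> n" for n
  proof -
    obtain G :: "nat pattern" where G: "simple_graph G" "card (verts G) = n" "max_density F31 n = induced_density F31 G"
      using max_density_attained by blast
    have fin: "finite (verts G)" using G by (simp add: simple_graph_def)
    have "finite (copies (adj G) (verts G))"
      unfolding copies_def by (rule finite_subset[OF Collect_restrict finite_maps_to[OF fin]])
    moreover have "emb (adj G) (verts G) \<subseteq> copies (adj G) (verts G)" unfolding emb_def by blast
    ultimately have "card (emb (adj G) (verts G)) \<le> card (copies (adj G) (verts G))" by (rule card_mono)
    then have "real (card (emb (adj G) (verts G))) \<le> real (card (copies (adj G) (verts G)))" by simp
    moreover have "2624400 * real (card (copies (adj G) (verts G))) \<le> 7200 * real n ^ 6"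
      using copies_bound[of "adj G", OF adj_commute adj_irrefl[OF G(1)] fin] unfolding G(2) by linarith
    ultimately have "2624400 * real (card (emb (adj G) (verts G))) \<le> 7200 * real n ^ 6" by linarith
    then have "real (card (emb (adj G) (verts G))) \<le> 2 / 729 * real n ^ 6" by simp
    then have "induced_density F31 G \<le> 2 / 729 * real n ^ 6 / 16 / real (n choose 6)"
      unfolding density_eq_embeddings[OF G(1)] G(2) by (intro divide_right_mono) auto
    then show ?thesis unfolding G(3) by simp
  qed
  have "(\<lambda>n. (2 / 729 - 37 * (1 / real n)) / 16 / ?q n) \<longlonglongrightarrow> (2 / 729 - 37 * 0) / 16 / (1 / 720)"
    by (intro tendsto_intros lim_1_over_n choose_six_limit) simp_all
  then have lo: "(\<lambda>n. (2 / 729 - 37 * (1 / real n)) / 16 / ?q n) \<longlonglongrightarrow> 10 / 81" by simp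
  have "(\<lambda>n. 2 / 729 / 16 / ?q n) \<longlonglongrightarrow> 2 / 729 / 16 / (1 / 720)"
    by (intro tendsto_intros choose_six_limit) simp_all
  then have up: "(\<lambda>n. 2 / 729 / 16 / ?q n) \<longlonglongrightarrow> 10 / 81" by simp
  show ?thesis
    by (rule tendsto_sandwich[OF _ _ lo up]; rule eventually_mono[OF eventually_ge_at_top[of 6]])
       (use lower upper in blast)+
qed

text \<open>Each vertex is coloured by the unique part that contains it.\<close>

lemma blowup_has_colouring:
  assumes "blowup_parts B31 V"
  shows "\<exists>c. blowup B31 V = coloured_graph (\<Union>i\<in>verts B31. V i) c \<and> (\<forall>p. {w \<in> (\<Union>i\<in>verts B31. V i). c w = p} = V (index p))"
proof -
  let ?U = "\<Union>i\<in>verts B31. V i"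
  have U: "?U = (\<Union>p. V (index p))" using verts_B31 by auto
  have disj: "p = q" if "w \<in> V (index p)" "w \<in> V (index q)" for w p q
    using assms that verts_B31 index_inject unfolding blowup_parts_def disjoint_family_on_def by blast
  define c where "c w = (THE p. w \<in> V (index p))" for w
  have c: "c w = p" if "w \<in> V (index p)" for w p
    unfolding c_def
  proof (rule the_equality)
    show "w \<in> V (index p)" by (rule that)
    show "q = p" if "w \<in> V (index q)" for q by (rule disj[OF that \<open>w \<in> V (index p)\<close>])
  qed
  have mem: "w \<in> V (index p) \<longleftrightarrow> w \<in> ?U \<and> c w = p" for w p
    unfolding U using c by blast
  have "(x \<noteq> y \<and> (\<exists>i\<in>verts B31. \<exists>j\<in>verts B31. x \<in> V i \<and> y \<in> V j \<and> {i, j} \<in> edges B31)) \<longleftrightarrow>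
      (x \<in> ?U \<and> y \<in> ?U \<and> x \<noteq> y \<and> joined (c x) (c y))" for x y
  proof -
    have "(\<exists>i\<in>verts B31. \<exists>j\<in>verts B31. x \<in> V i \<and> y \<in> V j \<and> {i, j} \<in> edges B31) \<longleftrightarrow>
        (\<exists>p q. x \<in> V (index p) \<and> y \<in> V (index q) \<and> joined p q)"
      unfolding joined_iff_edge ex_verts_B31 by blast
    then show ?thesis unfolding mem by blast
  qed
  then have "blowup B31 V = coloured_graph ?U c" unfolding blowup_def coloured_graph_def by simp
  moreover have "{w \<in> ?U. c w = p} = V (index p)" for p using mem by blast
  ultimately show ?thesis by blast
qed

lemma embeddings_into_blowup:
  assumes V: "blowup_parts B31 V" and N: "N = card (V 0) + card (V 1) + card (V 2)"
  shows "card (verts (blowup B31 V)) = N" "simple_graph (blowup B31 V)"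
    "\<bar>real (card (emb (adj (blowup B31 V)) (verts (blowup B31 V)))) - 2 * (real (card (V 0)) * real (card (V 1)) * real (card (V 2)))\<^sup>2\<bar> \<le> 36 * real N ^ 5"
proof -
  let ?U = "\<Union>i\<in>verts B31. V i"
  obtain c where G: "blowup B31 V = coloured_graph ?U c" and c: "\<And>p. {w \<in> ?U. c w = p} = V (index p)"
    using blowup_has_colouring[OF V] by blast
  have fin: "finite ?U" using V unfolding blowup_parts_def by (auto simp: B31_def)
  show simple: "simple_graph (blowup B31 V)" unfolding G by (rule simple_coloured_graph[OF fin])
  have U: "?U = V 0 \<union> V 1 \<union> V 2" by (auto simp: B31_def numeral_3_eq_3 less_Suc_eq numeral_2_eq_2)
  have m: "c w = p" if "w \<in> V (index p)" for w p using that unfolding c[symmetric] by blast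
  have d: "V 0 \<inter> V 1 = {}" "(V 0 \<union> V 1) \<inter> V 2 = {}"
    unfolding disjoint_iff using m[of _ Clique] m[of _ Left] m[of _ Right] part.distinct by (simp_all, metis+)
  have f: "finite (V 0)" "finite (V 1)" "finite (V 2)" using fin unfolding U by simp_all
  have cardU: "card ?U = N"
    unfolding U N using card_Un_disjoint[OF _ f(3) d(2)] card_Un_disjoint[OF f(1,2) d(1)] f by simp
  then show "card (verts (blowup B31 V)) = N" unfolding G verts_coloured_graph .
  have size: "class_size ?U c Clique = card (V 0)" "class_size ?U c Left = card (V 1)" "class_size ?U c Right = card (V 2)"
    unfolding class_size_def c by simp_all
  let ?R = "wrong_pairs ?U (blowup_rel c) c"
  have "disagreement ?U (blowup_rel c) c = {}" unfolding disagreement_def blowup_rel_def by auto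
  then have "card ?R \<le> N" using card_wrong_pairs[OF fin, of "blowup_rel c" c] unfolding cardU by simp
  then have "card ?R * N ^ 4 \<le> N * N ^ 4" by (rule mult_right_mono) simp
  moreover have "N * N ^ 4 = N ^ 5" by (simp add: eval_nat_numeral)
  ultimately have R: "36 * (card ?R * N ^ 4) \<le> 36 * N ^ 5" by linarith
  have sym: "blowup_rel c x y = blowup_rel c y x" and irr: "\<not> blowup_rel c x x" for x y
    using graph_rel_blowup unfolding graph_rel_def by blast+
  have "card (emb (blowup_rel c) ?U) \<le> 2 * (card (V 0) * card (V 1) * card (V 2))\<^sup>2 + 36 * N ^ 5"
    using card_emb_le[of ?U "blowup_rel c" c, OF fin sym irr] R unfolding size cardU by linarith
  from of_nat_mono[OF this, where ?'a = real]
  have le: "real (card (emb (blowup_rel c) ?U)) \<le> 2 * (real (card (V 0)) * real (card (V 1)) * real (card (V 2)))\<^sup>2 + 36 * real N ^ 5"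
    by simp
  have "2 * (card (V 0) * card (V 1) * card (V 2))\<^sup>2 \<le> card (emb (blowup_rel c) ?U) + 36 * N ^ 5"
    using card_emb_ge[of ?U "blowup_rel c" c, OF fin sym irr] R unfolding size cardU by linarith
  from of_nat_mono[OF this, where ?'a = real]
  have ge: "2 * (real (card (V 0)) * real (card (V 1)) * real (card (V 2)))\<^sup>2 \<le> real (card (emb (blowup_rel c) ?U)) + 36 * real N ^ 5"
    by simp
  show "\<bar>real (card (emb (adj (blowup B31 V)) (verts (blowup B31 V)))) - 2 * (real (card (V 0)) * real (card (V 1)) * real (card (V 2)))\<^sup>2\<bar> \<le> 36 * real N ^ 5"
    unfolding G verts_coloured_graph emb_coloured_graph abs_le_iff using le ge by linarith
qed

text \<open>The parts need only sum to \<open>(1 + o(1)) n\<close>, so the number of vertices is normalised separately.\<close>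

lemma blowup_sequence_limit:
  fixes V :: "nat \<Rightarrow> nat \<Rightarrow> nat set"
  assumes parts: "\<And>n. blowup_parts B31 (V n)"
    and lim: "\<And>i. i < 3 \<Longrightarrow> (\<lambda>n. real (card (V n i)) / real n) \<longlonglongrightarrow> x i"
    and total: "x 0 + x 1 + x 2 = 1"
  shows "(\<lambda>n. induced_density F31 (blowup B31 (V n))) \<longlonglongrightarrow> 90 * (x 0 * x 1 * x 2)\<^sup>2"
proof -
  define N where "N n = card (V n 0) + card (V n 1) + card (V n 2)" for n
  define T where "T n = real (card (emb (adj (blowup B31 (V n))) (verts (blowup B31 (V n)))))" for n
  define P where "P n = real (card (V n 0)) / real n * (real (card (V n 1)) / real n) * (real (card (V n 2)) / real n)" for n
  have P: "P \<longlonglongrightarrow> x 0 * x 1 * x 2" unfolding P_def by (intro tendsto_mult lim) simp_all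
  have "(\<lambda>n. real (card (V n 0)) / real n + real (card (V n 1)) / real n + real (card (V n 2)) / real n) \<longlonglongrightarrow> x 0 + x 1 + x 2"
    by (intro tendsto_add lim) simp_all
  then have N: "(\<lambda>n. real (N n) / real n) \<longlonglongrightarrow> 1"
    unfolding N_def total by (simp add: add_divide_distrib)
  have "filterlim (\<lambda>n. real (N n) / real n * real n) at_top sequentially"
    by (rule filterlim_tendsto_pos_mult_at_top[OF N _ filterlim_real_sequentially]) simp
  moreover have "\<forall>\<^sub>F n in sequentially. real (N n) / real n * real n = real (N n)"
    by (rule eventually_mono[OF eventually_gt_at_top[of 0]]) simp
  ultimately have "filterlim (\<lambda>n. real (N n)) at_top sequentially" by (rule filterlim_cong[THEN iffD1, rotated -1, OF _ refl refl])
  then have "\<forall>\<^sub>F n in sequentially. real Z \<le> real (N n)" for Z :: nat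
    unfolding filterlim_at_top by blast
  then have Ntop: "filterlim N at_top sequentially" unfolding filterlim_at_top of_nat_le_iff by blast
  from Ntop have ch: "(\<lambda>n. real (N n choose 6) / real (N n) ^ 6) \<longlonglongrightarrow> 1 / 720"
    by (rule filterlim_compose[OF choose_six_limit])
  have diff: "(\<lambda>n. T n / real n ^ 6 - 2 * (P n)\<^sup>2) \<longlonglongrightarrow> 0"
  proof (rule tendsto_rabs_zero_cancel, rule tendsto_sandwich[OF _ _ tendsto_const])
    show "\<forall>\<^sub>F n in sequentially. 0 \<le> \<bar>T n / real n ^ 6 - 2 * (P n)\<^sup>2\<bar>" by simp
    have "(\<lambda>n. 36 * (real (N n) / real n) ^ 5 * (1 / real n)) \<longlonglongrightarrow> 36 * 1 ^ 5 * 0"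
      by (intro tendsto_intros N lim_1_over_n)
    then show "(\<lambda>n. 36 * (real (N n) / real n) ^ 5 * (1 / real n)) \<longlonglongrightarrow> 0" by simp
    show "\<forall>\<^sub>F n in sequentially. \<bar>T n / real n ^ 6 - 2 * (P n)\<^sup>2\<bar> \<le> 36 * (real (N n) / real n) ^ 5 * (1 / real n)"
    proof (rule eventually_mono[OF eventually_gt_at_top[of 0]])
      fix n :: nat assume n: "0 < n"
      let ?s = "real (card (V n 0)) * real (card (V n 1)) * real (card (V n 2))"
      have "P n = ?s / real n ^ 3" unfolding P_def by (simp add: eval_nat_numeral)
      then have "(P n)\<^sup>2 = ?s\<^sup>2 / real n ^ 6" by (simp add: power_divide flip: power_mult)
      then have "T n / real n ^ 6 - 2 * (P n)\<^sup>2 = (T n - 2 * ?s\<^sup>2) / real n ^ 6" by (simp add: diff_divide_distrib)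
      then have "\<bar>T n / real n ^ 6 - 2 * (P n)\<^sup>2\<bar> = \<bar>T n - 2 * ?s\<^sup>2\<bar> / real n ^ 6" by simp
      also have "\<dots> \<le> 36 * real (N n) ^ 5 / real n ^ 6"
        using embeddings_into_blowup(3)[OF parts N_def] unfolding T_def by (intro divide_right_mono) auto
      also have "\<dots> = 36 * (real (N n) / real n) ^ 5 * (1 / real n)"
        by (simp add: power_divide eval_nat_numeral)
      finally show "\<bar>T n / real n ^ 6 - 2 * (P n)\<^sup>2\<bar> \<le> 36 * (real (N n) / real n) ^ 5 * (1 / real n)" .
    qed
  qed
  have "(\<lambda>n. (T n / real n ^ 6 - 2 * (P n)\<^sup>2) + 2 * (P n)\<^sup>2) \<longlonglongrightarrow> 0 + 2 * (x 0 * x 1 * x 2)\<^sup>2"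
    by (intro tendsto_intros diff P)
  then have T: "(\<lambda>n. T n / real n ^ 6) \<longlonglongrightarrow> 2 * (x 0 * x 1 * x 2)\<^sup>2" by simp
  have "(\<lambda>n. T n / real n ^ 6 / 16 / (real (N n choose 6) / real (N n) ^ 6 * (real (N n) / real n) ^ 6))
      \<longlonglongrightarrow> 2 * (x 0 * x 1 * x 2)\<^sup>2 / 16 / (1 / 720 * 1 ^ 6)"
    by (intro tendsto_intros T ch N) simp_all
  moreover have "\<forall>\<^sub>F n in sequentially. T n / real n ^ 6 / 16 / (real (N n choose 6) / real (N n) ^ 6 * (real (N n) / real n) ^ 6)
      = induced_density F31 (blowup B31 (V n))"
  proof (rule eventually_mono[OF eventually_conj[OF eventually_gt_at_top[of 0] filterlim_at_top[THEN iffD1, rule_format, OF Ntop, of 1]]])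
    fix n assume n: "0 < n \<and> 1 \<le> N n"
    have "induced_density F31 (blowup B31 (V n)) = T n / 16 / real (N n choose 6)"
      unfolding density_eq_embeddings[OF embeddings_into_blowup(2)[OF parts N_def]] embeddings_into_blowup(1)[OF parts N_def] T_def ..
    then show "T n / real n ^ 6 / 16 / (real (N n choose 6) / real (N n) ^ 6 * (real (N n) / real n) ^ 6)
      = induced_density F31 (blowup B31 (V n))" using n by (simp add: power_divide field_simps)
  qed
  ultimately have "(\<lambda>n. induced_density F31 (blowup B31 (V n))) \<longlonglongrightarrow> 2 * (x 0 * x 1 * x 2)\<^sup>2 / 16 / (1 / 720 * 1 ^ 6)"
    by (rule Lim_transform_eventually)
  moreover have "2 * (x 0 * x 1 * x 2)\<^sup>2 / 16 / (1 / 720 * 1 ^ 6) = 90 * (x 0 * x 1 * x 2)\<^sup>2" by simp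
  ultimately show ?thesis by (simp only:)
qed

text \<open>Residue classes modulo \<open>3\<close> supply disjoint parts. Without such a sequence the defining
  condition of the blowup density would hold for every real number.\<close>

lemma blowup_sequence_exists:
  assumes x: "x \<in> unit_simplex 3"
  shows "\<exists>V :: nat \<Rightarrow> nat \<Rightarrow> nat set. (\<forall>n. blowup_parts B31 (V n)) \<and> (\<forall>i\<in>verts B31. (\<lambda>n. real (card (V n i)) / real n) \<longlonglongrightarrow> x i)"
proof -
  define V where "V n i = (\<lambda>k. 3 * k + i) ` {..<nat \<lfloor>x i * real n\<rfloor>}" for n i :: nat
  have "blowup_parts B31 (V n)" for n
  proof -
    have "i = j" if "i < 3" "j < 3" "w \<in> V n i" "w \<in> V n j" for i j w
    proof -
      have "w mod 3 = i" using that(1,3) unfolding V_def by auto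
      moreover have "w mod 3 = j" using that(2,4) unfolding V_def by auto
      ultimately show ?thesis by simp
    qed
    then have "disjoint_family_on (V n) {0..<3}" unfolding disjoint_family_on_def by (auto simp del: atLeastLessThan_iff simp: atLeastLessThan_iff)
    then show ?thesis unfolding blowup_parts_def by (simp add: B31_def V_def)
  qed
  moreover have "(\<lambda>n. real (card (V n i)) / real n) \<longlonglongrightarrow> x i" if i: "i \<in> verts B31" for i
  proof -
    have xi: "0 \<le> x i" using x i by (simp add: unit_simplex_def B31_def)
    have card: "card (V n i) = nat \<lfloor>x i * real n\<rfloor>" for n
      unfolding V_def by (subst card_image) (auto simp: inj_on_def)
    have b: "x i * real n - 1 \<le> real (card (V n i))" "real (card (V n i)) \<le> x i * real n" for n
    proof -
      have "0 \<le> x i * real n" using xi by simp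
      then show "x i * real n - 1 \<le> real (card (V n i))" "real (card (V n i)) \<le> x i * real n"
        unfolding card by linarith+
    qed
    have "(\<lambda>n. x i - 1 / real n) \<longlonglongrightarrow> x i - 0" by (intro tendsto_intros lim_1_over_n)
    then have lo: "(\<lambda>n. x i - 1 / real n) \<longlonglongrightarrow> x i" by simp
    show ?thesis
    proof (rule tendsto_sandwich[OF _ _ lo tendsto_const])
      show "\<forall>\<^sub>F n in sequentially. x i - 1 / real n \<le> real (card (V n i)) / real n"
      proof (rule eventually_mono[OF eventually_gt_at_top[of 0]])
        fix n :: nat assume "0 < n"
        then have "x i - 1 / real n = (x i * real n - 1) / real n" by (simp add: field_simps)
        then show "x i - 1 / real n \<le> real (card (V n i)) / real n"
          using divide_right_mono[OF b(1)[of n], of "real n"] by simp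
      qed
      show "\<forall>\<^sub>F n in sequentially. real (card (V n i)) / real n \<le> x i"
      proof (rule eventually_mono[OF eventually_gt_at_top[of 0]])
        fix n :: nat assume "0 < n"
        then show "real (card (V n i)) / real n \<le> x i" using b(2)[of n] by (simp add: field_simps)
      qed
    qed
  qed
  ultimately show ?thesis by blast
qed

lemma blowup_density_eq:
  assumes x: "x \<in> unit_simplex 3"
  shows "blowup_density F31 B31 x = 90 * (x 0 * x 1 * x 2)\<^sup>2"
  unfolding blowup_density_def
proof (rule the_equality)
  have "(\<Sum>i<3. x i) = 1" using x by (simp add: unit_simplex_def)
  then have total: "x 0 + x 1 + x 2 = 1" by (simp add: numeral_3_eq_3 numeral_2_eq_2)
  have limit: "(\<lambda>n. induced_density F31 (blowup B31 (V n))) \<longlonglongrightarrow> 90 * (x 0 * x 1 * x 2)\<^sup>2"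
    if "(\<forall>n. blowup_parts B31 (V n)) \<and> (\<forall>i\<in>verts B31. (\<lambda>n. real (card (V n i)) / real n) \<longlonglongrightarrow> x i)"
    for V :: "nat \<Rightarrow> nat \<Rightarrow> nat set"
    by (rule blowup_sequence_limit[OF _ _ total]) (use that in \<open>simp_all add: B31_def\<close>)
  then show "\<forall>V :: nat \<Rightarrow> nat \<Rightarrow> nat set. (\<forall>n. blowup_parts B31 (V n)) \<and>
      (\<forall>i\<in>verts B31. (\<lambda>n. real (card (V n i)) / real n) \<longlonglongrightarrow> x i) \<longrightarrow>
      (\<lambda>n. induced_density F31 (blowup B31 (V n))) \<longlonglongrightarrow> 90 * (x 0 * x 1 * x 2)\<^sup>2" by blast
  fix L assume L: "\<forall>V :: nat \<Rightarrow> nat \<Rightarrow> nat set. (\<forall>n. blowup_parts B31 (V n)) \<and>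
      (\<forall>i\<in>verts B31. (\<lambda>n. real (card (V n i)) / real n) \<longlonglongrightarrow> x i) \<longrightarrow>
      (\<lambda>n. induced_density F31 (blowup B31 (V n))) \<longlonglongrightarrow> L"
  obtain V :: "nat \<Rightarrow> nat \<Rightarrow> nat set" where
    V: "(\<forall>n. blowup_parts B31 (V n)) \<and> (\<forall>i\<in>verts B31. (\<lambda>n. real (card (V n i)) / real n) \<longlonglongrightarrow> x i)"
    using blowup_sequence_exists[OF x] by blast
  show "L = 90 * (x 0 * x 1 * x 2)\<^sup>2"
    by (rule LIMSEQ_unique[OF L[rule_format, OF V] limit[OF V]])
qed

text \<open>The inequality of the means with a remainder that shows when equality holds.\<close>

lemma am_gm_three:
  fixes a b c :: real
  assumes "0 \<le> a" "0 \<le> b" "0 \<le> c" "a + b + c = 1"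
  shows "((a - b)\<^sup>2 + (b - c)\<^sup>2 + (c - a)\<^sup>2) + 54 * (a * b * c) \<le> 2"
proof -
  define Q where "Q = (a - b)\<^sup>2 + (b - c)\<^sup>2 + (c - a)\<^sup>2"
  define R where "R = a * (b - c)\<^sup>2 + b * (c - a)\<^sup>2 + c * (a - b)\<^sup>2"
  define t where "t = a * b * c"
  have "2 * ((a + b + c) ^ 3 - 27 * t) = (a + b + c) * Q + 6 * R"
    unfolding t_def Q_def R_def by (simp add: power2_eq_square power3_eq_cube algebra_simps)
  then have "2 - 54 * t = Q + 6 * R" unfolding assms(4) by simp
  moreover have "0 \<le> R" unfolding R_def using assms(1-3) by simp
  ultimately have "Q + 54 * t \<le> 2" by linarith
  then show ?thesis unfolding t_def Q_def .
qed

lemma simplex_product_le: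
  assumes "x \<in> unit_simplex 3"
  shows "0 \<le> x 0 * x 1 * x 2" "x 0 * x 1 * x 2 \<le> 1 / 27"
    "1 / 27 \<le> x 0 * x 1 * x 2 \<Longrightarrow> i < 3 \<Longrightarrow> x i = 1 / 3"
proof -
  have nn: "0 \<le> x 0" "0 \<le> x 1" "0 \<le> x 2" and "(\<Sum>i<3. x i) = 1" using assms by (simp_all add: unit_simplex_def)
  then have total: "x 0 + x 1 + x 2 = 1" by (simp add: numeral_3_eq_3 numeral_2_eq_2)
  define q0 q1 q2 where "q0 = (x 0 - x 1)\<^sup>2" and "q1 = (x 1 - x 2)\<^sup>2" and "q2 = (x 2 - x 0)\<^sup>2"
  define t where "t = x 0 * x 1 * x 2"
  have am: "(q0 + q1 + q2) + 54 * t \<le> 2" unfolding q0_def q1_def q2_def t_def by (rule am_gm_three[OF nn total])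
  have q: "0 \<le> q0" "0 \<le> q1" "0 \<le> q2" unfolding q0_def q1_def q2_def by simp_all
  show "0 \<le> x 0 * x 1 * x 2" using nn by simp
  have "54 * t \<le> 2" using am q by linarith
  then show "x 0 * x 1 * x 2 \<le> 1 / 27" unfolding t_def by simp
  assume "1 / 27 \<le> x 0 * x 1 * x 2" and i: "i < 3"
  then have "2 \<le> 54 * t" unfolding t_def by simp
  then have "q0 \<le> 0" "q1 \<le> 0" using am q by linarith+
  then have "(x 0 - x 1)\<^sup>2 \<le> 0" "(x 1 - x 2)\<^sup>2 \<le> 0" unfolding q0_def q1_def .
  then have "x 0 = x 1" "x 1 = x 2" by simp_all
  moreover have "i = 0 \<or> i = 1 \<or> i = 2" using i by linarith
  ultimately show "x i = 1 / 3" using total by auto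
qed

lemma barycentre_simplex: "barycentre \<in> unit_simplex 3"
  by (simp add: unit_simplex_def barycentre_def)

lemma blowup_density_barycentre: "blowup_density F31 B31 barycentre = 90 * (1 / 27)\<^sup>2"
  unfolding blowup_density_eq[OF barycentre_simplex] by (simp add: barycentre_def)

theorem theorem3p14:
  shows "(convergent (max_density F31) \<and> inducibility F31 = 10/81) \<and>
         perfectly_stable F31 B31 \<and>
         is_arg_max (blowup_density F31 B31) (\<lambda>x. x \<in> unit_simplex 3) barycentre \<and>
         (\<forall>x. is_arg_max (blowup_density F31 B31) (\<lambda>x. x \<in> unit_simplex 3) x \<longrightarrow>
            (\<exists>\<sigma>. pattern_aut B31 \<sigma> \<and> (\<forall>i<3. x i = barycentre (\<sigma> i))))"
proof (intro conjI allI impI)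
  show "convergent (max_density F31)" using max_density_limit by (rule convergentI)
  show "inducibility F31 = 10/81" unfolding inducibility_def by (rule limI[OF max_density_limit])
  show "perfectly_stable F31 B31" by (rule F31_perfectly_stable)
  have "blowup_density F31 B31 y \<le> blowup_density F31 B31 barycentre" if y: "y \<in> unit_simplex 3" for y
    unfolding blowup_density_barycentre blowup_density_eq[OF y]
    using power_mono[OF simplex_product_le(2,1)[OF y], of 2] by simp
  then show "is_arg_max (blowup_density F31 B31) (\<lambda>x. x \<in> unit_simplex 3) barycentre"
    unfolding is_arg_max_def using barycentre_simplex by (auto simp: not_less)
  fix x assume "is_arg_max (blowup_density F31 B31) (\<lambda>x. x \<in> unit_simplex 3) x"
  then have x: "x \<in> unit_simplex 3" and "\<not> blowup_density F31 B31 x < blowup_density F31 B31 barycentre"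
    unfolding is_arg_max_def using barycentre_simplex by blast+
  then have "(1 / 27)\<^sup>2 \<le> (x 0 * x 1 * x 2)\<^sup>2"
    unfolding blowup_density_barycentre blowup_density_eq[OF x] by simp
  then have "1 / 27 \<le> x 0 * x 1 * x 2" using simplex_product_le(1)[OF x] by (rule power2_le_imp_le)
  then have "x i = barycentre i" if "i < 3" for i
    using simplex_product_le(3)[OF x _ that] that by (simp add: barycentre_def)
  moreover have "pattern_aut B31 id" by (simp add: pattern_aut_def pattern_iso_def)
  ultimately show "\<exists>\<sigma>. pattern_aut B31 \<sigma> \<and> (\<forall>i<3. x i = barycentre (\<sigma> i))"
    by (intro exI[of _ id]) simp
qed

end
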